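(* Let $K$ be a multi-quadratic number field containing $\mathbb{Q}(\sqrt{-3})$. Then $J_1(3,9)(K)_{\mathrm{tors}} = J_1(3,9)(\mathbb{Q}(\sqrt{-3})) \cong \mathbb{Z}/3 \times \mathbb{Z}/3$.
   Context: A multi-quadratic number field is a number field which is a compositum of quadratic number fields. For positive integers $M,N$, $X_1(M,MN)$ is the modular curve (coarse moduli space) attached to the level structure $\Gamma_1(M,MN) = \{\begin{pmatrix}1&b\\0&d\end{pmatrix} \in \mathrm{GL}_2(\mathbb{Z}/MN) : b \equiv 0,\ d\equiv 1 \bmod M\}$; it is defined over $\mathbb{Q}(\zeta_M)$, and $J_1(M,MN)$ denotes its Jacobian. Here $X_1(3,9)$ is defined over $\mathbb{Q}(\sqrt{-3}) = \mathbb{Q}(\zeta_3)$; it is the base change of the elliptic curve with Cremona label 27a3. *)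

theory Defs
  imports "HOL-Algebra.Algebraic_Closure_Type" "HOL-Algebra.Generated_Fields"
    "HOL-Algebra.Elementary_Groups"
begin

subsection \<open>Multi-quadratic number fields\<close>

text \<open>
  Number fields are represented as subfields of an arbitrary ambient field of characteristic
  zero (a type of class \<^class>\<open>field_char_0\<close>). The rationals are the set
  \<^term>\<open>\<rat>\<close> in that type. The abstract field may itself be the whole type, so this is
  no restriction on the field.
\<close>

abbreviation ambient :: "'a::field_char_0 ring" where
  "ambient \<equiv> ring_of_type_algebra"

definition number_field :: "'a::field_char_0 set \<Rightarrow> bool" where
  "number_field K \<longleftrightarrow> subfield K ambient \<and> ring.finite_dimension ambient \<rat> K"

definition quadratic_number_field :: "'a::field_char_0 set \<Rightarrow> bool" where
  "quadratic_number_field F \<longleftrightarrow> subfield F ambient \<and> ring.dimension ambient 2 \<rat> F"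

definition multiquadratic_number_field :: "'a::field_char_0 set \<Rightarrow> bool" where
  "multiquadratic_number_field K \<longleftrightarrow> number_field K \<and>
     (\<exists>\<F>. (\<forall>F\<in>\<F>. quadratic_number_field F) \<and> K = generate_field ambient (\<Union>\<F>))"

definition rat_adjoin :: "'a::field_char_0 \<Rightarrow> 'a set" where
  "rat_adjoin r = generate_field ambient {r}"


subsection \<open>Weierstrass curves and their groups of rational points\<close>

text \<open>
  The curve $y^2 + a_1 x y + a_3 y = x^3 + a_2 x^2 + a_4 x + a_6$, with the chord-and-tangent
  addition whose neutral element is the point at infinity.
\<close>

record 'a weierstrass =
  a1 :: 'a
  a2 :: 'a
  a3 :: 'a
  a4 :: 'a
  a6 :: 'a

datatype 'a point = At_Infinity | Affine 'a 'a

fun on_curve :: "'a::field weierstrass \<Rightarrow> 'a point \<Rightarrow> bool" where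
  "on_curve W At_Infinity \<longleftrightarrow> True"
| "on_curve W (Affine x y) \<longleftrightarrow>
     y^2 + a1 W * x * y + a3 W * y = x^3 + a2 W * x^2 + a4 W * x + a6 W"

fun defined_over :: "'a set \<Rightarrow> 'a point \<Rightarrow> bool" where
  "defined_over K At_Infinity \<longleftrightarrow> True"
| "defined_over K (Affine x y) \<longleftrightarrow> x \<in> K \<and> y \<in> K"

text \<open>
  The third intersection point of the curve with the line of slope \<open>l\<close> through
  \<open>(x1, y1)\<close> and \<open>(x2, y2)\<close> has abscissa \<open>x3\<close>; the sum is its
  negative, where $-(x, y) = (x, -y - a_1 x - a_3)$.
\<close>

definition line_sum :: "'a::field weierstrass \<Rightarrow> 'a \<Rightarrow> 'a \<Rightarrow> 'a \<Rightarrow> 'a \<Rightarrow> 'a point" where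
  "line_sum W l x1 y1 x2 =
     (let x3 = l^2 + a1 W * l - a2 W - x1 - x2;
          y3 = y1 + l * (x3 - x1)
      in Affine x3 (- y3 - a1 W * x3 - a3 W))"

fun point_add :: "'a::field weierstrass \<Rightarrow> 'a point \<Rightarrow> 'a point \<Rightarrow> 'a point" where
  "point_add W At_Infinity Q = Q"
| "point_add W P At_Infinity = P"
| "point_add W (Affine x1 y1) (Affine x2 y2) =
     (if x1 \<noteq> x2 then line_sum W ((y2 - y1) / (x2 - x1)) x1 y1 x2
      else if y1 + y2 + a1 W * x2 + a3 W = 0 then At_Infinity
      else line_sum W
        ((3 * x1^2 + 2 * a2 W * x1 + a4 W - a1 W * y1) / (2 * y1 + a1 W * x1 + a3 W)) x1 y1 x2)"

definition rational_points :: "'a::field weierstrass \<Rightarrow> 'a set \<Rightarrow> 'a point monoid" where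
  "rational_points W K =
     \<lparr>carrier = {P. on_curve W P \<and> defined_over K P},
      monoid.mult = point_add W, one = At_Infinity\<rparr>"

definition torsion_subgroup :: "'b monoid \<Rightarrow> 'b monoid" where
  "torsion_subgroup G =
     G\<lparr>carrier := {P \<in> carrier G. \<exists>n::nat. n > 0 \<and> P [^]\<^bsub>G\<^esub> n = \<one>\<^bsub>G\<^esub>}\<rparr>"


subsection \<open>The Jacobian of $X_1(3,9)$\<close>

text \<open>The elliptic curve with Cremona label 27a3, $y^2 + y = x^3$ (discriminant $-27$).\<close>

definition curve_27a3 :: "'a::field_char_0 weierstrass" where
  "curve_27a3 = \<lparr>a1 = 0, a2 = 0, a3 = 1, a4 = 0, a6 = 0\<rparr>"

text \<open>
  The modular curve $X_1(3,9)$ over $\mathbb{Q}(\sqrt{-3})$ is the base change of 27a3. Being an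
  elliptic curve, it is its own Jacobian, via $P \mapsto [P - O]$; the group law on divisor
  classes of degree zero is then the chord-and-tangent law. For a subfield \<open>K\<close> containing
  $\mathbb{Q}(\sqrt{-3})$, the group $J_1(3,9)(K)$ is therefore the group of \<open>K\<close>-rational points
  of 27a3.
\<close>

definition J1_3_9 :: "'a::field_char_0 set \<Rightarrow> 'a point monoid" where
  "J1_3_9 K = rational_points curve_27a3 K"

end

theory Submission
  imports Defs "HOL-Library.Set_Algebras"
begin

text \<open>
  The curve $E : y^2 + y = x^3$ has good supersingular reduction at 2 with nine points over
  $\mathbb{F}_4$, all of them killed by 3. A multi-quadratic field embeds into a tower over
  $\mathbb{Q}(\sqrt{-3}, i, \sqrt{2})$ obtained by adjoining square roots of integers congruent
  to 1 modulo 8, so the units of a valuation ring above 2 satisfy $u^3 \equiv 1$ and the point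
  $3P$ lies in the kernel of reduction, which has no odd torsion. There is no 2-torsion because
  $-1/4$ is not a cube in a tower of quadratic extensions. Hence all torsion over $K$ is killed
  by 3, and $E[3]$ consists of nine points over $\mathbb{Q}(\omega)$.

  Conversely, for a point over $\mathbb{Q}(\omega)$ the ordinate is a unit times a cube;
  after translating by a 3-torsion point the unit disappears, and $y$, $y + 1$ are both cubes,
  so that Fermat's theorem for exponent 3 over the Eisenstein integers applies.
  Associativity of the group law comes from identifying point addition with multiplication of
  ideal classes of the affine coordinate ring.
\<close>

subsection \<open>Ideals and ideal classes\<close>

text \<open>Modulo squares the 2-adic numbers are generated by -1, 2 and -3, so locally at 2 every
  quadratic field is part of one finite extension, whose residue field is F_4: sqrt(-3) is the
  unramified step, i and sqrt(2) ramify, and a square root of 1 + 8k is already 2-adic. This is why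
  the degree of K never matters. Completions are replaced by a valuation ring obtained from Zorn's
  lemma. As K need not contain i or sqrt(2), the ring lives in an algebraic closure and is pulled
  back to the type of K. Its value group is unknown, so it is handled by divisibility alone;
  discreteness is proved only for the small base field. Reduction at 2 controls odd torsion only,
  hence the separate treatment of 2-torsion. Over Q(omega) the descent uses that the function y has
  divisor 3(0,0) - 3O, so y modulo cubes is multiplicative on points. The primitive cube roots of
  unity are ordinates of 3-torsion points with abscissa -1, which realise the nontrivial classes of
  units modulo cubes.\<close>

inductive_set ideal_span :: "'r::comm_ring_1 set \<Rightarrow> 'r set" for S where
  zero: "0 \<in> ideal_span S"
| scaled: "s \<in> S \<Longrightarrow> r * s \<in> ideal_span S"
| add: "a \<in> ideal_span S \<Longrightarrow> b \<in> ideal_span S \<Longrightarrow> a + b \<in> ideal_span S"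

lemma ideal_span_base: "s \<in> S \<Longrightarrow> s \<in> ideal_span S"
  using ideal_span.scaled[of s S 1] by simp

lemma ideal_span_scale: "a \<in> ideal_span S \<Longrightarrow> r * a \<in> ideal_span S"
proof (induction rule: ideal_span.induct)
  case (scaled s r') then show ?case using ideal_span.scaled[of s S "r * r'"] by (simp add: mult.assoc)
qed (auto simp: distrib_left intro: ideal_span.intros)

lemma ideal_span_diff: "a \<in> ideal_span S \<Longrightarrow> b \<in> ideal_span S \<Longrightarrow> a - b \<in> ideal_span S"
  using ideal_span.add[of a S "-b"] ideal_span_scale[of b S "-1"] by simp

lemma ideal_span_minimal: "S \<subseteq> ideal_span T \<Longrightarrow> ideal_span S \<subseteq> ideal_span T"
proof
  fix x assume "S \<subseteq> ideal_span T" "x \<in> ideal_span S"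
  from this(2,1) show "x \<in> ideal_span T"
    by (induction rule: ideal_span.induct) (auto intro: ideal_span.zero ideal_span.add ideal_span_scale)
qed

lemma ideal_span_single: "ideal_span {h} = {r * h |r. True}"
proof
  show "ideal_span {h} \<subseteq> {r * h |r. True}"
  proof
    fix x assume "x \<in> ideal_span {h}"
    then show "x \<in> {r * h |r. True}"
    proof (induction rule: ideal_span.induct)
      case zero
      have "0 = 0 * h" by simp
      then show ?case by blast
    next
      case (add a b)
      then show ?case by (auto simp: distrib_right[symmetric])
    qed auto
  qed
qed (auto intro: ideal_span.scaled)

lemma ideal_span_mult_right:
  assumes "a \<in> ideal_span S" "t \<in> T"
  shows "a * t \<in> ideal_span (S * T)"
  using assms
proof (induction rule: ideal_span.induct)
  case (scaled s r)
  then have "s * t \<in> S * T" by (auto simp: set_times_def)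
  from ideal_span.scaled[OF this] show ?case by (simp add: mult.assoc)
qed (auto simp: distrib_right intro: ideal_span.intros)

lemma ideal_span_mult_cong:
  assumes "ideal_span S = ideal_span S'"
  shows "ideal_span (S * T) = ideal_span (S' * T)"
proof -
  have "ideal_span (S * T) \<subseteq> ideal_span (S' * T)" if "ideal_span S = ideal_span S'" for S S'
  proof (rule ideal_span_minimal, rule subsetI)
    fix x assume "x \<in> S * T"
    then obtain s t where x: "s \<in> S" "t \<in> T" "x = s * t" by (auto simp: set_times_def)
    then have "s \<in> ideal_span S'" using that ideal_span_base by blast
    then show "x \<in> ideal_span (S' * T)" using ideal_span_mult_right x by blast
  qed
  from this[OF assms] this[OF assms[symmetric]] show ?thesis by blast
qed

lemma ideal_span_mult_single: "ideal_span ({f} * S) = (*) f ` ideal_span S"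
proof
  show "ideal_span ({f} * S) \<subseteq> (*) f ` ideal_span S"
  proof
    fix x assume "x \<in> ideal_span ({f} * S)"
    then show "x \<in> (*) f ` ideal_span S"
    proof (induction rule: ideal_span.induct)
      case zero then show ?case using ideal_span.zero by force
    next
      case (scaled s r)
      then obtain t where "t \<in> S" "s = f * t" by (auto simp: set_times_def)
      then have "r * s = f * (r * t)" "r * t \<in> ideal_span S"
        by (auto intro: ideal_span.scaled simp: algebra_simps)
      then show ?case by blast
    next
      case (add a b)
      then show ?case using ideal_span.add by (force simp: distrib_left[symmetric])
    qed
  qed
  show "(*) f ` ideal_span S \<subseteq> ideal_span ({f} * S)"
  proof
    fix x assume "x \<in> (*) f ` ideal_span S"
    then obtain a where "a \<in> ideal_span S" "x = f * a" by auto
    then show "x \<in> ideal_span ({f} * S)"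
      using ideal_span_mult_right[of a S f "{f}"] by (simp add: mult.commute)
  qed
qed

text \<open>Equality of ideal classes, with ideals given by generating sets so that products are
  computed on generators. Scaling both sides avoids fractional ideals.\<close>

definition same_class :: "'r::idom set \<Rightarrow> 'r set \<Rightarrow> bool" where
  "same_class S T \<longleftrightarrow> (\<exists>f g. f \<noteq> 0 \<and> g \<noteq> 0 \<and> ideal_span ({f} * S) = ideal_span ({g} * T))"

lemma same_class_refl: "same_class S S"
  unfolding same_class_def by (rule exI[of _ 1], rule exI[of _ 1]) simp

lemma same_class_sym: "same_class S T \<Longrightarrow> same_class T S"
  unfolding same_class_def by metis

lemma singleton_times_singleton: "{f} * {g} = {f * g}"
  by (auto simp: set_times_def)

lemma one_times_set [simp]: "{1} * S = (S :: 'r::comm_monoid_mult set)"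
  by (auto simp: set_times_def)

lemma times_one_set: "S * {1} = (S :: 'r::comm_monoid_mult set)"
  by (auto simp: set_times_def)

lemma same_class_trans:
  assumes "same_class S T" "same_class T U" shows "same_class S U"
proof -
  obtain f g where fg: "f \<noteq> 0" "g \<noteq> 0" "ideal_span ({f} * S) = ideal_span ({g} * T)"
    using assms(1) unfolding same_class_def by blast
  obtain f' g' where fg': "f' \<noteq> 0" "g' \<noteq> 0" "ideal_span ({f'} * T) = ideal_span ({g'} * U)"
    using assms(2) unfolding same_class_def by blast
  have "ideal_span ({f' * f} * S) = ideal_span ({f} * S * {f'})"
    by (simp flip: singleton_times_singleton add: ac_simps)
  also have "\<dots> = ideal_span ({g} * T * {f'})" using fg(3) by (rule ideal_span_mult_cong)
  also have "\<dots> = ideal_span ({f'} * T * {g})" by (simp add: ac_simps)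
  also have "\<dots> = ideal_span ({g'} * U * {g})" using fg'(3) by (rule ideal_span_mult_cong)
  also have "\<dots> = ideal_span ({g * g'} * U)"
    by (simp flip: singleton_times_singleton add: ac_simps)
  finally show ?thesis unfolding same_class_def
    using fg fg' by (intro exI[of _ "f' * f"] exI[of _ "g * g'"]) auto
qed

lemma same_class_mult:
  assumes "same_class S T" shows "same_class (S * U) (T * U)"
proof -
  obtain f g where fg: "f \<noteq> 0" "g \<noteq> 0" "ideal_span ({f} * S) = ideal_span ({g} * T)"
    using assms unfolding same_class_def by blast
  from ideal_span_mult_cong[OF this(3), of U] fg(1,2) show ?thesis
    unfolding same_class_def by (auto simp: mult.assoc)
qed

text \<open>From f I = (g) the element g lies in f I, so g = f h; cancelling f leaves I =
  (h).\<close>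

lemma same_class_principal:
  assumes "same_class S {1}"
  obtains h where "h \<noteq> 0" "ideal_span S = ideal_span {h}"
proof -
  obtain f g where fg: "f \<noteq> 0" "g \<noteq> 0" "ideal_span ({f} * S) = ideal_span ({g} * {1})"
    using assms unfolding same_class_def by blast
  have "g \<in> ideal_span ({f} * S)" by (simp add: fg(3) ideal_span_base singleton_times_singleton)
  then obtain h where h: "h \<in> ideal_span S" "g = f * h" by (auto simp: ideal_span_mult_single)
  have "(*) f ` ideal_span S = (*) f ` ideal_span {h}"
    using fg(3) h(2) by (simp add: singleton_times_singleton flip: ideal_span_mult_single)
  then have "ideal_span S = ideal_span {h}"
    by (rule inj_image_eq_iff[THEN iffD1, rotated]) (use fg(1) in \<open>auto simp: inj_on_def\<close>)
  with h fg that show ?thesis by auto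
qed

subsection \<open>Polynomial functions on the affine curve\<close>

text \<open>\<open>Cfun p q\<close> stands for the function $p(x) + q(x) y$, with $y^2 = x^3 - y$.\<close>

context notes [[typedef_overloaded]]
begin
datatype 'a cfun = Cfun (xpart: "'a::zero poly") (ypart: "'a poly")
end

definition xcube :: "'a::comm_ring_1 poly" where "xcube = [:0, 0, 0, 1:]"

instantiation cfun :: (field) comm_ring_1
begin

definition "0 = Cfun 0 0"
definition "1 = Cfun 1 0"
definition "f + g = Cfun (xpart f + xpart g) (ypart f + ypart g)"
definition "f - g = Cfun (xpart f - xpart g) (ypart f - ypart g)"
definition "- f = Cfun (- xpart f) (- ypart f)"
definition "f * g = Cfun (xpart f * xpart g + ypart f * ypart g * xcube)
   (xpart f * ypart g + ypart f * xpart g - ypart f * ypart g)"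

instance
  by standard
    (auto simp: zero_cfun_def one_cfun_def plus_cfun_def minus_cfun_def uminus_cfun_def times_cfun_def
      intro!: cfun.expand simp: algebra_simps)

end

lemma cfun_sel [simp]:
  "xpart 0 = 0" "ypart 0 = 0" "xpart 1 = 1" "ypart 1 = 0"
  "xpart (f + g) = xpart f + xpart g" "ypart (f + g) = ypart f + ypart g"
  "xpart (f - g) = xpart f - xpart g" "ypart (f - g) = ypart f - ypart g"
  "xpart (- f) = - xpart f" "ypart (- f) = - ypart f"
  "xpart (f * g) = xpart f * xpart g + ypart f * ypart g * xcube"
  "ypart (f * g) = xpart f * ypart g + ypart f * xpart g - ypart f * ypart g"
  by (simp_all add: zero_cfun_def one_cfun_def plus_cfun_def minus_cfun_def uminus_cfun_def times_cfun_def)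

text \<open>The product of f with its conjugate under y -> -1 - y, a polynomial in x alone.\<close>

definition cfun_norm :: "'a::field cfun \<Rightarrow> 'a poly" where
  "cfun_norm f = xpart f * xpart f - xpart f * ypart f - ypart f * ypart f * xcube"

lemma cfun_norm_mult: "cfun_norm (f * g) = cfun_norm f * cfun_norm g"
  unfolding cfun_norm_def cfun_sel by Groebner_Basis.algebra

text \<open>The terms p^2 and q^2 x^3 have degrees of different parity, so the leading terms cannot
  cancel; p q never dominates. The degree of the norm is the pole order at infinity, and this bound
  replaces Riemann-Roch below.\<close>

lemma degree_cfun_norm_ge:
  fixes f :: "'a::field cfun"
  assumes "ypart f \<noteq> 0" shows "degree (cfun_norm f) \<ge> 3"
proof -
  let ?p = "xpart f" and ?q = "ypart f"
  have q: "degree (?q * ?q * xcube) = 2 * degree ?q + 3"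
    using assms by (simp add: degree_mult_eq xcube_def del: mult_pCons_right)
  show ?thesis
  proof (cases "degree ?p \<ge> degree ?q + 2")
    case True
    then have p: "degree (?p * ?p) = 2 * degree ?p" by (cases "?p = 0") (auto simp: degree_mult_eq)
    have "degree (?p * ?q) < degree (?p * ?p)"
      using True p degree_mult_le[of ?p ?q] by linarith
    moreover have "degree (?q * ?q * xcube) < degree (?p * ?p)" using True p q by linarith
    ultimately have "degree (?p * ?q + ?q * ?q * xcube) < degree (?p * ?p)"
      by (rule degree_add_less)
    then have "degree (?p * ?p + - (?p * ?q + ?q * ?q * xcube)) = degree (?p * ?p)"
      by (intro degree_add_eq_left) (simp only: degree_minus)
    also have "?p * ?p + - (?p * ?q + ?q * ?q * xcube) = cfun_norm f"
      unfolding cfun_norm_def by (simp add: algebra_simps)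
    finally show ?thesis using p True by linarith
  next
    case False
    have "degree (?p * ?p) \<le> 2 * degree ?p" using degree_mult_le[of ?p ?p] by simp
    then have a: "degree (?p * ?p) < degree (?q * ?q * xcube)" using False q by linarith
    have b: "degree (?p * ?q) < degree (?q * ?q * xcube)"
      using False q degree_mult_le[of ?p ?q] by linarith
    have "degree (?p * ?p - ?p * ?q) < degree (?q * ?q * xcube)"
      by (rule degree_diff_less[OF a b])
    then have "degree ((?p * ?p - ?p * ?q) + - (?q * ?q * xcube)) = degree (- (?q * ?q * xcube))"
      by (intro degree_add_eq_right) (simp only: degree_minus)
    then have "degree (cfun_norm f) = 2 * degree ?q + 3"
      using q unfolding cfun_norm_def by (simp only: degree_minus diff_conv_add_uminus)
    then show ?thesis by simp
  qed
qed

lemma cfun_norm_nonzero: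
  assumes "f \<noteq> 0" shows "cfun_norm f \<noteq> 0"
proof (cases "ypart f = 0")
  case True
  then have "xpart f \<noteq> 0" using assms by (metis cfun.expand cfun_sel(1,2))
  then show ?thesis using True by (simp add: cfun_norm_def)
next
  case False
  then show ?thesis using degree_cfun_norm_ge[OF False] by auto
qed

instance cfun :: (field) idom
proof
  fix a b :: "'a cfun" assume "a \<noteq> 0" "b \<noteq> 0"
  then have "cfun_norm (a * b) \<noteq> 0" by (simp add: cfun_norm_mult cfun_norm_nonzero)
  then show "a * b \<noteq> 0" by (metis cfun_norm_def cfun_sel(1,2) diff_0_right mult_zero_left)
qed

abbreviation fX :: "'a::field cfun" where "fX \<equiv> Cfun [:0, 1:] 0"
abbreviation fY :: "'a::field cfun" where "fY \<equiv> Cfun 0 1"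

definition const :: "'a::field \<Rightarrow> 'a cfun" where "const c = Cfun [:c:] 0"

lemma const_hom:
  "const 0 = 0" "const 1 = 1" "const (a + b) = const a + const b" "const (a - b) = const a - const b"
  "const (- a) = - const a" "const (a * b) = const a * const b" "const (a ^ n) = const a ^ n"
  "const (numeral k) = numeral k"
proof -
  show m: "const (a * b) = const a * const b" and p: "const (a + b) = const a + const b"
    and one: "const 1 = 1" and "const 0 = 0" "const (a - b) = const a - const b" "const (- a) = - const a"
    for a b by (auto simp: const_def intro!: cfun.expand)
  show "const (a ^ n) = const a ^ n" by (induction n) (auto simp: m one)
  show "const (numeral k) = numeral k" by (induction k) (auto simp only: numeral.simps p one)
qed

lemma fXY_relation: "fY * fY + fY = fX * fX * (fX :: 'a::field cfun)"
  by (rule cfun.expand) (simp add: xcube_def)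

section \<open>Points as maximal ideals of the coordinate ring\<close>

definition cfun_eval :: "'a::field \<Rightarrow> 'a \<Rightarrow> 'a cfun \<Rightarrow> 'a" where
  "cfun_eval x y f = poly (xpart f) x + poly (ypart f) x * y"

lemma cfun_eval_mult:
  assumes "y ^ 2 + y = x ^ 3"
  shows "cfun_eval x y (f * g) = cfun_eval x y f * cfun_eval x y g"
proof -
  have "x * (x * x) = y * y + y" using assms by (simp add: power2_eq_square power3_eq_cube)
  then show ?thesis unfolding cfun_eval_def cfun_sel
    by (simp add: algebra_simps xcube_def) Groebner_Basis.algebra
qed

text \<open>Generators of the maximal ideal of an affine point. The point at infinity is missing
  from the affine curve, so it gets the unit ideal.\<close>

fun vanishing :: "'a::field point \<Rightarrow> 'a cfun set" where
  "vanishing At_Infinity = {1}"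
| "vanishing (Affine x y) = {fX - const x, fY - const y}"

subsection \<open>The chord-and-tangent law as multiplication of ideal classes\<close>

abbreviation E :: "'a::field_char_0 weierstrass" where "E \<equiv> curve_27a3"

abbreviation padd :: "'a::field_char_0 point \<Rightarrow> 'a point \<Rightarrow> 'a point" (infixl "\<oplus>\<^sub>E" 65) where
  "P \<oplus>\<^sub>E Q \<equiv> point_add curve_27a3 P Q"

fun pneg :: "'a::field_char_0 point \<Rightarrow> 'a point" where
  "pneg At_Infinity = At_Infinity"
| "pneg (Affine x y) = Affine x (- y - 1)"

lemma curve_27a3_sel [simp]:
  "a1 curve_27a3 = 0" "a2 curve_27a3 = 0" "a3 curve_27a3 = 1" "a4 curve_27a3 = 0" "a6 curve_27a3 = 0"
  by (simp_all add: curve_27a3_def)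

lemma on_E: "on_curve curve_27a3 (Affine x y) \<longleftrightarrow> y ^ 2 + y = x ^ 3"
  by (simp add: curve_27a3_def)

definition slope :: "'a::field_char_0 \<Rightarrow> 'a \<Rightarrow> 'a \<Rightarrow> 'a \<Rightarrow> 'a" where
  "slope x1 y1 x2 y2 = (if x1 \<noteq> x2 then (y2 - y1) / (x2 - x1) else 3 * x1 ^ 2 / (2 * y1 + 1))"

text \<open>Subtracting the curve equations at equal abscissae gives (y1 - y2)(y1 + y2 + 1) = 0, so
  the points are equal or opposite. In the chord case (x3, y3) is the third intersection point and
  the sum is its negative.\<close>

lemma padd_cases:
  fixes x1 y1 x2 y2 :: "'a::field_char_0"
  assumes on: "y1 ^ 2 + y1 = x1 ^ 3" "y2 ^ 2 + y2 = x2 ^ 3"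
  obtains (opposite) "x2 = x1" "y2 = - y1 - 1" "Affine x1 y1 \<oplus>\<^sub>E Affine x2 y2 = At_Infinity"
  | (chord) l x3 y3 where "l = slope x1 y1 x2 y2" "x1 \<noteq> x2 \<or> x1 = x2 \<and> y1 = y2 \<and> 2 * y1 + 1 \<noteq> 0"
     "x3 = l ^ 2 - x1 - x2" "y3 = y1 + l * (x3 - x1)"
     "Affine x1 y1 \<oplus>\<^sub>E Affine x2 y2 = Affine x3 (- y3 - 1)"
proof (cases "x1 = x2")
  case False
  then show ?thesis using chord[OF refl _ refl refl]
    by (simp add: line_sum_def curve_27a3_def slope_def Let_def)
next
  case True
  show ?thesis
  proof (cases "y1 + y2 + 1 = 0")
    case z: True
    then have "y2 = - y1 - 1" by (simp add: algebra_simps eq_neg_iff_add_eq_0)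
    then show ?thesis using opposite True z by (simp add: curve_27a3_def)
  next
    case nz: False
    have "(y1 - y2) * (y1 + y2 + 1) = (y1 ^ 2 + y1) - (y2 ^ 2 + y2)"
      by (simp add: algebra_simps power2_eq_square)
    then have "(y1 - y2) * (y1 + y2 + 1) = 0" by (simp only: on True diff_self)
    with nz have y: "y1 = y2" by simp
    then have n: "2 * y1 + 1 \<noteq> 0" using nz unfolding mult_2 by metis
    moreover have "Affine x1 y1 \<oplus>\<^sub>E Affine x1 y1 = line_sum E (slope x1 y1 x1 y1) x1 y1 x1"
      using n by (simp add: slope_def)
    ultimately show ?thesis using chord[OF refl _ refl refl] y True
      by (simp add: line_sum_def Let_def del: point_add.simps)
  qed
qed

text \<open>Substituting y = l x + b into the curve gives x^3 - l^2 x^2 - (2lb + l) x - (b^2 + b)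
  with roots x1, x2, x3. The choice of \<open>x3\<close> is the first Vieta relation; these are the
  other two.\<close>

lemma line_vieta:
  fixes x1 y1 x2 y2 :: "'a::field_char_0"
  assumes on: "y1 ^ 2 + y1 = x1 ^ 3" "y2 ^ 2 + y2 = x2 ^ 3"
    and l: "l = slope x1 y1 x2 y2" and ne: "x1 \<noteq> x2 \<or> x1 = x2 \<and> y1 = y2 \<and> 2 * y1 + 1 \<noteq> 0"
    and x3: "x3 = l ^ 2 - x1 - x2" and b: "b = y1 - l * x1"
  shows "y2 = l * x2 + b" "x1 * x2 + x1 * x3 + x2 * x3 = - (2 * l * b + l)" "x1 * x2 * x3 = b ^ 2 + b"
proof -
  have 1: "y2 = l * x2 + b \<and> x1 * x2 + x1 * x3 + x2 * x3 = - (2 * l * b + l)"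
  proof (cases "x1 = x2")
    case False
    then have lx: "l * (x2 - x1) = y2 - y1" using l by (simp add: slope_def)
    then have y2: "y2 = l * x2 + b" using b by Groebner_Basis.algebra
    \<comment> \<open>The difference of the two curve equations carries the factor x2 - x1, which is
      cancelled afterwards; in the tangent case the slope equation takes this role.\<close>
    have "(x2 - x1) * (x1 * x2 + x1 * x3 + x2 * x3 + (2 * l * b + l)) = 0"
      using on y2 b x3 by Groebner_Basis.algebra
    then show ?thesis using False y2 by (simp only: eq_neg_iff_add_eq_0 mult_eq_0_iff) simp
  next
    case True
    then have lx: "l * (2 * y1 + 1) = 3 * x1 ^ 2" and n: "2 * y1 + 1 \<noteq> 0" "x2 = x1" "y2 = y1"
      using l ne by (auto simp: slope_def)
    have "x1 * x2 + x1 * x3 + x2 * x3 + (2 * l * b + l) = 0" using lx n(2,3) b x3 by Groebner_Basis.algebra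
    then show ?thesis using b n by (simp only: eq_neg_iff_add_eq_0) simp
  qed
  then show "y2 = l * x2 + b" "x1 * x2 + x1 * x3 + x2 * x3 = - (2 * l * b + l)" by auto
  then show "x1 * x2 * x3 = b ^ 2 + b" using on b x3 by Groebner_Basis.algebra
qed

lemma on_curve_padd:
  fixes P Q :: "'a::field_char_0 point"
  assumes "on_curve E P" "on_curve E Q" shows "on_curve E (P \<oplus>\<^sub>E Q)"
proof (cases P; cases Q)
  fix x1 y1 x2 y2 assume PQ: "P = Affine x1 y1" "Q = Affine x2 y2"
  have on: "y1 ^ 2 + y1 = x1 ^ 3" "y2 ^ 2 + y2 = x2 ^ 3" using assms PQ by auto
  show ?thesis
  proof (cases rule: padd_cases[OF on])
    case (2 l x3 y3)
    note chord = 2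
    define b where "b = y1 - l * x1"
    note v = line_vieta[OF on chord(1,2,3) b_def]
    have "(- y3 - 1) ^ 2 + (- y3 - 1) = x3 ^ 3"
      using v(2,3) chord(3,4) b_def by Groebner_Basis.algebra
    then show ?thesis using chord(5) PQ by simp
  qed (use assms PQ in auto)
qed (use assms in auto)

lemma pneg_on_curve: "on_curve E P \<Longrightarrow> on_curve E (pneg P)"
  by (cases P) (auto simp: power2_eq_square algebra_simps)

text \<open>The vertical line x = x0 meets the affine curve exactly in P and -P, so the product
  ideal is generated by x - x0.\<close>

lemma vanishing_pneg:
  fixes P :: "'a::field_char_0 point"
  assumes "on_curve E P"
  shows "same_class (vanishing P * vanishing (pneg P)) {1}"
proof (cases P)
  case (Affine x0 y0)
  have on: "y0 ^ 2 + y0 = x0 ^ 3" using assms Affine by simp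
  let ?X = "fX - const x0" and ?Y = "fY - const y0" and ?Y' = "fY - const (- y0 - 1)"
  have rel: "?Y * ?Y' = ?X * ?X * ?X + const (3 * x0) * (?X * ?X) + const (3 * x0 ^ 2) * ?X"
  proof -
    have "const (y0 ^ 2 + y0) = const (x0 ^ 3)" using on by simp
    then show ?thesis using fXY_relation[where 'a='a] unfolding const_hom by Groebner_Basis.algebra
  qed
  let ?S = "{?X, ?Y} * {?X, ?Y'}"
  have S: "?X * ?X \<in> ideal_span ?S" "?X * ?Y' \<in> ideal_span ?S" "?Y * ?X \<in> ideal_span ?S"
    "?Y * ?Y' \<in> ideal_span ?S"
    by (auto simp: set_times_def intro!: ideal_span_base)
  have "ideal_span ?S = ideal_span ({?X} * {1})"
  proof
    show "ideal_span ?S \<subseteq> ideal_span ({?X} * {1})"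
    proof (rule ideal_span_minimal, rule subsetI)
      fix s assume "s \<in> ?S"
      moreover have "?Y * ?Y' = (?X * ?X + const (3 * x0) * ?X + const (3 * x0 ^ 2)) * ?X"
        unfolding rel by (simp only: distrib_right mult.assoc)
      ultimately consider "s = ?X * ?X" | "s = ?Y' * ?X" | "s = ?Y * ?X"
        | "s = (?X * ?X + const (3 * x0) * ?X + const (3 * x0 ^ 2)) * ?X"
        unfolding set_times_def by (elim CollectE bexE insertE emptyE) (simp_all only: mult.commute[of ?X ?Y'])
      then show "s \<in> ideal_span ({?X} * {1})"
        by cases (auto simp: ideal_span_single singleton_times_singleton)
    qed
    \<comment> \<open>Smoothness at P: X Y' - Y X is 2 y0 + 1 times X; if this factor vanishes, then
      x0 is nonzero and the linear term 3 x0^2 X of \<open>rel\<close> isolates X.\<close>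
    have "?X \<in> ideal_span ?S"
    proof (cases "2 * y0 + 1 = 0")
      case False
      have "const (inverse (2 * y0 + 1)) * (?X * ?Y' - ?Y * ?X)
          = const (inverse (2 * y0 + 1) * (2 * y0 + 1)) * ?X"
        unfolding const_hom by Groebner_Basis.algebra
      also have "\<dots> = ?X" using False by (simp add: const_hom)
      finally show ?thesis using ideal_span_scale[OF ideal_span_diff[OF S(2,3)]] by metis
    next
      case True
      have "x0 \<noteq> 0"
      proof
        assume "x0 = 0"
        then have "y0 = 0 \<or> y0 = - 1" using on by (auto simp: power2_eq_square eq_neg_iff_add_eq_0
           simp flip: distrib_left) (metis distrib_left mult.commute mult_1 mult_eq_0_iff)
        then show False using True by auto
      qed
      have "const (inverse (3 * x0 ^ 2)) * (?Y * ?Y' - ?X * (?X * ?X) - const (3 * x0) * (?X * ?X))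
          = const (inverse (3 * x0 ^ 2) * (3 * x0 ^ 2)) * ?X"
        unfolding rel unfolding const_hom by Groebner_Basis.algebra
      also have "\<dots> = ?X" using \<open>x0 \<noteq> 0\<close> by (simp add: const_hom)
      finally show ?thesis
        using ideal_span_scale[OF ideal_span_diff[OF ideal_span_diff[OF S(4) ideal_span_scale[OF S(1)]]
            ideal_span_scale[OF S(1)]]] by metis
    qed
    then show "ideal_span ({?X} * {1}) \<subseteq> ideal_span ?S"
      by (intro ideal_span_minimal) (auto simp: singleton_times_singleton)
  qed
  moreover have "?X \<noteq> 0"
    by (metis cfun.sel(1) cfun_sel(1,7) const_def degree_pCons_eq_if diff_eq_eq one_neq_zero pCons_eq_0_iff
        pCons_eq_iff add_0)
  ultimately show ?thesis using Affine unfolding same_class_def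
    by (rule_tac exI[of _ 1], rule_tac exI[of _ ?X]) simp
qed (simp add: same_class_refl singleton_times_singleton)

text \<open>Let R be the third point on the line L through P and Q. The affine zeros of L are P, Q,
  R, and those of x - x3 are R and P + Q. Hence (x - x3) I_P I_Q = L I_(P+Q), an identity checked on
  generators.\<close>

lemma vanishing_padd:
  fixes P Q :: "'a::field_char_0 point"
  assumes "on_curve E P" "on_curve E Q"
  shows "same_class (vanishing P * vanishing Q) (vanishing (P \<oplus>\<^sub>E Q))"
proof (cases P; cases Q)
  fix x1 y1 x2 y2 assume PQ: "P = Affine x1 y1" "Q = Affine x2 y2"
  have on: "y1 ^ 2 + y1 = x1 ^ 3" "y2 ^ 2 + y2 = x2 ^ 3" using assms PQ by auto
  show ?thesis
  proof (cases rule: padd_cases[OF on])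
    case 1
    then show ?thesis using vanishing_pneg[OF assms(1)] PQ by simp
  next
    case (2 l x3 y3)
    note chord = 2
    define b where "b = y1 - l * x1"
    note v = line_vieta[OF on chord(1,2,3) b_def]
    have y1: "y1 = l * x1 + b" and y3: "y3 = l * x3 + b" using b_def chord(4) by Groebner_Basis.algebra+
    let ?l = "const l" and ?b = "const b"
    let ?X1 = "fX - const x1" and ?Y1 = "fY - const y1"
    let ?X2 = "fX - const x2" and ?Y2 = "fY - const y2"
    let ?X3 = "fX - const x3" and ?Y3 = "fY - const (- y3 - 1)"
    define L where "L = fY - ?l * fX - ?b"
    have Y: "?Y1 = L + ?l * ?X1" "?Y2 = L + ?l * ?X2" "?Y3 = fY + 1 + ?l * const x3 + ?b"
      unfolding L_def y1 v(1) y3 const_hom by (simp_all add: algebra_simps)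
    \<comment> \<open>The second factor is the negative of the conjugate of L under y -> -1 - y, so
      this is the norm of L up to sign, factored by Vieta.\<close>
    have key: "L * (?Y3 + ?l * ?X3) = ?X1 * ?X2 * ?X3"
    proof -
      have "const (x1 * x2 + x1 * x3 + x2 * x3) = const (- (2 * l * b + l))"
        "const (x1 * x2 * x3) = const (b ^ 2 + b)" "const x3 = const (l ^ 2 - x1 - x2)"
        using v(2,3) chord(3) by simp_all
      then show ?thesis using fXY_relation[where 'a='a] unfolding Y(3) unfolding L_def const_hom
        by Groebner_Basis.algebra
    qed
    let ?S = "{?X1, ?Y1} * {?X2, ?Y2}"
    have S: "?X1 * ?X2 \<in> ideal_span ?S" "?X1 * ?Y2 \<in> ideal_span ?S" "?Y1 * ?X2 \<in> ideal_span ?S"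
      "?Y1 * ?Y2 \<in> ideal_span ?S"
      by (auto simp: set_times_def intro!: ideal_span_base)
    \<comment> \<open>For a chord, L is recovered from X2 L - X1 L = (x1 - x2) L; for a tangent,
      from the expansion of the curve equation at the point, where L appears with the unit
      coefficient 2 y1 + 1.\<close>
    have LS: "L \<in> ideal_span ?S"
    proof (cases "x1 = x2")
      case False
      have "const (inverse (x1 - x2)) * (?X2 * L - ?X1 * L) = const (inverse (x1 - x2) * (x1 - x2)) * L"
        unfolding const_hom by Groebner_Basis.algebra
      also have "inverse (x1 - x2) * (x1 - x2) = 1" using False by simp
      finally have e: "const (inverse (x1 - x2)) * ((?Y1 * ?X2 - ?l * (?X1 * ?X2)) - (?X1 * ?Y2 - ?l * (?X1 * ?X2))) = L"
        unfolding Y const_hom by Groebner_Basis.algebra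
      have "const (inverse (x1 - x2)) * ((?Y1 * ?X2 - ?l * (?X1 * ?X2)) - (?X1 * ?Y2 - ?l * (?X1 * ?X2)))
          \<in> ideal_span ?S"
        by (rule ideal_span_scale[OF ideal_span_diff[OF ideal_span_diff[OF S(3) ideal_span_scale[OF S(1)]]
            ideal_span_diff[OF S(2) ideal_span_scale[OF S(1)]]]])
      then show ?thesis unfolding e .
    next
      case True
      then have n: "2 * y1 + 1 \<noteq> 0" "y2 = y1" "l * (2 * y1 + 1) = 3 * x1 ^ 2"
        using chord(1,2) by (auto simp: slope_def)
      have "const (y1 ^ 2 + y1) = const (x1 ^ 3)" "const (l * (2 * y1 + 1)) = const (3 * x1 ^ 2)"
        using on n by simp_all
      then have "?X1 * (?X1 * ?X1) + const (3 * x1) * (?X1 * ?X1) - ?Y1 * ?Y1 = const (2 * y1 + 1) * L"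
        using fXY_relation[where 'a='a] unfolding L_def b_def const_hom by Groebner_Basis.algebra
      then have "const (inverse (2 * y1 + 1)) * (?X1 * (?X1 * ?X1) + const (3 * x1) * (?X1 * ?X1) - ?Y1 * ?Y1)
          = const (inverse (2 * y1 + 1) * (2 * y1 + 1)) * L" by (simp add: const_hom)
      also have "\<dots> = L" using n(1) by (simp add: const_hom)
      finally have e: "const (inverse (2 * y1 + 1)) * (?X1 * (?X1 * ?X1) + const (3 * x1) * (?X1 * ?X1) - ?Y1 * ?Y1) = L" .
      have XY: "?X1 * ?X1 \<in> ideal_span ?S" "?Y1 * ?Y1 \<in> ideal_span ?S" using S(1,4) True n(2) by simp_all
      have "const (inverse (2 * y1 + 1)) * (?X1 * (?X1 * ?X1) + const (3 * x1) * (?X1 * ?X1) - ?Y1 * ?Y1)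
          \<in> ideal_span ?S"
        by (rule ideal_span_scale[OF ideal_span_diff[OF ideal_span.add[OF ideal_span_scale[OF XY(1)]
              ideal_span_scale[OF XY(1)]] XY(2)]])
      then show ?thesis unfolding e .
    qed
    have "ideal_span ({?X3} * ?S) = ideal_span ({L} * {?X3, ?Y3})"
    proof
      let ?T = "{L} * {?X3, ?Y3}"
      have T: "L * ?X3 \<in> ideal_span ?T" "L * ?Y3 \<in> ideal_span ?T"
        by (auto simp: set_times_def intro!: ideal_span_base)
      have XXX: "?X1 * ?X2 * ?X3 \<in> ideal_span ?T"
        using ideal_span.add[OF T(2) ideal_span_scale[OF T(1), of ?l]] unfolding key[symmetric]
        by (simp add: algebra_simps)
      show "ideal_span ({?X3} * ?S) \<subseteq> ideal_span ?T"
      proof (rule ideal_span_minimal, rule subsetI)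
        fix s assume "s \<in> {?X3} * ?S"
        then have "s = ?X3 * (?X1 * ?X2) \<or> s = ?X3 * (?X1 * ?Y2) \<or> s = ?X3 * (?Y1 * ?X2) \<or> s = ?X3 * (?Y1 * ?Y2)"
          by (auto simp: set_times_def)
        moreover have "?X3 * (?X1 * ?X2) = ?X1 * ?X2 * ?X3"
          "?X3 * (?X1 * ?Y2) = ?X1 * (L * ?X3) + ?l * (?X1 * ?X2 * ?X3)"
          "?X3 * (?Y1 * ?X2) = ?X2 * (L * ?X3) + ?l * (?X1 * ?X2 * ?X3)"
          "?X3 * (?Y1 * ?Y2) = (L + ?l * ?X1 + ?l * ?X2) * (L * ?X3) + (?l * ?l) * (?X1 * ?X2 * ?X3)"
          unfolding Y(1,2) by Groebner_Basis.algebra+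
        ultimately consider "s = ?X1 * ?X2 * ?X3" | "s = ?X1 * (L * ?X3) + ?l * (?X1 * ?X2 * ?X3)"
          | "s = ?X2 * (L * ?X3) + ?l * (?X1 * ?X2 * ?X3)"
          | "s = (L + ?l * ?X1 + ?l * ?X2) * (L * ?X3) + (?l * ?l) * (?X1 * ?X2 * ?X3)"
          by argo
        then show "s \<in> ideal_span ?T"
          by cases (use XXX T in \<open>simp_all only: ideal_span.add ideal_span_scale\<close>)
      qed
      have "?X3 * (?X1 * ?X2) \<in> ideal_span ({?X3} * ?S)" "?X3 * L \<in> ideal_span ({?X3} * ?S)"
        using S(1) LS unfolding ideal_span_mult_single by blast+
      then have "?X3 * L \<in> ideal_span ({?X3} * ?S)"
        "?X3 * (?X1 * ?X2) - ?l * (?X3 * L) \<in> ideal_span ({?X3} * ?S)"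
        by (auto intro: ideal_span_diff ideal_span_scale)
      moreover have "?X3 * (?X1 * ?X2) - ?l * (?X3 * L) = L * ?Y3" using key by Groebner_Basis.algebra
      ultimately show "ideal_span ?T \<subseteq> ideal_span ({?X3} * ?S)"
        by (intro ideal_span_minimal) (auto simp: set_times_def mult.commute)
    qed
    moreover have "?X3 \<noteq> 0" "L \<noteq> 0"
      by (auto simp: L_def const_def zero_cfun_def minus_cfun_def times_cfun_def)
    ultimately show ?thesis unfolding same_class_def PQ chord(5) vanishing.simps by blast
  qed
next
  fix x1 y1 assume PQ: "P = Affine x1 y1" "Q = At_Infinity"
  show ?thesis unfolding PQ vanishing.simps point_add.simps times_one_set by (rule same_class_refl)
next
  fix x1 y1 assume PQ: "P = At_Infinity" "Q = Affine x1 y1"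
  show ?thesis unfolding PQ vanishing.simps point_add.simps one_times_set by (rule same_class_refl)
next
  assume PQ: "P = At_Infinity" "Q = At_Infinity"
  show ?thesis unfolding PQ vanishing.simps point_add.simps one_times_set by (rule same_class_refl)
qed

text \<open>Equal classes make I_P I_(-Q) principal, say (h). Degrees of norms force h to be a
  polynomial in x alone, and the y-parts of the generators then identify the coordinates of P and
  Q.\<close>

lemma same_class_vanishing_imp_eq:
  fixes P Q :: "'a::field_char_0 point"
  assumes on: "on_curve E P" "on_curve E Q" and "same_class (vanishing P) (vanishing Q)"
  shows "P = Q"
proof -
  \<comment> \<open>Covers the case of one point at infinity. The generator h divides x - a, whose
    norm has degree 2, so h has no y-part; h also divides y - b, whose y-part is 1, so h is a unit
    although it vanishes at the point.\<close>
  have principal: False if Q: "same_class (vanishing Q) {1}" "on_curve E Q" "Q = Affine a b" for Q :: "'a point" and a b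
  proof -
    obtain h where h: "h \<noteq> 0" "ideal_span {fX - const a, fY - const b} = ideal_span {h}"
      using same_class_principal[OF Q(1)] Q(3) by auto
    have "fX - const a \<in> ideal_span {h}" "fY - const b \<in> ideal_span {h}"
      unfolding h(2)[symmetric] by (auto intro: ideal_span_base)
    then obtain r s where rs: "fX - const a = r * h" "fY - const b = s * h"
      by (auto simp: ideal_span_single)
    have "ypart h = 0"
    proof (rule ccontr)
      assume "ypart h \<noteq> 0"
      from degree_cfun_norm_ge[OF this] have "3 \<le> degree (cfun_norm h)" .
      moreover have "cfun_norm r * cfun_norm h = [:-a, 1:] * [:-a, 1:]"
        unfolding cfun_norm_mult[symmetric] rs(1)[symmetric] by (simp add: cfun_norm_def const_def)
      then have "degree (cfun_norm h) \<le> degree ([:-a, 1:] * [:-a, 1:])"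
        by (metis dvd_imp_degree_le dvd_triv_right mult_eq_0_iff pCons_eq_0_iff one_neq_zero)
      ultimately show False by simp
    qed
    then have "ypart s * xpart h = 1" using arg_cong[OF rs(2), of ypart] by (simp add: const_def)
    have "cfun_eval a b x = 0" if "x \<in> ideal_span {fX - const a, fY - const b}" for x
      using that
    proof (induction rule: ideal_span.induct)
      case (scaled s r)
      then show ?case using Q(2,3) by (auto simp: cfun_eval_mult on_E) (auto simp: cfun_eval_def const_def)
    qed (auto simp: cfun_eval_def algebra_simps)
    then have "cfun_eval a b h = 0" unfolding h(2) by (auto intro: ideal_span_base)
    then have "poly (xpart h) a = 0" using \<open>ypart h = 0\<close> by (simp add: cfun_eval_def)
    then show False using arg_cong[OF \<open>ypart s * xpart h = 1\<close>, of "\<lambda>p. poly p a"] by simp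
  qed
  show ?thesis
  proof (cases P; cases Q)
    fix a c b d assume P: "P = Affine a c" and Q: "Q = Affine b d"
    let ?S = "vanishing P * vanishing (pneg Q)"
    have "same_class ?S {1}"
      using same_class_mult[OF assms(3)] vanishing_pneg[OF on(2)] same_class_trans by blast
    then obtain h where h: "h \<noteq> 0" "ideal_span ?S = ideal_span {h}"
      using same_class_principal by blast
    have mult: "\<exists>r. x = r * h" if "x \<in> ?S" for x
      using ideal_span_base[OF that] unfolding h(2) by (auto simp: ideal_span_single)
    obtain g where g: "(fX - const a) * (fX - const b) = g * h"
      using mult[of "(fX - const a) * (fX - const b)"] by (auto simp: P Q set_times_def)
    have yh: "ypart h = 0"
    proof (rule ccontr)
      assume yh: "ypart h \<noteq> 0"
      \<comment> \<open>The norm of (x - a)(x - b) has degree 4. If h involved y, the cofactor g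
        would have norm of degree at most 1 and hence no y-part, and then g h would still involve
        y.\<close>
      have n: "cfun_norm g * cfun_norm h = ([:-a, 1:] * [:-b, 1:]) * ([:-a, 1:] * [:-b, 1:])"
        unfolding cfun_norm_mult[symmetric] g[symmetric] by (simp add: cfun_norm_def const_def)
      then have "cfun_norm g \<noteq> 0" by auto
      moreover have "cfun_norm h \<noteq> 0" using h(1) by (rule cfun_norm_nonzero)
      ultimately have "degree (cfun_norm g) + degree (cfun_norm h) = 4"
        using arg_cong[OF n, of degree] by (simp add: degree_mult_eq del: mult_pCons_left mult_pCons_right)
      with degree_cfun_norm_ge[OF yh] have dg: "degree (cfun_norm g) \<le> 1" by simp
      then have yg: "ypart g = 0" using degree_cfun_norm_ge[of g] by force
      then have "xpart g \<noteq> 0" using \<open>cfun_norm g \<noteq> 0\<close> by (auto simp: cfun_norm_def)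
      then show False using arg_cong[OF g, of ypart] yg yh by (simp add: const_def)
    qed
    have "cfun_eval a c x = 0" if "x \<in> ideal_span ?S" for x
      using that
    proof (induction rule: ideal_span.induct)
      case (scaled s r)
      then obtain u v where "u \<in> vanishing P" "s = u * v" by (auto simp: set_times_def)
      then show ?case using on(1) P by (auto simp: cfun_eval_mult on_E) (auto simp: cfun_eval_def const_def)
    qed (auto simp: cfun_eval_def algebra_simps)
    then have "cfun_eval a c h = 0" unfolding h(2) by (auto intro: ideal_span_base)
    then have root: "poly (xpart h) a = 0" using yh by (simp add: cfun_eval_def)
    obtain r where r: "(fY - const c) * (fX - const b) = r * h"
      using mult[of "(fY - const c) * (fX - const b)"] by (auto simp: P Q set_times_def)
    \<comment> \<open>Since h is a polynomial in x with root a, the y-part of every multiple of h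
      vanishes at a. The two y-parts compared here and below are x - b and the constant d -
      c.\<close>
    have "a = b" using arg_cong[OF r, of "\<lambda>f. poly (ypart f) a"] root yh by (simp add: const_def)
    obtain r where r: "(fY - const c) * (fY - const (- d - 1)) = r * h"
      using mult[of "(fY - const c) * (fY - const (- d - 1))"] by (auto simp: P Q set_times_def)
    have "c = d" using arg_cong[OF r, of "\<lambda>f. poly (ypart f) a"] root yh by (simp add: const_def)
    with \<open>a = b\<close> show ?thesis by (simp add: P Q)
  next
    fix a c assume "P = Affine a c" "Q = At_Infinity"
    then show ?thesis using principal[of P a c] assms by simp
  next
    fix a c assume "P = At_Infinity" "Q = Affine a c"
    then show ?thesis using principal[of Q a c] same_class_sym[OF assms(3)] assms(2) by simp
  qed simp
qed

section \<open>Commutativity and associativity, transported from ideal classes\<close>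

lemma padd_commute:
  fixes P Q :: "'a::field_char_0 point"
  assumes "on_curve E P" "on_curve E Q" shows "P \<oplus>\<^sub>E Q = Q \<oplus>\<^sub>E P"
proof (rule same_class_vanishing_imp_eq)
  have "same_class (vanishing P * vanishing Q) (vanishing (Q \<oplus>\<^sub>E P))"
    using vanishing_padd[OF assms(2,1)] by (simp only: mult.commute[of "vanishing P"])
  with same_class_sym[OF vanishing_padd[OF assms]]
  show "same_class (vanishing (P \<oplus>\<^sub>E Q)) (vanishing (Q \<oplus>\<^sub>E P))" by (rule same_class_trans)
  show "on_curve E (P \<oplus>\<^sub>E Q)" "on_curve E (Q \<oplus>\<^sub>E P)" using assms on_curve_padd by blast+
qed

lemma padd_assoc:
  fixes P Q S :: "'a::field_char_0 point"
  assumes "on_curve E P" "on_curve E Q" "on_curve E S"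
  shows "P \<oplus>\<^sub>E Q \<oplus>\<^sub>E S = P \<oplus>\<^sub>E (Q \<oplus>\<^sub>E S)"
proof (rule same_class_vanishing_imp_eq)
  have PQ: "on_curve E (P \<oplus>\<^sub>E Q)" and QS: "on_curve E (Q \<oplus>\<^sub>E S)" using assms on_curve_padd by blast+
  have "same_class (vanishing P * vanishing Q * vanishing S) (vanishing (P \<oplus>\<^sub>E Q) * vanishing S)"
    by (rule same_class_mult[OF vanishing_padd[OF assms(1,2)]])
  from same_class_trans[OF this vanishing_padd[OF PQ assms(3)]]
  have 1: "same_class (vanishing P * vanishing Q * vanishing S) (vanishing (P \<oplus>\<^sub>E Q \<oplus>\<^sub>E S))" .
  have "same_class (vanishing Q * vanishing S * vanishing P) (vanishing (Q \<oplus>\<^sub>E S) * vanishing P)"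
    by (rule same_class_mult[OF vanishing_padd[OF assms(2,3)]])
  then have "same_class (vanishing P * vanishing Q * vanishing S) (vanishing P * vanishing (Q \<oplus>\<^sub>E S))"
    by (simp only: mult.commute[of _ "vanishing P"] mult.assoc)
  from same_class_trans[OF this vanishing_padd[OF assms(1) QS]]
  have "same_class (vanishing P * vanishing Q * vanishing S) (vanishing (P \<oplus>\<^sub>E (Q \<oplus>\<^sub>E S)))" .
  from same_class_trans[OF same_class_sym[OF 1] this]
  show "same_class (vanishing (P \<oplus>\<^sub>E Q \<oplus>\<^sub>E S)) (vanishing (P \<oplus>\<^sub>E (Q \<oplus>\<^sub>E S)))" .
  show "on_curve E (P \<oplus>\<^sub>E Q \<oplus>\<^sub>E S)" "on_curve E (P \<oplus>\<^sub>E (Q \<oplus>\<^sub>E S))"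
    using assms PQ QS on_curve_padd by blast+
qed

lemma padd_pneg:
  fixes P :: "'a::field_char_0 point"
  shows "pneg P \<oplus>\<^sub>E P = At_Infinity"
  by (cases P) auto

lemma padd_infinity_right [simp]:
  fixes P :: "'a::field_char_0 point"
  shows "P \<oplus>\<^sub>E At_Infinity = P"
  by (cases P) auto

subsection \<open>Valuation rings above 2\<close>

text \<open>A valuation ring of the whole type in which 2 is not invertible. No value group is
  fixed, so valuations are compared only through divisibility in \<open>V\<close>.\<close>

locale val_ring2 =
  fixes V :: "'a::field_char_0 set"
  assumes one: "1 \<in> V"
    and diff: "x \<in> V \<Longrightarrow> y \<in> V \<Longrightarrow> x - y \<in> V"
    and mult: "x \<in> V \<Longrightarrow> y \<in> V \<Longrightarrow> x * y \<in> V"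
    and total: "x \<in> V \<or> inverse x \<in> V"
    and two: "inverse 2 \<notin> V"
begin

definition M :: "'a set" where "M = {x \<in> V. \<forall>v\<in>V. x * v \<noteq> 1}"

lemma zero: "0 \<in> V" using diff[OF one one] by simp
lemma minus: "x \<in> V \<Longrightarrow> - x \<in> V" using diff[OF zero] by simp
lemma add: "x \<in> V \<Longrightarrow> y \<in> V \<Longrightarrow> x + y \<in> V" using diff[of x "-y"] minus by simp
lemma power: "x \<in> V \<Longrightarrow> x ^ n \<in> V" by (induction n) (auto intro: one mult)
lemma of_nat: "of_nat n \<in> V" by (induction n) (auto intro: zero one add)
lemma numeral: "numeral n \<in> V" using of_nat[of "numeral n"] by simp
lemma of_int: "of_int n \<in> V" by (cases n) (auto simp del: of_nat_Suc intro: of_nat minus)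

lemmas V_intros = zero one diff minus add mult power numeral of_nat

lemma M_V: "x \<in> M \<Longrightarrow> x \<in> V" by (simp add: M_def)
lemma M_zero: "0 \<in> M" by (simp add: M_def zero)
lemma one_not_M: "1 \<notin> M" using one by (auto simp: M_def)

lemma unit: "x \<in> V \<Longrightarrow> x \<notin> M \<Longrightarrow> inverse x \<in> V"
  by (auto simp: M_def dest: inverse_unique)

lemma unit_nonzero: "x \<notin> M \<Longrightarrow> x \<noteq> 0" using M_zero by auto

lemma unit_iff: "inverse x \<in> V \<Longrightarrow> x \<noteq> 0 \<Longrightarrow> x \<notin> M"
  by (auto simp: M_def intro!: bexI[of _ "inverse x"])

lemma M_mult: "x \<in> M \<Longrightarrow> v \<in> V \<Longrightarrow> x * v \<in> M"
  by (auto simp: M_def mult mult.assoc)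

lemma M_mult2: "x \<in> M \<Longrightarrow> v \<in> V \<Longrightarrow> v * x \<in> M"
  by (metis M_mult mult.commute)

lemma M_prime:
  assumes "x \<in> V" "y \<in> V" "x * y \<in> M" shows "x \<in> M \<or> y \<in> M"
proof (rule ccontr)
  assume n: "\<not> ?thesis"
  then have "inverse x * inverse y \<in> V" using assms unit mult by blast
  from M_mult[OF assms(3) this] have "(x * inverse x) * (y * inverse y) \<in> M" by (simp only: ac_simps)
  then show False using n unit_nonzero one_not_M by auto
qed

lemma M_minus: "x \<in> M \<Longrightarrow> - x \<in> M"
  using M_mult[of x "-1"] minus[OF one] by simp

lemma M_add:
  assumes "x \<in> M" "y \<in> M" shows "x + y \<in> M"
proof -
  have *: "x + y \<in> M" if "x \<in> M" "y \<in> M" "x / y \<in> V" "y \<noteq> 0" for x y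
    using M_mult[OF that(2) add[OF that(3) one]] that(4) by (simp add: distrib_left)
  consider "x = 0" | "y = 0" | "x \<noteq> 0" "y \<noteq> 0" "x / y \<in> V" | "x \<noteq> 0" "y \<noteq> 0" "y / x \<in> V"
    using total[of "x / y"] by (auto simp: inverse_eq_divide)
  then show ?thesis using assms *[of x y] *[of y x] by cases (auto simp: add.commute)
qed

lemma M_diff: "x \<in> M \<Longrightarrow> y \<in> M \<Longrightarrow> x - y \<in> M"
  using M_add[of x "-y"] M_minus by simp

lemma unit_add_M: "x \<notin> M \<Longrightarrow> y \<in> M \<Longrightarrow> x + y \<notin> M"
  using M_diff[of "x + y" y] by auto

lemma inverse_M: "x \<notin> V \<Longrightarrow> inverse x \<in> M"
  using total[of x] by (auto simp: M_def) (metis inverse_unique inverse_inverse_eq)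

lemma not_V_iff: "x \<noteq> 0 \<Longrightarrow> inverse x \<in> M \<Longrightarrow> x \<notin> V"
  by (auto simp: M_def)

lemma two_M: "2 \<in> M"
  using two unit[of 2] numeral by auto

lemma V_powerD: "x ^ Suc n \<in> V \<Longrightarrow> x \<in> V"
  using total[of x] mult[of "x ^ Suc n" "inverse x ^ n"] power[of "inverse x" n]
  by (cases "x = 0") (auto simp: zero power_inverse field_simps)

lemma M_powerD:
  assumes "x ^ Suc n \<in> M" shows "x \<in> M"
proof -
  have x: "x \<in> V" using assms V_powerD M_V by blast
  from assms show "x \<in> M"
  proof (induction n)
    case (Suc n)
    then show ?case using M_prime[OF x power[OF x, of "Suc n"]] by auto
  qed simp
qed

lemma odd_unit: "odd n \<Longrightarrow> of_nat n \<notin> M"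
proof
  assume "odd n" "of_nat n \<in> M"
  then obtain k where "n = 2 * k + 1" by (auto elim: oddE)
  then have "(1::'a) = of_nat n - 2 * of_nat k" by simp
  then have "1 \<in> M" using \<open>of_nat n \<in> M\<close> M_diff M_mult[OF two_M of_nat] by metis
  then show False using one_not_M by simp
qed

lemma double_plus_one_unit: "y \<in> V \<Longrightarrow> 2 * y + 1 \<notin> M"
  using unit_add_M[OF one_not_M M_mult[OF two_M]] by (simp add: add.commute)

subsection \<open>Reduction of the curve modulo the maximal ideal\<close>

lemma integral_iff:
  assumes "y ^ 2 + y = x ^ 3" shows "x \<in> V \<longleftrightarrow> y \<in> V"
proof
  assume "x \<in> V"
  show "y \<in> V"
  proof (rule ccontr)
    assume y: "y \<notin> V"
    then have "y \<noteq> 0" using zero by auto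
    then have "1 = x ^ 3 * (inverse y * inverse y) - inverse y"
      unfolding assms[symmetric] by (simp add: field_simps power2_eq_square)
    moreover have "x ^ 3 * (inverse y * inverse y) - inverse y \<in> M"
      by (rule M_diff[OF M_mult2[OF M_mult[OF inverse_M[OF y] M_V[OF inverse_M[OF y]]] power[OF \<open>x \<in> V\<close>]]
            inverse_M[OF y]])
    ultimately show False using one_not_M by simp
  qed
next
  assume "y \<in> V"
  then have "x ^ Suc 2 \<in> V" using assms by (auto intro!: V_intros simp flip: assms)
  then show "x \<in> V" by (rule V_powerD)
qed

text \<open>The points that reduce to infinity. By \<open>integral_iff\<close> the abscissa is
  nonintegral exactly when the ordinate is.\<close>

definition kernel :: "'a point set" where
  "kernel = {P. on_curve E P \<and> (case P of At_Infinity \<Rightarrow> True | Affine x y \<Rightarrow> x \<notin> V)}"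

lemma kernel_Affine: "Affine x y \<in> kernel \<longleftrightarrow> y ^ 2 + y = x ^ 3 \<and> x \<notin> V"
  by (simp add: kernel_def)

lemma kernel_infinity: "At_Infinity \<in> kernel" by (simp add: kernel_def)

text \<open>Modulo \<open>M\<close>, y2 - y1 is -(2 y1 + 1), a unit because 2 lies in
  \<open>M\<close>. The chord slope is thus a unit divided by an element of \<open>M\<close>, so its
  square, and with it x3, is not integral.\<close>

lemma padd_opposite_mod_M:
  assumes on: "y1 ^ 2 + y1 = x1 ^ 3" "y2 ^ 2 + y2 = x2 ^ 3"
    and V: "x1 \<in> V" "x2 \<in> V" and M: "x2 - x1 \<in> M" "y1 + y2 + 1 \<in> M"
  shows "Affine x1 y1 \<oplus>\<^sub>E Affine x2 y2 \<in> kernel"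
proof (cases rule: padd_cases[OF on])
  case 1
  then show ?thesis by (simp add: kernel_infinity)
next
  case (2 l x3 y3)
  have y: "y1 \<in> V" "y2 \<in> V" using V on integral_iff by auto
  have ne: "x1 \<noteq> x2" using 2(2) M(2) double_plus_one_unit[OF y(1)] by auto
  have u: "y2 - y1 \<notin> M"
  proof
    assume "y2 - y1 \<in> M"
    then have "y1 + y2 + 1 - (y2 - y1) \<in> M" using M(2) M_diff by blast
    then show False using double_plus_one_unit[OF y(1)] by simp
  qed
  have "l * (x2 - x1) = y2 - y1" using 2(1) ne by (simp add: slope_def)
  then have "l \<notin> V" using u M_mult2[OF M(1)] by metis
  then have "l ^ 2 \<notin> V" using V_powerD[of l 1] by (auto simp: power2_eq_square)
  moreover have "l ^ 2 = x3 + (x1 + x2)" using 2(3) by simp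
  ultimately have "x3 \<notin> V" using add[OF _ add[OF V]] by metis
  moreover have "on_curve E (Affine x1 y1 \<oplus>\<^sub>E Affine x2 y2)"
    by (rule on_curve_padd) (use on in auto)
  ultimately show ?thesis unfolding 2(5) by (simp add: kernel_def)
qed

text \<open>Modulo the maximal ideal $2P = -P$, because $x^4 = x$ there.\<close>

lemma triple_in_kernel:
  assumes on: "y ^ 2 + y = x ^ 3" and x: "x \<in> V" and res: "x \<in> M \<or> x ^ 3 - 1 \<in> M"
  shows "Affine x y \<oplus>\<^sub>E Affine x y \<oplus>\<^sub>E Affine x y \<in> kernel"
proof (cases rule: padd_cases[OF on on])
  case 1
  then have "2 * y + 1 = 0" by (simp add: algebra_simps)
  then have "2 * y + 1 \<in> M" using M_zero by simp
  then show ?thesis using double_plus_one_unit integral_iff[OF on] x by simp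
next
  case (2 l x3 y3)
  have y: "y \<in> V" using x on integral_iff by auto
  have "x * (x ^ 3 - 1) \<in> M" using res x by (auto intro: M_mult M_mult2 V_intros)
  have u: "2 * y + 1 \<notin> M" using y by (rule double_plus_one_unit)
  have "l * (2 * y + 1) = 3 * x ^ 2" using 2(1) unit_nonzero[OF u] by (simp add: slope_def)
  \<comment> \<open>Modulo 2 the slope equation l (2y + 1) = 3 x^2 reads l = x^2.\<close>
  then have "2 * (x ^ 2 - y * l) = l - x ^ 2" by Groebner_Basis.algebra
  moreover have "l \<in> V" unfolding 2(1) slope_def divide_inverse
    using unit[OF _ u] x y by (auto intro!: V_intros)
  ultimately have "l - x ^ 2 \<in> M"
    using M_mult[OF two_M diff[OF power[OF x, of 2] mult[OF y \<open>l \<in> V\<close>]]] by metis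
  \<comment> \<open>Hence x3 - x = l^2 - 3x agrees modulo \<open>M\<close> with x^4 - x, which lies
    in \<open>M\<close>.\<close>
  then have "(l - x ^ 2) * (l + x ^ 2) + x * (x ^ 3 - 1) - 2 * x \<in> M"
    by (rule M_diff[OF M_add[OF M_mult[OF _ add[OF \<open>l \<in> V\<close> power[OF x]]] \<open>x * (x ^ 3 - 1) \<in> M\<close>] M_mult[OF two_M x]])
  moreover have "(l - x ^ 2) * (l + x ^ 2) + x * (x ^ 3 - 1) - 2 * x = x3 - x"
    unfolding 2(3) by Groebner_Basis.algebra
  ultimately have d: "x3 - x \<in> M" by simp
  have "- (l * (x3 - x)) \<in> M" using d \<open>l \<in> V\<close> by (intro M_minus M_mult2)
  moreover have "- (l * (x3 - x)) = - y3 - 1 + y + 1" by (simp add: 2(4) algebra_simps)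
  ultimately have e: "- y3 - 1 + y + 1 \<in> M" by simp
  have on3: "(- y3 - 1) ^ 2 + (- y3 - 1) = x3 ^ 3"
    using on_curve_padd[of "Affine x y" "Affine x y"] on by (simp add: 2(5) del: point_add.simps)
  have "x3 \<in> V" using 2(3) \<open>l \<in> V\<close> x by (auto intro!: V_intros)
  show ?thesis unfolding 2(5)
    using padd_opposite_mod_M[OF on3 on \<open>x3 \<in> V\<close> x] d e M_minus[OF d] by (simp add: minus_diff_eq)
qed

subsection \<open>The formal parameter on the kernel of reduction\<close>

text \<open>Up to sign the usual formal group parameter at infinity; it vanishes there, which
  explains the value 0.\<close>

fun zcoord :: "'a point \<Rightarrow> 'a" where
  "zcoord At_Infinity = 0"
| "zcoord (Affine x y) = x / y"

lemma kernel_zw: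
  assumes "Affine x y \<in> kernel"
  shows "y \<noteq> 0" "x / y \<noteq> 0" "x / y \<in> M" "1 / y \<in> M" "1 / y + (1 / y) ^ 2 = (x / y) ^ 3" "y \<notin> V"
proof -
  have on: "y ^ 2 + y = x ^ 3" and x: "x \<notin> V" using assms by (auto simp: kernel_Affine)
  show y: "y \<notin> V" using integral_iff[OF on] x by simp
  then show y0: "y \<noteq> 0" using zero by auto
  show "x / y \<noteq> 0" using y0 x zero by auto
  show w: "1 / y \<in> M" using inverse_M[OF y] by (simp add: inverse_eq_divide)
  show e: "1 / y + (1 / y) ^ 2 = (x / y) ^ 3"
    using y0 on by (simp add: power_divide field_simps power2_eq_square power3_eq_cube)
  have "(x / y) ^ Suc 2 \<in> M"
    using w e M_add[OF w M_mult[OF w M_V[OF w]]] by (simp add: power2_eq_square power3_eq_cube)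
  then show "x / y \<in> M" by (rule M_powerD)
qed

lemma zcoord_pneg:
  fixes x y :: 'a
  assumes "1 + y \<noteq> 0" "y \<noteq> 0"
  shows "x / (- y - 1) = - (x / y) * inverse (1 + 1 / y)"
proof -
  have "x / (- y - 1) = - (x / (1 + y))"
    using minus_divide_right[of x "1 + y"] by (simp only: minus_add_distrib) simp
  also have "\<dots> = - (x / y) * inverse (1 + 1 / y)" using assms by (simp add: field_simps)
  finally show ?thesis .
qed

text \<open>The difference factors as (w1 - w2)(1 + w1 + w2) with a unit second factor. Since w +
  w^2 = z^3, the parameter z determines a point of the kernel.\<close>

lemma w_unique:
  assumes w: "w1 \<in> M" "w2 \<in> M" "w1 + w1 ^ 2 = w2 + w2 ^ 2" shows "w1 = w2"
proof -
  have "(w1 - w2) * (1 + (w1 + w2)) = 0" using w(3) by (simp add: algebra_simps power2_eq_square)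
  moreover have "1 + (w1 + w2) \<noteq> 0" using unit_add_M[OF one_not_M M_add[OF w(1,2)]] unit_nonzero by blast
  ultimately show ?thesis by simp
qed

text \<open>
  In the coordinates $z = x / y$, $w = 1 / y$ the curve is $w + w^2 = z^3$, and a chord
  $w = \lambda z + \mu$ meets it in points whose $z$-coordinates add up to $\lambda^2$.
\<close>

lemma zcoord_padd:
  assumes P: "P \<in> kernel" and Q: "Q \<in> kernel"
    and c: "c \<in> M" and a: "p1 \<in> V" "p2 \<in> V" "zcoord P = c * p1" "zcoord Q = c * p2"
  shows "P \<oplus>\<^sub>E Q \<in> kernel \<and> (\<exists>e\<in>M. zcoord (P \<oplus>\<^sub>E Q) = zcoord P + zcoord Q + c * e)"
proof (cases P; cases Q)
  fix x1 y1 x2 y2 assume PQ: "P = Affine x1 y1" "Q = Affine x2 y2"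
  note k1 = kernel_zw[OF P[unfolded PQ]] and k2 = kernel_zw[OF Q[unfolded PQ]]
  have on: "y1 ^ 2 + y1 = x1 ^ 3" "y2 ^ 2 + y2 = x2 ^ 3" using P Q PQ by (auto simp: kernel_Affine)
  define z1 z2 w1 w2 where zw: "z1 = x1 / y1" "z2 = x2 / y2" "w1 = 1 / y1" "w2 = 1 / y2"
  \<comment> \<open>The common factor \<open>c\<close> stands in for the smaller of two valuations:
    the error has to be \<open>c\<close> times an element of \<open>M\<close>, so that it remains
    small compared with the parameters themselves.\<close>
  have z: "z1 = c * p1" "z2 = c * p2" using a PQ zw by auto
  have inv1: "inverse (1 + w) \<in> V" "1 + w \<noteq> 0" if "w \<in> M" for w
    using unit_add_M[OF one_not_M that] unit[OF add[OF one M_V[OF that]]] unit_nonzero by auto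
  show ?thesis
  proof (cases rule: padd_cases[OF on])
    case 1
    have "1 + y1 \<noteq> 0" using k2(1) 1(2) by (auto simp: add_eq_0_iff)
    then have "z2 = - z1 * inverse (1 + w1)" using zcoord_pneg k1(1) unfolding zw 1(1,2) by blast
    moreover have "(1 + w1) * inverse (1 + w1) = 1" using inv1(2)[OF k1(4)] zw(3) by simp
    ultimately have "0 = z1 + z2 + c * (- (w1 * (p1 * inverse (1 + w1))))"
      using z(1) by Groebner_Basis.algebra
    moreover have "- (w1 * (p1 * inverse (1 + w1))) \<in> M"
      using inv1(1)[OF k1(4)] k1(4) a(1) zw(3) by (intro M_minus M_mult mult) auto
    ultimately have "\<exists>e\<in>M. 0 = z1 + z2 + c * e" by blast
    then show ?thesis unfolding PQ 1(3) using kernel_infinity zw(1,2) by simp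
  next
    case (2 l x3 y3)
    define b where "b = y1 - l * x1"
    note v = line_vieta[OF on 2(1,2,3) b_def]
    have y1: "y1 = l * x1 + b" and y3: "y3 = l * x3 + b" using b_def 2(4) by Groebner_Basis.algebra+
    have cancel: "x1 = x2 \<and> y1 = y2" if "z1 = z2"
    proof -
      have "w1 = w2" using w_unique[OF k1(4) k2(4)] k1(5) k2(5) that zw by simp
      then show ?thesis using that zw k1(1) k2(1) by (simp add: field_simps)
    qed
    have tangent: "b * (2 * y1 + 1) = - (y1 * (y1 + 2))" "l * (2 * y1 + 1) = 3 * x1 ^ 2" "2 * y1 + 1 \<noteq> 0"
      if "x1 = x2"
    proof -
      show "2 * y1 + 1 \<noteq> 0" "l * (2 * y1 + 1) = 3 * x1 ^ 2"
        using 2(1,2) that by (auto simp: slope_def)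
      then show "b * (2 * y1 + 1) = - (y1 * (y1 + 2))" using on(1) b_def by Groebner_Basis.algebra
    qed
    \<comment> \<open>On a line y = l x the parameter z is 1/l at both points, so the line would be
      a tangent, forcing y1 = -2, which is integral.\<close>
    have b: "b \<noteq> 0"
    proof
      assume b: "b = 0"
      have "l * z1 = 1" "l * z2 = 1" using k1(1) k2(1) zw y1 v(1) b by (simp_all add: field_simps)
      then have "z1 = z2" by (metis mult_left_cancel mult_zero_left one_neq_zero)
      then have "y1 * (y1 + 2) = 0" using cancel tangent(1) b by simp
      then have "y1 + 2 = 0" using k1(1) by simp
      then have "y1 = - 2" by (simp add: eq_neg_iff_add_eq_0)
      then show False using k1(6) minus[OF numeral] by simp
    qed
    \<comment> \<open>Dividing y = l x + b by b y turns the line into w = sl * z + 1/b.\<close>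
    define sl where "sl = - l / b"
    have on_line: "1 / y = sl * (x / y) + 1 / b" if "y = l * x + b" "y \<noteq> 0" for x y
    proof -
      have "1 / y = (y - l * x) / (b * y)" using that b by simp
      also have "\<dots> = sl * (x / y) + 1 / b" using that(2) b by (simp add: sl_def diff_divide_distrib)
      finally show ?thesis .
    qed
    have w: "w1 = sl * z1 + 1 / b" "w2 = sl * z2 + 1 / b"
      unfolding zw using on_line k1(1) k2(1) y1 v(1) by blast+
    have W: "w1 + w2 \<in> M" using M_add[OF k1(4) k2(4)] zw by simp
    \<comment> \<open>Obtained by subtracting w + w^2 = z^3 at the two points, or from the tangent
      slope. It makes \<open>sl\<close> a multiple of c^2.\<close>
    have "sl * (1 + (w1 + w2)) = z1 ^ 2 + z1 * z2 + z2 ^ 2"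
    proof (cases "z1 = z2")
      case False
      have "w1 + w1 ^ 2 = z1 ^ 3" "w2 + w2 ^ 2 = z2 ^ 3" using k1(5) k2(5) zw by auto
      moreover have "sl * (z1 - z2) = w1 - w2" using w by (simp add: algebra_simps)
      ultimately have "(z1 - z2) * (sl * (1 + (w1 + w2)) - (z1 ^ 2 + z1 * z2 + z2 ^ 2)) = 0"
        by Groebner_Basis.algebra
      then show ?thesis using False by simp
    next
      case True
      have "(2 * y1 + 1) * (- l * (y1 * (y1 + 2))) = (2 * y1 + 1) * (3 * x1 ^ 2 * b)"
        using tangent(1,2)[OF conjunct1[OF cancel[OF True]]] by Groebner_Basis.algebra
      then have "- l * (y1 * (y1 + 2)) = 3 * x1 ^ 2 * b"
        by (simp only: mult_left_cancel[OF tangent(3)[OF conjunct1[OF cancel[OF True]]]])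
      moreover have "sl * (1 + (w1 + w1)) = - l * (y1 * (y1 + 2)) / (b * (y1 * y1))"
        using b k1(1) by (simp add: sl_def zw field_simps)
      ultimately have "sl * (1 + (w1 + w1)) = 3 * z1 ^ 2"
        using b k1(1) by (simp add: zw power2_eq_square)
      moreover have "w2 = w1" using cancel[OF True] zw by simp
      ultimately show ?thesis unfolding True[symmetric] by (simp add: power2_eq_square)
    qed
    then have "sl = c * c * (p1 ^ 2 + p1 * p2 + p2 ^ 2) * inverse (1 + (w1 + w2))"
      using inv1(2)[OF W] by (simp add: z field_simps power2_eq_square)
    moreover define t where "t = (p1 ^ 2 + p1 * p2 + p2 ^ 2) * inverse (1 + (w1 + w2))"
    ultimately have sl: "sl = c * c * t" by simp
    have t: "t \<in> V" unfolding t_def using inv1(1)[OF W] a(1,2) by (intro mult add power)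
    \<comment> \<open>The ordinates on a line multiply to b^3, because y = 0 meets the curve only in
      (0,0), with multiplicity three. The next symmetric function turns into the sum of the
      z-coordinates.\<close>
    have yyy: "y1 * y2 * y3 = b ^ 3"
      unfolding v(1) y3 using v(2,3) 2(3) y1 by Groebner_Basis.algebra
    then have y30: "y3 \<noteq> 0" using b by auto
    define z3 where "z3 = x3 / y3"
    have "x1 * y2 * y3 + x2 * y1 * y3 + x3 * y1 * y2 = l ^ 2 * b"
      unfolding v(1) y3 using v(2,3) 2(3) y1 by Groebner_Basis.algebra
    then have "z1 + z2 + z3 = l ^ 2 * b / (y1 * y2 * y3)"
      using k1(1) k2(1) y30 by (simp add: zw z3_def field_simps)
    also have "\<dots> = sl ^ 2" unfolding yyy sl_def using b by (simp add: field_simps power2_eq_square power3_eq_cube)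
    finally have sum: "z1 + z2 + z3 = sl ^ 2" .
    define s where "s = c * c * c * t * t - p1 - p2"
    have s: "s \<in> V" unfolding s_def using t a(1,2) M_V[OF c] by (intro diff mult)
    have "z3 = sl ^ 2 - z1 - z2" using sum by (simp add: algebra_simps)
    then have z3: "z3 = c * s" by (simp add: sl z s_def algebra_simps power2_eq_square)
    have "1 / b = w1 - sl * z1" using w by simp
    moreover have slM: "sl \<in> M" unfolding sl by (rule M_mult[OF M_mult[OF c M_V[OF c]] t])
    moreover have "z1 \<in> V" "z3 \<in> V" unfolding z(1) z3 using a(1) s mult[OF M_V[OF c]] by blast+
    ultimately have "1 / b \<in> M" "sl * z3 \<in> M" using M_diff[of w1 "sl * z1"] M_mult[of sl] k1(4) zw(3) by auto
    moreover have w3: "1 / y3 = sl * z3 + 1 / b" unfolding z3_def using on_line y30 y3 by blast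
    ultimately have w3M: "1 / y3 \<in> M" using M_add by metis
    have "on_curve E (Affine x1 y1 \<oplus>\<^sub>E Affine x2 y2)" by (rule on_curve_padd) (use on in auto)
    then have on3: "(- y3 - 1) ^ 2 + (- y3 - 1) = x3 ^ 3" unfolding 2(5) by simp
    then have "y3 ^ 2 + y3 = x3 ^ 3" by (simp add: power2_eq_square algebra_simps)
    moreover have "y3 \<notin> V" using not_V_iff[OF y30] w3M by (simp add: inverse_eq_divide)
    ultimately have "x3 \<notin> V" using integral_iff by blast
    then have ker: "P \<oplus>\<^sub>E Q \<in> kernel" using on3 by (simp add: PQ 2(5) kernel_Affine del: point_add.simps)
    have "1 + y3 \<noteq> 0" using \<open>y3 \<notin> V\<close> minus[OF one] by (auto simp: add_eq_0_iff)
    \<comment> \<open>Passing from the third point to its negative multiplies z by -1 / (1 + w3),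
      which is -1 modulo \<open>M\<close>.\<close>
    then have "x3 / (- y3 - 1) = - z3 * inverse (1 + 1 / y3)"
      using zcoord_pneg y30 unfolding z3_def by blast
    also have "\<dots> = z1 + z2 + (z3 * ((1 / y3) * inverse (1 + 1 / y3)) - sl ^ 2)"
    proof -
      have "(1 + 1 / y3) * inverse (1 + 1 / y3) = 1" using inv1(2)[OF w3M] by simp
      then show ?thesis unfolding sum[symmetric] by Groebner_Basis.algebra
    qed
    also have "\<dots> = z1 + z2 + c * ((1 / y3) * (s * inverse (1 + 1 / y3)) - c * (c * c * t * t))"
      unfolding z3 sl by (simp add: algebra_simps power2_eq_square)
    finally have "zcoord (P \<oplus>\<^sub>E Q) = z1 + z2 + c * ((1 / y3) * (s * inverse (1 + 1 / y3)) - c * (c * c * t * t))"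
      by (simp add: PQ 2(5) del: point_add.simps)
    moreover have "(1 / y3) * (s * inverse (1 + 1 / y3)) - c * (c * c * t * t) \<in> M"
      using w3M s inv1(1)[OF w3M] c t by (intro M_diff M_mult mult M_V[OF c]) auto
    ultimately show ?thesis using ker zw PQ by auto
  qed
qed (use P Q M_zero in \<open>auto intro!: bexI[of _ 0]\<close>)

end

section \<open>Multiples of points and odd torsion\<close>

primrec pmul :: "nat \<Rightarrow> 'a::field_char_0 point \<Rightarrow> 'a point" where
  "pmul 0 P = At_Infinity"
| "pmul (Suc n) P = pmul n P \<oplus>\<^sub>E P"

lemma on_curve_pmul: "on_curve E P \<Longrightarrow> on_curve E (pmul n P)"
  by (induction n) (auto intro: on_curve_padd)

lemma pmul_add: "on_curve E P \<Longrightarrow> pmul (m + n) P = pmul m P \<oplus>\<^sub>E pmul n P"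
  by (induction n) (simp_all add: padd_assoc on_curve_pmul)

lemma pmul_mult: "on_curve E P \<Longrightarrow> pmul (m * n) P = pmul m (pmul n P)"
  by (induction m) (simp_all add: pmul_add padd_commute on_curve_pmul)

lemma pmul_infinity [simp]: "pmul n At_Infinity = At_Infinity"
  by (induction n) auto

context val_ring2
begin

text \<open>Each addition of P uses \<open>zcoord_padd\<close> with c equal to the parameter of P
  itself, so all errors stay relative to that parameter.\<close>

lemma kernel_pmul:
  assumes P: "P \<in> kernel"
  shows "pmul n P \<in> kernel \<and> (\<exists>e\<in>M. zcoord (pmul n P) = zcoord P * (of_nat n + e))"
proof (induction n)
  case 0
  then show ?case using M_zero kernel_infinity by (auto intro!: bexI[of _ 0])
next
  case (Suc n)
  then obtain e where e: "e \<in> M" "zcoord (pmul n P) = zcoord P * (of_nat n + e)" and k: "pmul n P \<in> kernel"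
    by auto
  have "zcoord P \<in> M" using P kernel_zw(3) M_zero by (cases P) auto
  from zcoord_padd[OF k P this add[OF of_nat M_V[OF e(1)]] one e(2)]
  obtain e' where e': "e' \<in> M" "pmul n P \<oplus>\<^sub>E P \<in> kernel"
    "zcoord (pmul n P \<oplus>\<^sub>E P) = zcoord (pmul n P) + zcoord P + zcoord P * e'"
    by (metis mult_1_right)
  have "zcoord (pmul (Suc n) P) = zcoord P * (of_nat (Suc n) + (e + e'))"
    unfolding pmul.simps e'(3) e(2) by (simp add: algebra_simps)
  then show ?case using M_add[OF e(1) e'(1)] e'(2) unfolding pmul.simps by blast
qed

text \<open>For odd n the factor n + e is a unit, and a nonzero parameter times a unit is
  nonzero.\<close>

lemma kernel_odd_torsion:
  assumes P: "P \<in> kernel" and n: "odd n" "pmul n P = At_Infinity"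
  shows "P = At_Infinity"
proof (cases P)
  case (Affine x y)
  obtain e where "e \<in> M" "0 = zcoord P * (of_nat n + e)" using kernel_pmul[OF P, of n] n(2) by auto
  moreover have "zcoord P \<noteq> 0" using kernel_zw(2) P Affine by simp
  ultimately have "of_nat n + e = 0" by simp
  then show ?thesis using unit_add_M[OF odd_unit[OF n(1)] \<open>e \<in> M\<close>] M_zero by simp
qed

lemma odd_torsion:
  assumes on: "on_curve E P" and res: "\<And>x y. P = Affine x y \<Longrightarrow> x \<in> V \<Longrightarrow> x \<notin> M \<Longrightarrow> x ^ 3 - 1 \<in> M"
    and n: "odd n" "pmul n P = At_Infinity"
  shows "pmul 3 P = At_Infinity"
proof (rule kernel_odd_torsion[OF _ n(1)])
  show "pmul 3 P \<in> kernel"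
  proof (cases "P \<in> kernel")
    case True
    then show ?thesis using kernel_pmul by blast
  next
    case False
    then obtain x y where P: "P = Affine x y" "x \<in> V" "y ^ 2 + y = x ^ 3"
      using on by (cases P) (auto simp: kernel_def)
    then show ?thesis using triple_in_kernel[OF P(3,2)] res[OF P(1,2)]
      by (auto simp: eval_nat_numeral simp del: point_add.simps(3))
  qed
  show "pmul n (pmul 3 P) = At_Infinity"
    using pmul_mult[OF on, of n 3] pmul_mult[OF on, of 3 n] n(2) by (simp add: mult.commute)
qed

end

subsection \<open>Existence of a valuation ring above 2\<close>

definition ring2 :: "'a::field_char_0 set \<Rightarrow> bool" where
  "ring2 A \<longleftrightarrow> 1 \<in> A \<and> (\<forall>x\<in>A. \<forall>y\<in>A. x - y \<in> A \<and> x * y \<in> A) \<and> inverse 2 \<notin> A"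

lemma ring2_Ints: "ring2 (\<int> :: 'a::field_char_0 set)"
proof -
  have "inverse 2 \<notin> (\<int> :: 'a set)"
  proof
    assume "inverse 2 \<in> (\<int> :: 'a set)"
    then obtain n where "inverse 2 = (of_int n :: 'a)" by (auto elim: Ints_cases)
    then have "of_int (2 * n) = (of_int 1 :: 'a)" by (simp add: field_simps)
    then have "2 * n = 1" unfolding of_int_eq_iff .
    then show False by presburger
  qed
  then show ?thesis by (simp add: ring2_def)
qed

context
  fixes A :: "'a::field_char_0 set"
  assumes A: "ring2 A" and max: "\<And>B. ring2 B \<Longrightarrow> A \<subseteq> B \<Longrightarrow> B = A"
begin

lemma A_one: "1 \<in> A" and A_diff: "x \<in> A \<Longrightarrow> y \<in> A \<Longrightarrow> x - y \<in> A"
  and A_mult: "x \<in> A \<Longrightarrow> y \<in> A \<Longrightarrow> x * y \<in> A" and A_two: "inverse 2 \<notin> A"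
  using A by (auto simp: ring2_def)

lemma A_zero: "0 \<in> A" using A_diff[OF A_one A_one] by simp
lemma A_minus: "x \<in> A \<Longrightarrow> - x \<in> A" using A_diff[OF A_zero] by simp
lemma A_add: "x \<in> A \<Longrightarrow> y \<in> A \<Longrightarrow> x + y \<in> A" using A_diff[of x "-y"] A_minus by simp
lemma A_sum: "(\<And>i. i \<in> I \<Longrightarrow> f i \<in> A) \<Longrightarrow> sum f I \<in> A"
  by (induction I rule: infinite_finite_induct) (auto intro: A_zero A_add)
lemma A_power: "x \<in> A \<Longrightarrow> x ^ n \<in> A" by (induction n) (auto intro: A_one A_mult)

definition polys :: "'a poly set" where "polys = {p. \<forall>i. poly.coeff p i \<in> A}"

text \<open>The ring A[x] is strictly larger than A, so by maximality it contains 1/2.\<close>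

lemma outside_unit_ideal:
  assumes "x \<notin> A" shows "\<exists>p\<in>polys. 2 * poly p x = 1"
proof -
  let ?B = "(\<lambda>p. poly p x) ` polys"
  have "[:a:] \<in> polys" if "a \<in> A" for a using that A_zero by (auto simp: polys_def coeff_pCons split: nat.splits)
  then have AB: "A \<subseteq> ?B" by (force simp: image_iff intro!: bexI[of _ "[:_:]"])
  have x: "x \<in> ?B" using A_zero A_one
    by (auto simp: polys_def coeff_pCons image_iff intro!: exI[of _ "[:0, 1:]"] split: nat.splits)
  have "p - q \<in> polys" "p * q \<in> polys" if "p \<in> polys" "q \<in> polys" for p q
    using that by (auto simp: polys_def coeff_mult intro: A_diff A_sum A_mult)
  then have "\<forall>x\<in>?B. \<forall>y\<in>?B. x - y \<in> ?B \<and> x * y \<in> ?B"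
    by (auto simp flip: poly_diff poly_mult)
  then have "ring2 ?B" if "inverse 2 \<notin> ?B" using that AB A_one by (auto simp: ring2_def)
  then have "inverse 2 \<in> ?B" using max[of ?B] AB x assms by blast
  then obtain p where p: "p \<in> polys" "poly p x = inverse 2" by auto
  have "2 * poly p x = 1" unfolding p(2) by simp
  then show ?thesis using p(1) by blast
qed

text \<open>Otherwise 2 p(1/u) = 1 for some polynomial p over A. Multiplying by a power of u puts
  that power into 2A, while every power of u is 1 modulo 2A; so 2 would be invertible in A.\<close>

lemma one_plus_even_unit:
  assumes "a \<in> A" shows "inverse (1 - 2 * a) \<in> A"
proof (rule ccontr)
  let ?u = "1 - 2 * a"
  assume "inverse ?u \<notin> A"
  then obtain p where p: "p \<in> polys" "2 * poly p (inverse ?u) = 1" using outside_unit_ideal by blast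
  have u0: "?u \<noteq> 0"
  proof
    assume "?u = 0"
    then have "2 * a = 1" by simp
    then have "a = inverse 2" by (metis inverse_unique)
    then show False using assms A_two by metis
  qed
  have uA: "?u \<in> A" using assms A_one A_diff A_add by (metis mult_2)
  let ?n = "degree p"
  let ?c = "\<Sum>i\<le>?n. poly.coeff p i * ?u ^ (?n - i)"
  have "?u ^ ?n * poly p (inverse ?u) = (\<Sum>i\<le>?n. ?u ^ ?n * (poly.coeff p i * inverse ?u ^ i))"
    by (simp add: poly_altdef sum_distrib_left)
  also have "\<dots> = ?c"
  proof (rule sum.cong[OF refl])
    fix i assume "i \<in> {..?n}"
    then have "?u ^ ?n = ?u ^ (?n - i) * ?u ^ i" by (simp flip: power_add)
    then show "?u ^ ?n * (poly.coeff p i * inverse ?u ^ i) = poly.coeff p i * ?u ^ (?n - i)"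
      using u0 by (simp add: power_inverse)
  qed
  finally have e: "?u ^ ?n = 2 * ?c" using p(2) by (metis mult.left_commute mult_1_right)
  have c: "?c \<in> A" using p(1) uA by (auto simp: polys_def intro!: A_sum A_mult A_power)
  have "\<exists>e\<in>A. ?u ^ n = 1 - 2 * e" for n
  proof (induction n)
    case 0
    then show ?case using A_zero by (auto intro!: bexI[of _ 0])
  next
    case (Suc n)
    then obtain e where e: "e \<in> A" "?u ^ n = 1 - 2 * e" by blast
    then have "?u ^ Suc n = 1 - 2 * (a + e * ?u)" unfolding power_Suc e(2) by (simp add: algebra_simps)
    moreover have "a + e * ?u \<in> A" using e assms uA A_add A_mult by blast
    ultimately show ?case by blast
  qed
  then obtain e where e': "e \<in> A" "?u ^ ?n = 1 - 2 * e" by blast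
  then have "2 * (?c + e) = 1" using e by (simp add: algebra_simps)
  then have "inverse 2 = ?c + e" by (rule inverse_unique)
  then show False using A_add[OF c e'(1)] A_two by metis
qed

text \<open>The descent in the classical existence proof for valuation rings: the relation for 1/x,
  multiplied by a power of x, expresses x^n by lower powers, since 1 - 2 q_0 is a unit of A.\<close>

lemma degree_reduce:
  assumes p: "p \<in> polys" "2 * poly p x = 1" and q: "q \<in> polys" "2 * poly q (inverse x) = 1"
    and deg: "degree q \<le> degree p" and x: "x \<noteq> 0"
  shows "\<exists>p'\<in>polys. 2 * poly p' x = 1 \<and> degree p' < degree p"
proof -
  let ?n = "degree p"
  have n: "?n > 0"
  proof (rule ccontr)
    assume "\<not> ?n > 0"
    then obtain a where "p = [:a:]" by (auto elim: degree_eq_zeroE)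
    then have "2 * a = 1" "a \<in> A" using p by (auto simp: polys_def dest: spec[of _ 0])
    then show False using A_two by (metis inverse_unique)
  qed
  define w where "w = inverse (1 - 2 * poly.coeff q 0)"
  have q0: "poly.coeff q 0 \<in> A" using q by (auto simp: polys_def)
  have w: "w \<in> A" unfolding w_def by (rule one_plus_even_unit[OF q0])
  have nz: "1 - 2 * poly.coeff q 0 \<noteq> 0" using A_two q0 by (metis eq_iff_diff_eq_0 inverse_unique)
  \<comment> \<open>The nonconstant part of q at 1/x, multiplied by x^n; degree q <= n keeps the
    exponents nonnegative, and j >= 1 keeps them below n.\<close>
  define r where "r = (\<Sum>j\<in>{1..degree q}. monom (poly.coeff q j) (?n - j))"
  have r: "r \<in> polys" using q(1) A_zero by (auto simp: polys_def r_def coeff_sum intro!: A_sum)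
  have "degree r < ?n" unfolding r_def
  proof (rule degree_sum_less)
    show "degree (monom (poly.coeff q j) (?n - j)) < ?n" if "j \<in> {1..degree q}" for j
      by (rule le_less_trans[OF degree_monom_le]) (use that n in auto)
  qed (use n in simp)
  have "x ^ ?n * poly q (inverse x) = x ^ ?n * (poly.coeff q 0 + (\<Sum>j\<in>{1..degree q}. poly.coeff q j * inverse x ^ j))"
    by (simp add: poly_altdef sum.atMost_shift sum.shift_bounds_Suc_ivl atLeast0AtMost[symmetric] sum.atLeast_Suc_atMost)
  also have "\<dots> = poly.coeff q 0 * x ^ ?n + (\<Sum>j\<in>{1..degree q}. x ^ ?n * (poly.coeff q j * inverse x ^ j))"
    by (simp add: distrib_left sum_distrib_left mult.commute)
  also have "(\<Sum>j\<in>{1..degree q}. x ^ ?n * (poly.coeff q j * inverse x ^ j)) = poly r x"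
    unfolding r_def poly_sum poly_monom
  proof (rule sum.cong[OF refl])
    fix i assume "i \<in> {1..degree q}"
    then have "x ^ ?n = x ^ (?n - i) * x ^ i" using deg by (simp flip: power_add)
    then show "x ^ ?n * (poly.coeff q i * inverse x ^ i) = poly.coeff q i * x ^ (?n - i)"
      using x by (simp add: power_inverse)
  qed
  finally have "2 * (x ^ ?n * poly q (inverse x)) = 2 * (poly.coeff q 0 * x ^ ?n + poly r x)" by simp
  then have "x ^ ?n = 2 * (poly.coeff q 0 * x ^ ?n + poly r x)" using q(2) by (metis mult.left_commute mult_1_right)
  then have "(1 - 2 * poly.coeff q 0) * x ^ ?n = 2 * poly r x" by (simp add: algebra_simps)
  then have xn: "x ^ ?n = 2 * w * poly r x" unfolding w_def using nz by (simp add: field_simps)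
  define a where "a = lead_coeff p"
  have a: "a \<in> A" using p(1) by (auto simp: polys_def a_def)
  \<comment> \<open>The leading monomial is replaced by its expression through \<open>xn\<close>,
    which preserves the value at x.\<close>
  define p' where "p' = (p - monom a ?n) + smult (2 * a * w) r"
  have "degree (p - monom a ?n) < ?n"
  proof (rule degree_lessI)
    show "p - monom a ?n \<noteq> 0 \<or> 0 < ?n" using n by simp
    show "\<forall>k\<ge>?n. poly.coeff (p - monom a ?n) k = 0"
      by (auto simp: a_def coeff_eq_0 le_less)
  qed
  then have "degree p' < ?n" unfolding p'_def
    using \<open>degree r < ?n\<close> by (intro degree_add_less) (auto intro: le_less_trans[OF degree_smult_le])
  moreover have "p' \<in> polys"
  proof -
    have "2 * a * w \<in> A" using A_mult[OF A_add[OF a a] w] by (simp only: mult_2)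
    then have "poly.coeff p' i \<in> A" for i
      using A_add[OF A_diff A_mult] p(1) r a A_zero unfolding p'_def polys_def coeff_add coeff_diff coeff_smult coeff_monom mem_Collect_eq
      by auto
    then show ?thesis by (simp add: polys_def)
  qed
  moreover have "poly p' x = poly p x"
    by (simp add: p'_def poly_monom xn algebra_simps)
  ultimately show ?thesis using p(2) by metis
qed

text \<open>If neither lay in A, both x and 1/x would satisfy relations as above, and the larger
  degree could be lowered forever.\<close>

lemma maximal_total: "x \<in> A \<or> inverse x \<in> A"
proof (rule ccontr)
  assume n: "\<not> ?thesis"
  then have x0: "x \<noteq> 0" using A_zero by auto
  obtain p q where pq: "p \<in> polys" "2 * poly p x = 1" "q \<in> polys" "2 * poly q (inverse x) = 1"
    using n outside_unit_ideal by meson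
  then show False
  proof (induction "degree p + degree q" arbitrary: p q rule: less_induct)
    case less
    show False
    proof (cases "degree q \<le> degree p")
      case True
      then obtain p' where "p' \<in> polys" "2 * poly p' x = 1" "degree p' < degree p"
        using degree_reduce[OF less(2-5) True x0] by blast
      then show False using less(1)[of p' q, OF _ _ _ less(4,5)] by linarith
    next
      case False
      have "2 * poly p (inverse (inverse x)) = 1" "inverse x \<noteq> 0" "degree p \<le> degree q"
        using less(3) x0 False by simp_all
      then obtain q' where "q' \<in> polys" "2 * poly q' (inverse x) = 1" "degree q' < degree q"
        using degree_reduce[OF less(4,5,2)] by blast
      then show False using less(1)[of p q', OF _ less(2,3)] by linarith
    qed
  qed
qed

end

lemma exists_val_ring2: "\<exists>V :: 'a::field_char_0 set. val_ring2 V"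
proof -
  define R where "R = Collect (ring2 :: 'a set \<Rightarrow> bool)"
  have "\<exists>M\<in>R. \<forall>Y\<in>R. M \<subseteq> Y \<longrightarrow> Y = M"
  proof (rule subset_Zorn_nonempty)
    show "R \<noteq> {}" using ring2_Ints by (auto simp: R_def)
    fix C :: "'a set set" assume C: "C \<noteq> {}" "subset.chain R C"
    have r: "ring2 A" if "A \<in> C" for A using C(2) that by (auto simp: subset.chain_def R_def)
    have "x - y \<in> \<Union>C \<and> x * y \<in> \<Union>C" if xy: "x \<in> \<Union>C" "y \<in> \<Union>C" for x y
    proof -
      obtain A B where AB: "A \<in> C" "x \<in> A" "B \<in> C" "y \<in> B" using xy by blast
      then have "A \<subseteq> B \<or> B \<subseteq> A" using C(2) unfolding subset.chain_def by blast
      then obtain A where A: "A \<in> C" "x \<in> A" "y \<in> A" using AB by blast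
      then show ?thesis using r[OF A(1)] by (auto simp: ring2_def)
    qed
    moreover have "1 \<in> \<Union>C" "inverse 2 \<notin> \<Union>C" using r C(1) by (auto simp: ring2_def)
    ultimately show "\<Union>C \<in> R" unfolding R_def ring2_def mem_Collect_eq by blast
  qed
  then obtain A :: "'a set" where A: "ring2 A" "\<And>Y. ring2 Y \<Longrightarrow> A \<subseteq> Y \<Longrightarrow> Y = A" by (auto simp: R_def)
  have "val_ring2 A"
  proof
    show "x \<in> A \<or> inverse x \<in> A" for x using maximal_total[of A x] A by blast
  qed (use A(1) in \<open>auto simp: ring2_def\<close>)
  then show ?thesis by blast
qed

subsection \<open>Towers of quadratic extensions\<close>

text \<open>Subfields as plain sets for calculation. Closure under \<open>inverse\<close> includes
  0, as \<open>inverse 0 = 0\<close>.\<close>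

definition is_field_set :: "'a::field set \<Rightarrow> bool" where
  "is_field_set F \<longleftrightarrow> 1 \<in> F \<and> (\<forall>x\<in>F. \<forall>y\<in>F. x - y \<in> F \<and> x * y \<in> F) \<and> (\<forall>x\<in>F. inverse x \<in> F)"

lemma fs_one: "is_field_set F \<Longrightarrow> 1 \<in> F"
  and fs_diff: "is_field_set F \<Longrightarrow> x \<in> F \<Longrightarrow> y \<in> F \<Longrightarrow> x - y \<in> F"
  and fs_mult: "is_field_set F \<Longrightarrow> x \<in> F \<Longrightarrow> y \<in> F \<Longrightarrow> x * y \<in> F"
  and fs_inverse: "is_field_set F \<Longrightarrow> x \<in> F \<Longrightarrow> inverse x \<in> F"
  by (auto simp: is_field_set_def)

lemma fs_zero: "is_field_set F \<Longrightarrow> 0 \<in> F"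
  using fs_diff[OF _ fs_one fs_one] by fastforce

lemma fs_minus: "is_field_set F \<Longrightarrow> x \<in> F \<Longrightarrow> - x \<in> F"
  using fs_diff[OF _ fs_zero, of F x] by simp

lemma fs_add: "is_field_set F \<Longrightarrow> x \<in> F \<Longrightarrow> y \<in> F \<Longrightarrow> x + y \<in> F"
  using fs_diff[OF _ _ fs_minus, of F x y] by simp

lemma fs_divide: "is_field_set F \<Longrightarrow> x \<in> F \<Longrightarrow> y \<in> F \<Longrightarrow> x / y \<in> F"
  using fs_mult[OF _ _ fs_inverse, of F x y] by (simp add: divide_inverse)

lemma fs_power: "is_field_set F \<Longrightarrow> x \<in> F \<Longrightarrow> x ^ n \<in> F"
  by (induction n) (auto intro: fs_one fs_mult)

lemma fs_of_nat: "is_field_set F \<Longrightarrow> of_nat n \<in> F"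
  by (induction n) (auto intro: fs_zero fs_one fs_add)

lemma fs_numeral: "is_field_set F \<Longrightarrow> numeral n \<in> F"
  using fs_of_nat[of F "numeral n"] by simp

lemma fs_of_int: "is_field_set F \<Longrightarrow> of_int n \<in> F"
  by (cases n) (auto simp del: of_nat_Suc intro: fs_of_nat fs_minus)

lemma fs_Rats:
  fixes F :: "'a::field_char_0 set"
  shows "is_field_set F \<Longrightarrow> \<rat> \<subseteq> F"
  by (auto elim!: Rats_cases' intro!: fs_divide fs_of_int)

lemma is_field_set_Rats: "is_field_set (\<rat> :: 'a::field_char_0 set)"
  by (simp add: is_field_set_def)

text \<open>The field F(s) whenever s^2 lies in F; s may already belong to F, so steps of a tower
  may be trivial.\<close>

definition adj :: "'a::field set \<Rightarrow> 'a \<Rightarrow> 'a set" where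
  "adj F s = {a + b * s |a b. a \<in> F \<and> b \<in> F}"

lemma adjI: "a \<in> F \<Longrightarrow> b \<in> F \<Longrightarrow> a + b * s \<in> adj F s"
  by (auto simp: adj_def)

lemma adj_incl: "is_field_set F \<Longrightarrow> x \<in> F \<Longrightarrow> x \<in> adj F s"
  using adjI[of x F 0 s] fs_zero by force

lemma adj_gen: "is_field_set F \<Longrightarrow> s \<in> adj F s"
  using adjI[of 0 F 1 s] fs_zero fs_one by force

lemma adj_mono: "F \<subseteq> G \<Longrightarrow> adj F s \<subseteq> adj G s"
  by (auto simp: adj_def)

lemma is_field_set_adj:
  assumes F: "is_field_set F" and s: "s * s \<in> F"
  shows "is_field_set (adj F s)"
  unfolding is_field_set_def
proof (intro conjI ballI)
  show "1 \<in> adj F s" using adj_incl fs_one F by blast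
next
  fix x y assume "x \<in> adj F s" "y \<in> adj F s"
  then obtain a b c d where xy: "x = a + b * s" "y = c + d * s" "a \<in> F" "b \<in> F" "c \<in> F" "d \<in> F"
    by (auto simp: adj_def)
  have e: "x - y = (a - c) + (b - d) * s" "x * y = (a * c + b * d * (s * s)) + (a * d + b * c) * s"
    by (simp_all add: xy algebra_simps)
  show "x - y \<in> adj F s" unfolding e(1) by (intro adjI fs_diff[OF F] xy)
  show "x * y \<in> adj F s" unfolding e(2) by (intro adjI fs_add[OF F] fs_mult[OF F] xy s)
next
  fix x assume "x \<in> adj F s"
  then obtain a b where x: "x = a + b * s" "a \<in> F" "b \<in> F" by (auto simp: adj_def)
  show "inverse x \<in> adj F s"
  proof (cases "a - b * s = 0")
    \<comment> \<open>A vanishing conjugate means that s lies in F or b = 0, so x is already in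
      F.\<close>
    case True
    then have "a = b * s" by simp
    then have "s \<in> F \<or> b = 0" using fs_divide[OF F x(2,3)] by auto
    then have "x \<in> F" using x fs_add[OF F] fs_mult[OF F] by auto
    then show ?thesis using adj_incl F fs_inverse by blast
  next
    case False
    let ?N = "a * a - b * b * (s * s)"
    have N: "?N = x * (a - b * s)" by (simp add: x algebra_simps)
    have "inverse x = (a - b * s) / ?N" using False unfolding N by (simp add: divide_inverse)
    then have "inverse x = a / ?N + (- b / ?N) * s" by (simp add: field_simps diff_divide_distrib)
    moreover have "?N \<in> F" by (intro fs_diff[OF F] fs_mult[OF F] x s)
    ultimately show ?thesis using adjI[OF fs_divide[OF F x(2)] fs_divide[OF F fs_minus[OF F x(3)]]] by metis
  qed
qed

text \<open>A cube root $a + b s$ of an element of $F$ yields the cube root $-2a$ in $F$ unless $b = 0$.\<close>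

lemma cube_root_adj:
  fixes F :: "'a::field_char_0 set"
  assumes F: "is_field_set F" and s: "s * s \<in> F" and t: "t \<in> adj F s" "t ^ 3 \<in> F"
  shows "\<exists>r\<in>F. r ^ 3 = t ^ 3"
proof -
  obtain a b where ab: "t = a + b * s" "a \<in> F" "b \<in> F" using t(1) by (auto simp: adj_def)
  let ?d = "s * s" let ?A = "a * a * a + 3 * a * b * b * ?d" let ?B = "3 * a * a * b + b * b * b * ?d"
  have e: "t ^ 3 = ?A + ?B * s" by (simp add: ab algebra_simps power3_eq_cube)
  have AB: "?A \<in> F" "?B \<in> F" using ab s fs_add[OF F] fs_mult[OF F] fs_numeral[OF F] by simp_all
  show ?thesis
  proof (cases "?B = 0")
    case False
    have "s = (t ^ 3 - ?A) / ?B" using e False by (simp add: field_simps)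
    then have "s \<in> F" using fs_divide[OF F fs_diff[OF F t(2) AB(1)] AB(2)] by simp
    then have "t \<in> F" using ab fs_add[OF F] fs_mult[OF F] by simp
    then show ?thesis by blast
  next
    case True
    then have "b * (3 * a * a + b * b * ?d) = 0" by (simp add: algebra_simps)
    then consider "b = 0" | "3 * a * a + b * b * ?d = 0" by auto
    then show ?thesis
    proof cases
      case 1
      then show ?thesis using ab by auto
    next
      case 2
      \<comment> \<open>Here b^2 d = -3 a^2, so a^3 + 3 a b^2 d = -8 a^3.\<close>
      then have "(- 2 * a) ^ 3 = t ^ 3" unfolding e True by Groebner_Basis.algebra
      moreover have "- 2 * a \<in> F" using ab(2) fs_mult[OF F] fs_minus[OF F] fs_numeral[OF F] by simp
      ultimately show ?thesis by blast
    qed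
  qed
qed

primrec adjs :: "'a::field set \<Rightarrow> 'a list \<Rightarrow> 'a set" where
  "adjs F [] = F"
| "adjs F (s # l) = adj (adjs F l) s"

lemma is_field_set_adjs:
  assumes "is_field_set F" "\<forall>s\<in>set l. s * s \<in> F"
  shows "is_field_set (adjs F l) \<and> F \<subseteq> adjs F l"
  using assms
proof (induction l)
  case (Cons s l)
  then have IH: "is_field_set (adjs F l)" "F \<subseteq> adjs F l" by auto
  then have "s * s \<in> adjs F l" using Cons(3) by auto
  from is_field_set_adj[OF IH(1) this] show ?case using adj_incl[OF IH(1)] IH(2) by auto
qed simp

lemma adjs_append_right:
  assumes "is_field_set F" "\<forall>s\<in>set (l @ l'). s * s \<in> F"
  shows "adjs F l' \<subseteq> adjs F (l @ l')"
  using assms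
proof (induction l)
  case (Cons s l)
  then have "is_field_set (adjs F (l @ l'))" using is_field_set_adjs by (metis append_Cons list.set_intros(2))
  then show ?case using Cons adj_incl by fastforce
qed simp

lemma adjs_mono: "F \<subseteq> G \<Longrightarrow> adjs F l \<subseteq> adjs G l"
proof (induction l)
  case (Cons s l)
  then show ?case using adj_mono by simp
qed simp

lemma adjs_append: "adjs F (l @ l') = adjs (adjs F l') l"
  by (induction l) auto

lemma adjs_append_left:
  assumes "is_field_set F" "\<forall>s\<in>set (l @ l'). s * s \<in> F"
  shows "adjs F l \<subseteq> adjs F (l @ l')"
  unfolding adjs_append by (rule adjs_mono) (use is_field_set_adjs[OF assms(1), of l'] assms(2) in auto)

lemma cube_root_adjs:
  fixes F :: "'a::field_char_0 set"
  assumes "is_field_set F" "\<forall>s\<in>set l. s * s \<in> F" "t \<in> adjs F l" "t ^ 3 \<in> F"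
  shows "\<exists>r\<in>F. r ^ 3 = t ^ 3"
  using assms
proof (induction l arbitrary: t)
  case (Cons s l)
  have fs: "is_field_set (adjs F l)" "F \<subseteq> adjs F l" using is_field_set_adjs[of F l] Cons by auto
  have "s * s \<in> adjs F l" "t ^ 3 \<in> adjs F l" using Cons fs by auto
  then obtain r where "r \<in> adjs F l" "r ^ 3 = t ^ 3" using cube_root_adj[OF fs(1)] Cons(4) by auto
  then show ?case using Cons(1)[of r] Cons(2-5) by simp
qed auto

text \<open>A directed union of finite towers: S may be infinite, and each statement about finitely
  many elements reduces to one list.\<close>

definition tower :: "'a::field set \<Rightarrow> 'a set \<Rightarrow> 'a set" where
  "tower F S = (\<Union>l\<in>{l. set l \<subseteq> S}. adjs F l)"

lemma is_field_set_tower: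
  assumes F: "is_field_set F" and S: "\<And>s. s \<in> S \<Longrightarrow> s * s \<in> F"
  shows "is_field_set (tower F S)" "F \<subseteq> tower F S" "S \<subseteq> tower F S"
proof -
  have fs: "is_field_set (adjs F l)" if "set l \<subseteq> S" for l using is_field_set_adjs[OF F, of l] S that by auto
  have two: "\<exists>l. set l \<subseteq> S \<and> x \<in> adjs F l \<and> y \<in> adjs F l" if xy: "x \<in> tower F S" "y \<in> tower F S" for x y
  proof -
    obtain l l' where l: "set l \<subseteq> S" "x \<in> adjs F l" "set l' \<subseteq> S" "y \<in> adjs F l'"
      using xy by (auto simp: tower_def)
    then have "\<forall>s\<in>set (l @ l'). s * s \<in> F" using S by auto
    from adjs_append_left[OF F this] adjs_append_right[OF F this] show ?thesis
      using l by (intro exI[of _ "l @ l'"]) auto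
  qed
  show F': "F \<subseteq> tower F S" unfolding tower_def by (rule subsetI, rule UN_I[of "[]"]) auto
  show "S \<subseteq> tower F S"
  proof
    fix s assume "s \<in> S"
    then show "s \<in> tower F S" using adj_gen[OF F, of s] by (auto simp: tower_def intro!: exI[of _ "[s]"])
  qed
  show "is_field_set (tower F S)" unfolding is_field_set_def
  proof (intro conjI ballI)
    show "1 \<in> tower F S" using F' fs_one[OF F] by blast
    fix x assume x: "x \<in> tower F S"
    obtain l where "set l \<subseteq> S" "x \<in> adjs F l" using x by (auto simp: tower_def)
    then show "inverse x \<in> tower F S" using fs_inverse[OF fs, of l x] by (auto simp: tower_def)
    fix y assume y: "y \<in> tower F S"
    obtain l where "set l \<subseteq> S" "x \<in> adjs F l" "y \<in> adjs F l" using two[OF x y] by blast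
    then show "x - y \<in> tower F S" "x * y \<in> tower F S"
      using fs_diff[OF fs, of l x y] fs_mult[OF fs, of l x y] by (auto simp: tower_def)
  qed
qed

subsection \<open>Residue fields in towers\<close>

context val_ring2
begin

text \<open>The units whose residue is a nonzero element of F_4, that is, a cube root of
  unity.\<close>

definition U :: "'a set" where "U = {u \<in> V. u \<notin> M \<and> u ^ 3 - 1 \<in> M}"

text \<open>Expresses that the residue field of F embeds into F_4.\<close>

definition small_residue :: "'a set \<Rightarrow> bool" where
  "small_residue F \<longleftrightarrow> (\<forall>u\<in>F. u \<in> V \<longrightarrow> u \<notin> M \<longrightarrow> u ^ 3 - 1 \<in> M)"

lemma U_V: "u \<in> U \<Longrightarrow> u \<in> V" and U_M: "u \<in> U \<Longrightarrow> u \<notin> M" and U_cube: "u \<in> U \<Longrightarrow> u ^ 3 - 1 \<in> M"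
  by (auto simp: U_def)

lemma U_one: "1 \<in> U" using one one_not_M M_zero by (simp add: U_def)

lemma U_mult: assumes "u \<in> U" "v \<in> U" shows "u * v \<in> U"
proof -
  have "(u * v) ^ 3 - 1 = u ^ 3 * (v ^ 3 - 1) + (u ^ 3 - 1)" by (simp add: algebra_simps power_mult_distrib)
  moreover have "u ^ 3 * (v ^ 3 - 1) + (u ^ 3 - 1) \<in> M"
    using assms U_V U_cube by (intro M_add M_mult2 power) auto
  ultimately have "(u * v) ^ 3 - 1 \<in> M" by metis
  moreover have "u * v \<notin> M" using M_prime assms U_V U_M by blast
  ultimately show ?thesis using assms mult by (simp add: U_def)
qed

lemma U_add_M: assumes "u \<in> U" "m \<in> M" shows "u + m \<in> U"
proof -
  have "(u + m) ^ 3 - 1 = (u ^ 3 - 1) + m * (3 * u * u + 3 * u * m + m * m)"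
    by (simp add: algebra_simps power3_eq_cube)
  moreover have "(u ^ 3 - 1) + m * (3 * u * u + 3 * u * m + m * m) \<in> M"
    using assms U_V M_V U_cube by (intro M_add M_mult V_intros) auto
  ultimately have "(u + m) ^ 3 - 1 \<in> M" by metis
  moreover have "u + m \<in> V" using add U_V[OF assms(1)] M_V[OF assms(2)] by blast
  moreover have "u + m \<notin> M" by (rule unit_add_M[OF U_M[OF assms(1)] assms(2)])
  ultimately show ?thesis by (simp add: U_def)
qed

lemma U_inverse: assumes "u \<in> U" shows "inverse u \<in> U"
proof -
  have u0: "u \<noteq> 0" using U_M assms M_zero by auto
  have i: "inverse u \<in> V" using assms unit U_V U_M by blast
  have "inverse u ^ 3 - 1 = - ((u ^ 3 - 1) * inverse u ^ 3)" using u0 by (simp add: algebra_simps power_inverse)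
  moreover have "- ((u ^ 3 - 1) * inverse u ^ 3) \<in> M" using assms U_cube i by (intro M_minus M_mult power) auto
  ultimately have "inverse u ^ 3 - 1 \<in> M" by metis
  moreover have "inverse u \<notin> M" using unit_iff[of "inverse u"] u0 U_V[OF assms] by simp
  ultimately show ?thesis using i by (simp add: U_def)
qed

lemma U_nonzero: "u \<in> U \<Longrightarrow> u \<noteq> 0" using U_M M_zero by auto

lemma U_power: "u \<in> U \<Longrightarrow> u ^ k \<in> U"
  by (induction k) (auto intro: U_one U_mult)

lemma U_powi: "u \<in> U \<Longrightarrow> u powi n \<in> U"
  unfolding power_int_def using U_power U_inverse by presburger

lemma small_residueD: "small_residue F \<Longrightarrow> u \<in> F \<Longrightarrow> u \<in> V \<Longrightarrow> u \<notin> M \<Longrightarrow> u \<in> U"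
  by (simp add: small_residue_def U_def)

text \<open>Discreteness with uniformizer p and residues in F_4. As p itself is not asked to lie in
  F, the property passes to subsets.\<close>

definition uniformized :: "'a set \<Rightarrow> 'a \<Rightarrow> bool" where
  "uniformized F p \<longleftrightarrow> p \<in> M \<and> p \<noteq> 0 \<and> (\<forall>a\<in>F. a \<noteq> 0 \<longrightarrow> (\<exists>n u. u \<in> U \<and> a = p powi n * u))"

lemma powi_M: assumes "p \<in> M" "n > 0" shows "p powi n \<in> M"
proof -
  obtain k where "n = int (Suc k)" using assms(2) by (metis gr0_conv_Suc zero_less_imp_eq_int of_nat_0_less_iff)
  then have "p powi n = p * p ^ k" by (simp add: power_int_def nat_add_distrib)
  then show ?thesis using M_mult[OF assms(1) power[OF M_V[OF assms(1)]]] by simp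
qed

lemma powi_unit_zero:
  assumes p: "p \<in> M" "p \<noteq> 0" and u: "u \<in> U" and a: "p powi n * u \<in> V" "p powi n * u \<notin> M"
  shows "n = 0"
proof (rule ccontr)
  assume "n \<noteq> 0"
  then consider "n > 0" | "- n > 0" by linarith
  then show False
  proof cases
    case 1
    then show False using a(2) M_mult[OF powi_M[OF p(1) 1] U_V[OF u]] by simp
  next
    case 2
    have "p powi n * p powi (- n) = 1" using p(2) by (simp flip: power_int_add)
    then have "(p powi n * u) * (p powi (- n) * inverse u) = 1" using U_nonzero[OF u] by (simp add: ac_simps)
    moreover have "(p powi n * u) * (p powi (- n) * inverse u) \<in> M"
      by (rule M_mult2[OF M_mult[OF powi_M[OF p(1) 2] U_V[OF U_inverse[OF u]]] a(1)])
    ultimately show False using one_not_M by simp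
  qed
qed

lemma uniformized_small_residue: "uniformized F p \<Longrightarrow> small_residue F"
  unfolding small_residue_def uniformized_def
  using powi_unit_zero unit_nonzero U_cube by (metis mult_1 power_int_0_right)

lemma rat_decomposition:
  assumes "a \<in> \<rat>" "a \<noteq> 0"
  shows "\<exists>n u. u \<in> V \<and> u - 1 \<in> M \<and> a = 2 powi n * u"
proof -
  have int: "\<exists>k u. u \<in> V \<and> u - 1 \<in> M \<and> of_int m = 2 ^ k * u" if m: "m \<noteq> 0" for m
    using m
  proof (induction "nat \<bar>m\<bar>" arbitrary: m rule: less_induct)
    case less
    show ?case
    proof (cases "even m")
      case True
      then obtain m' where m': "m = 2 * m'" by (auto elim: evenE)
      then have "\<exists>k u. u \<in> V \<and> u - 1 \<in> M \<and> of_int m' = 2 ^ k * u" using less(1)[of m'] less(2) by simp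
      then obtain k u where "u \<in> V" "u - 1 \<in> M" "of_int m' = 2 ^ k * u" by blast
      then show ?thesis using m' by (intro exI[of _ "Suc k"] exI[of _ u]) simp
    next
      case False
      then obtain j where "m = 2 * j + 1" by (auto elim: oddE)
      then have "of_int m - 1 = 2 * (of_int j :: 'a)" by simp
      then show ?thesis using M_mult[OF two_M of_int[of j]] of_int[of m]
        by (intro exI[of _ 0] exI[of _ "of_int m"]) simp
    qed
  qed
  obtain i j where ij: "a = of_int i / of_int j" "j \<noteq> 0"
    using assms(1) by (auto elim!: Rats_cases')
  then have "i \<noteq> 0" using assms(2) by auto
  obtain k u l v where uv: "u \<in> V" "u - 1 \<in> M" "of_int i = 2 ^ k * u" "v \<in> V" "v - 1 \<in> M" "of_int j = 2 ^ l * v"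
    using int[OF \<open>i \<noteq> 0\<close>] int[OF ij(2)] by blast
  have v: "v \<notin> M" using M_diff[of v "v - 1"] uv(5) one_not_M by auto
  then have v0: "v \<noteq> 0" "inverse v \<in> V" using unit unit_nonzero uv(4) by auto
  have "a = 2 powi (int k - int l) * (u * inverse v)"
    using v0 ij(1) uv(3,6) by (simp add: power_int_diff field_simps)
  moreover have "u * inverse v - 1 = ((u - 1) - (v - 1)) * inverse v" using v0 by (simp add: field_simps)
  moreover have "((u - 1) - (v - 1)) * inverse v \<in> M" by (rule M_mult[OF M_diff[OF uv(2,5)] v0(2)])
  ultimately show ?thesis using mult[OF uv(1) v0(2)] by metis
qed

lemma one_mod_M_U: "u \<in> V \<Longrightarrow> u - 1 \<in> M \<Longrightarrow> u \<in> U"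
  using U_add_M[OF U_one, of "u - 1"] by simp

text \<open>The prime 2 is inert: since 1 + w = -w^2 is a unit, a + b w has the smaller of the
  valuations of a and b, and its leading residue is 1, w or 1 + w.\<close>

lemma uniformized_omega:
  assumes w: "w * w + w + 1 = 0"
  shows "uniformized (adj \<rat> w) 2"
proof -
  have w3: "w ^ 3 = 1" using w by Groebner_Basis.algebra
  have "w \<in> V" using V_powerD[of w 2] w3 one by (simp add: eval_nat_numeral)
  have "w \<notin> M" using M_mult[of w "w * w"] w3 one_not_M mult[OF \<open>w \<in> V\<close> \<open>w \<in> V\<close>] by (auto simp: power3_eq_cube mult.assoc)
  then have wU: "w \<in> U" using \<open>w \<in> V\<close> w3 M_zero by (simp add: U_def)
  have "- 1 \<in> U" using U_add_M[OF U_one, of "- 2"] M_minus[OF two_M] by simp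
  moreover have "1 + w = - 1 * (w * w)" using w by Groebner_Basis.algebra
  ultimately have w1U: "1 + w \<in> U" using wU U_mult by metis
  have "\<exists>n u. u \<in> U \<and> a + b * w = 2 powi n * u"
    if ab: "a \<in> \<rat>" "b \<in> \<rat>" "a + b * w \<noteq> 0" for a b
  proof (cases "a = 0 \<or> b = 0")
    case True
    then show ?thesis
    proof (cases "b = 0")
      case True
      then show ?thesis using ab rat_decomposition[of a] one_mod_M_U by auto
    next
      case False
      with True have "a = 0" by simp
      moreover obtain n u where "u \<in> V" "u - 1 \<in> M" "b = 2 powi n * u" using rat_decomposition[of b] ab False by blast
      ultimately show ?thesis using one_mod_M_U[of u] U_mult[OF _ wU, of u]
        by (intro exI[of _ n] exI[of _ "u * w"]) (simp add: mult.assoc)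
    qed
  next
    case False
    obtain n u where a: "u \<in> V" "u - 1 \<in> M" "a = 2 powi n * u" using rat_decomposition[of a] ab False by blast
    obtain m v where b: "v \<in> V" "v - 1 \<in> M" "b = 2 powi m * v" using rat_decomposition[of b] ab False by blast
    consider "n = m" | "n < m" | "m < n" by linarith
    then show ?thesis
    proof cases
      case 1
      have "u + v * w = (1 + w) + ((u - 1) + (v - 1) * w)" by (simp add: algebra_simps)
      moreover have "(u - 1) + (v - 1) * w \<in> M" using a b \<open>w \<in> V\<close> by (intro M_add M_mult)
      ultimately have "u + v * w \<in> U" using U_add_M[OF w1U] by metis
      then show ?thesis using 1 a b by (intro exI[of _ n] exI[of _ "u + v * w"]) (simp add: algebra_simps)
    next
      case 2
      have "2 powi (m - n) * (v * w) \<in> M" using powi_M[OF two_M, of "m - n"] 2 b(1) \<open>w \<in> V\<close> by (intro M_mult mult) auto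
      then have "u + 2 powi (m - n) * (v * w) \<in> U" using U_add_M one_mod_M_U a by blast
      moreover have "2 powi m = 2 powi n * (2 :: 'a) powi (m - n)" by (simp flip: power_int_add)
      ultimately show ?thesis using a b
        by (intro exI[of _ n] exI[of _ "u + 2 powi (m - n) * (v * w)"]) (simp add: algebra_simps)
    next
      case 3
      have "2 powi (n - m) * u \<in> M" using powi_M[OF two_M, of "n - m"] 3 a(1) by (intro M_mult) auto
      then have "v * w + 2 powi (n - m) * u \<in> U" using U_add_M[OF U_mult[OF one_mod_M_U[OF b(1,2)] wU]] by blast
      moreover have "2 powi n = 2 powi m * (2 :: 'a) powi (n - m)" by (simp flip: power_int_add)
      ultimately show ?thesis using a b
        by (intro exI[of _ m] exI[of _ "v * w + 2 powi (n - m) * u"]) (simp add: algebra_simps)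
    qed
  qed
  then show ?thesis unfolding uniformized_def using two_M by (auto simp: adj_def)
qed

text \<open>Measured by the new uniformizer, elements of F have even valuation and their multiples
  by it odd valuation. The two terms of an element therefore never cancel, and no new residues
  appear.\<close>

lemma uniformized_ramified:
  assumes F: "uniformized F p" and \<pi>: "\<pi> * \<pi> = p * e" "e \<in> U"
  shows "uniformized (adj F \<pi>) \<pi>"
proof -
  have p: "p \<in> M" "p \<noteq> 0" using F by (auto simp: uniformized_def)
  have "\<pi> ^ Suc 1 \<in> M" using M_mult[OF p(1) U_V[OF \<pi>(2)]] \<pi>(1) by (simp add: power2_eq_square)
  then have M: "\<pi> \<in> M" by (rule M_powerD)
  have nz: "\<pi> \<noteq> 0" using \<pi> p U_nonzero by auto
  have pp: "p powi n = \<pi> powi (2 * n) * inverse e powi n" for n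
  proof -
    have "p = \<pi> powi 2 * inverse e" using \<pi> U_nonzero[OF \<pi>(2)] by (simp add: power2_eq_square)
    then show ?thesis by (metis power_int_mult power_int_mult_distrib)
  qed
  have dec: "\<exists>n u. u \<in> U \<and> a = \<pi> powi (2 * n) * u" if a: "a \<in> F" "a \<noteq> 0" for a
  proof -
    obtain n u where "u \<in> U" "a = p powi n * u" using F a unfolding uniformized_def by blast
    then show ?thesis unfolding pp
      by (intro exI[of _ n] exI[of _ "inverse e powi n * u"]) (auto intro: U_mult U_powi U_inverse \<pi>(2) simp: mult.assoc)
  qed
  have comb: "\<exists>n u. u \<in> U \<and> \<pi> powi i * u1 + \<pi> powi j * u2 = \<pi> powi n * u"
    if "u1 \<in> U" "u2 \<in> U" "i < j" for i j u1 u2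
  proof -
    have "\<pi> powi (j - i) * u2 \<in> M" using powi_M[OF M, of "j - i"] that U_V by (intro M_mult) auto
    then have "u1 + \<pi> powi (j - i) * u2 \<in> U" using U_add_M that(1) by blast
    moreover have "\<pi> powi j = \<pi> powi i * \<pi> powi (j - i)" using nz by (simp flip: power_int_add)
    ultimately show ?thesis
      by (intro exI[of _ i] exI[of _ "u1 + \<pi> powi (j - i) * u2"]) (simp add: algebra_simps)
  qed
  have "\<exists>n u. u \<in> U \<and> a + b * \<pi> = \<pi> powi n * u" if ab: "a \<in> F" "b \<in> F" "a + b * \<pi> \<noteq> 0" for a b
  proof (cases "b = 0")
    case True
    then show ?thesis using dec[of a] ab by auto
  next
    case False
    then obtain m v where b: "v \<in> U" "b * \<pi> = \<pi> powi (2 * m + 1) * v"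
      using dec[of b] ab nz by (auto simp: power_int_add ac_simps)
    show ?thesis
    proof (cases "a = 0")
      case True
      then show ?thesis using b by auto
    next
      case False
      then obtain n u where a: "u \<in> U" "a = \<pi> powi (2 * n) * u" using dec[of a] ab by auto
      have "2 * n < 2 * m + 1 \<or> 2 * m + 1 < 2 * n" by presburger
      then show ?thesis
        unfolding a(2) b(2) using comb[OF a(1) b(1)] comb[OF b(1) a(1), of "2 * m + 1" "2 * n"]
        by (metis add.commute)
    qed
  qed
  then show ?thesis unfolding uniformized_def using M nz by (auto simp: adj_def)
qed

lemma small_residue_unramified:
  assumes F: "is_field_set F" "small_residue F" and s: "s * s \<in> F" "s * s = 1 + 8 * k" "k \<in> V"
  shows "small_residue (adj F s)"
proof -
  define t where "t = (1 + s) / 2"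
  have st: "s = 2 * t - 1" unfolding t_def by (simp add: field_simps)
  have tt: "t * t - t = 2 * k"
  proof -
    have "4 * (t * t - t) = 4 * (2 * k)" using s(2) unfolding st by (simp add: algebra_simps)
    then show ?thesis by (rule mult_left_cancel[THEN iffD1, rotated]) simp
  qed
  have ttF: "t * t - t \<in> F"
  proof -
    have e: "2 * k = (s * s - 1) / 4" using s(2) by simp
    show ?thesis unfolding tt e by (rule fs_divide[OF F(1) fs_diff[OF F(1) s(1) fs_one[OF F(1)]] fs_numeral[OF F(1)]])
  qed
  have ttM: "t * t - t \<in> M" unfolding tt by (rule M_mult[OF two_M s(3)])
  have tV: "t \<in> V"
  proof (rule ccontr)
    assume t: "t \<notin> V"
    then have "t \<noteq> 0" using zero by auto
    then have "1 = inverse t + (t * t - t) * (inverse t * inverse t)" by (simp add: field_simps)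
    moreover have "inverse t + (t * t - t) * (inverse t * inverse t) \<in> M"
      using inverse_M[OF t] M_V[OF inverse_M[OF t]] ttM by (intro M_add M_mult mult)
    ultimately show False using one_not_M by simp
  qed
  have "t * (t - 1) \<in> M" using ttM by (simp add: algebra_simps)
  then have "t \<in> M \<or> t - 1 \<in> M" using M_prime tV diff one by blast
  \<comment> \<open>The residue of t, which is 0 or 1.\<close>
  then obtain \<theta> where \<theta>: "\<theta> \<in> F" "\<theta> \<in> V" "t - \<theta> \<in> M"
    using fs_zero[OF F(1)] fs_one[OF F(1)] zero one by (metis diff_zero)
  have key: "c + t \<in> U" if "c \<in> F" "c \<in> V" "c + t \<notin> M" for c
  proof -
    have e: "c + t = (c + \<theta>) + (t - \<theta>)" by simp
    then have "c + \<theta> \<notin> M" using M_add \<theta>(3) that(3) by metis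
    then have "c + \<theta> \<in> U" using small_residueD[OF F(2)] fs_add[OF F(1) that(1) \<theta>(1)] add[OF that(2) \<theta>(2)] by blast
    then show ?thesis unfolding e using U_add_M \<theta>(3) by blast
  qed
  show ?thesis unfolding small_residue_def
  proof (intro ballI impI)
    fix u assume u: "u \<in> adj F s" "u \<in> V" "u \<notin> M"
    then obtain a b where ab: "a \<in> F" "b \<in> F" "u = a + b * s" by (auto simp: adj_def)
    define r q where rq: "r = a - b" "q = 2 * b"
    have rqF: "r \<in> F" "q \<in> F" using ab fs_diff[OF F(1)] fs_mult[OF F(1)] fs_numeral[OF F(1)] by (auto simp: rq)
    have u_eq: "u = r + q * t" unfolding ab(3) rq st by (simp add: algebra_simps)
    have unitF: "x \<in> U" if x: "x \<in> F" "x * v \<in> V" "x * v \<notin> M" "v \<in> U" for x v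
    proof -
      have v0: "v \<noteq> 0" using U_nonzero[OF x(4)] .
      have "x = (x * v) * inverse v" using v0 by simp
      then have "x \<in> V" using mult[OF x(2) U_V[OF U_inverse[OF x(4)]]] by metis
      moreover have "x \<notin> M" using x(3) M_mult[OF _ U_V[OF x(4)]] by blast
      ultimately show ?thesis using small_residueD[OF F(2) x(1)] by blast
    qed
    have "u \<in> U"
    proof (cases "q = 0")
      case True
      then show ?thesis using small_residueD[OF F(2)] rqF u u_eq by simp
    next
      case q: False
      define c where "c = r / q"
      have cF: "c \<in> F" unfolding c_def by (rule fs_divide[OF F(1) rqF])
      have uc: "u = q * (c + t)" using q by (simp add: u_eq c_def field_simps)
      show ?thesis
      \<comment> \<open>With u = q (c + t): if c is not integral, c dominates; if c + t is a unit,
        it agrees with c plus the residue of t; otherwise its conjugate c + 1 - t is a unit, and u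
        is the element q N of F divided by it.\<close>
      proof (cases "c \<in> V")
        case False
        then have "c \<noteq> 0" using zero by auto
        have "inverse c * t \<in> M" using M_mult[OF inverse_M[OF False] tV] .
        then have v: "1 + inverse c * t \<in> U" using U_add_M[OF U_one] by blast
        have e: "u = (q * c) * (1 + inverse c * t)" using uc \<open>c \<noteq> 0\<close> by (simp add: field_simps)
        have "q * c \<in> U" using unitF[of "q * c"] fs_mult[OF F(1) rqF(2) cF] u v e by metis
        then show ?thesis unfolding e using U_mult v by blast
      next
        case c: True
        show ?thesis
        proof (cases "c + t \<in> M")
          case False
          then have v: "c + t \<in> U" using key cF c by blast
          then have "q \<in> U" using unitF[of q] rqF u uc by metis
          then show ?thesis unfolding uc using U_mult v by blast
        next
          case True
          have "1 - 2 * t + (c + t) \<in> U"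
            using U_add_M[OF U_add_M[OF U_one M_minus[OF M_mult[OF two_M tV]]] True] by simp
          then have v: "c + 1 - t \<in> U" by (simp add: algebra_simps)
          define N where "N = c * c + c - (t * t - t)"
          have N: "N = (c + t) * (c + 1 - t)" by (simp add: N_def algebra_simps)
          have "q * N \<in> F" unfolding N_def by (intro fs_mult[OF F(1)] fs_add[OF F(1)] fs_diff[OF F(1)] rqF cF ttF)
          moreover have e: "q * N * inverse (c + 1 - t) = u" using U_nonzero[OF v] by (simp add: N uc)
          ultimately have "q * N \<in> U" using unitF[of "q * N"] u U_inverse[OF v] by metis
          then show ?thesis using U_mult[OF _ U_inverse[OF v]] e by metis
        qed
      qed
    qed
    then show "u ^ 3 - 1 \<in> M" by (rule U_cube)
  qed
qed

lemma small_residue_adjs: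
  assumes F: "is_field_set F" "small_residue F"
    and l: "\<forall>s\<in>set l. \<exists>k. s * s = 1 + 8 * of_int k"
  shows "small_residue (adjs F l)"
  using l
proof (induction l)
  case (Cons s l)
  have "s * s \<in> F" if "\<exists>k. s * s = 1 + 8 * of_int k" for s
    using that fs_of_int[OF F(1)] fs_add[OF F(1)] fs_mult[OF F(1)] fs_one[OF F(1)] fs_numeral[OF F(1)] by metis
  then have fs: "is_field_set (adjs F l)" "F \<subseteq> adjs F l" "s * s \<in> F"
    using is_field_set_adjs[OF F(1), of l] Cons(2) by auto
  obtain k where "s * s = 1 + 8 * of_int k" using Cons(2) by auto
  then show ?case using small_residue_unramified[OF fs(1), of s "of_int k"] Cons fs of_int by auto
qed (use F in simp)

end

text \<open>Every odd residue modulo 8 is its own inverse, and the residues are 1, 3, -3, -1; so one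
  factor c brings the odd part to 1 modulo 8. Using -3 instead of 5 fits the given square
  root.\<close>

lemma int_square_class:
  fixes N :: int
  assumes "N \<noteq> 0"
  obtains c \<delta> a k where "c \<in> {1, -1, -3, 3}" "\<delta> \<in> {1, 2}" "N * c = 4 ^ a * \<delta> * (1 + 8 * k)"
proof -
  have "\<exists>c \<delta> a k. c \<in> {1, -1, -3, 3} \<and> \<delta> \<in> {1, 2} \<and> N * c = 4 ^ a * \<delta> * (1 + 8 * k)"
    using assms
  proof (induction "nat \<bar>N\<bar>" arbitrary: N rule: less_induct)
    case less
    have odd: "\<exists>c k. c \<in> {1, -1, -3, 3} \<and> m * c = 1 + 8 * k" if "odd m" for m :: int
    proof -
      define q where "q = m div 8"
      have "m = 8 * q + m mod 8" by (simp add: q_def)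
      moreover have "m mod 8 = 1 \<or> m mod 8 = 3 \<or> m mod 8 = 5 \<or> m mod 8 = 7" using that by presburger
      ultimately have "m = 8 * q + 1 \<or> m = 8 * q + 3 \<or> m = 8 * q + 5 \<or> m = 8 * q + 7" by metis
      then have "m * 1 = 1 + 8 * q \<or> m * 3 = 1 + 8 * (3 * q + 1) \<or> m * -3 = 1 + 8 * (-3 * q - 2)
          \<or> m * -1 = 1 + 8 * (- q - 1)" by (elim disjE) simp_all
      then show ?thesis by blast
    qed
    have "odd N \<or> (\<exists>m. odd m \<and> N = 2 * m) \<or> (\<exists>m. N = 4 * m)" by presburger
    then consider "odd N" | "\<exists>m. odd m \<and> N = 2 * m" | "\<exists>m. N = 4 * m" by blast
    then show ?case
    proof cases
      case 1
      then show ?thesis using odd[of N] by (metis insertI1 mult_1 power_0)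
    next
      case 2
      then obtain m c k where "N = 2 * m" "c \<in> {1, -1, -3, 3}" "m * c = 1 + 8 * k" using odd by blast
      then show ?thesis by (intro exI[of _ c] exI[of _ 2] exI[of _ 0] exI[of _ k]) auto
    next
      case 3
      then obtain m where m: "N = 4 * m" by blast
      have "\<exists>c \<delta> a k. c \<in> {1, -1, -3, 3} \<and> \<delta> \<in> {1, 2} \<and> m * c = 4 ^ a * \<delta> * (1 + 8 * k)"
        by (rule less(1)) (use m less(2) in auto)
      then obtain c \<delta> a k where "c \<in> {1, -1, -3, 3}" "\<delta> \<in> {1, 2}" "m * c = 4 ^ a * \<delta> * (1 + 8 * k)"
        by blast
      then show ?thesis using m by (intro exI[of _ c] exI[of _ \<delta>] exI[of _ "Suc a"] exI[of _ k]) auto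
    qed
  qed
  then show ?thesis using that by blast
qed

subsection \<open>The maximal multi-quadratic tower\<close>

lemma adj_subset:
  assumes F: "is_field_set F" and "s = c + d * t" "c \<in> F" "d \<in> F"
  shows "adj F s \<subseteq> adj F t"
proof
  fix x assume "x \<in> adj F s"
  then obtain a b where x: "x = a + b * s" "a \<in> F" "b \<in> F" by (auto simp: adj_def)
  have e: "x = (a + b * c) + (b * d) * t" unfolding x assms(2) by (simp add: algebra_simps)
  show "x \<in> adj F t" unfolding e by (intro adjI fs_add[OF F] fs_mult[OF F] x assms)
qed

context val_ring2
begin

lemma uniformized_mono: "uniformized G p \<Longrightarrow> F \<subseteq> G \<Longrightarrow> uniformized F p"
  by (auto simp: uniformized_def)

text \<open>The 2-adic valuation of 4 r^3 is 2 + 3n, never 0. A 2-torsion point has y = -1/2, hence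
  x^3 = -1/4, which is where the equation comes from.\<close>

lemma no_rat_cube_root:
  fixes r :: 'a
  assumes "r \<in> \<rat>" shows "4 * r ^ 3 \<noteq> - 1"
proof
  assume "4 * r ^ 3 = - 1"
  with assms have r: "r \<in> \<rat>" "4 * r ^ 3 = - 1" by auto
  then have "r \<noteq> 0" by auto
  then obtain n u where u: "u \<in> V" "u - 1 \<in> M" "r = 2 powi n * u" using rat_decomposition r(1) by blast
  have "2 powi (2 + 3 * n) = 2 powi 2 * (2 :: 'a) powi (n * 3)" by (simp add: power_int_add mult.commute)
  also have "\<dots> = 4 * (2 powi n) ^ 3" by (simp add: power_int_mult)
  finally have e: "2 powi (2 + 3 * n) * u ^ 3 = - 1" using r(2) u(3) by (simp add: power_mult_distrib mult.assoc)
  have "2 + 3 * n = 0"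
  proof (rule powi_unit_zero[OF two_M])
    show "u ^ 3 \<in> U" using U_power one_mod_M_U u by blast
    show "2 powi (2 + 3 * n) * u ^ 3 \<in> V" "2 powi (2 + 3 * n) * u ^ 3 \<notin> M"
      unfolding e using minus[OF one] M_minus[of "- 1"] one_not_M by auto
  qed simp
  then show False by presburger
qed

end

text \<open>The local field at 2 is built with uniformizers 2, 1 + i and 1 - z, where z is a
  primitive eighth root of unity: the first step is inert and the other two ramify. Cube roots of
  -1/4 descend through all three steps to the rationals.\<close>

lemma
  fixes r i q :: "'a::field_char_0"
  assumes r: "r * r = - 3" and i: "i * i = - 1" and q: "q * q = 2"
  defines "F0 \<equiv> adj (adj (adj \<rat> r) i) q"
  shows base_tower_field: "is_field_set F0" and base_tower_gens: "r \<in> F0" "i \<in> F0" "q \<in> F0"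
    and base_tower_residue: "val_ring2 V \<Longrightarrow> val_ring2.small_residue V F0"
    and base_tower_cube: "t \<in> F0 \<Longrightarrow> 4 * t ^ 3 \<noteq> - 1"
proof -
  note F = is_field_set_Rats
  define F1 F2 where F12: "F1 = adj \<rat> r" "F2 = adj F1 i"
  have s1: "r * r \<in> \<rat>" unfolding r by simp
  have F1: "is_field_set F1" unfolding F12 by (rule is_field_set_adj[OF F s1])
  have s2: "i * i \<in> F1" unfolding i using fs_minus[OF F1 fs_one[OF F1]] .
  have F2: "is_field_set F2" unfolding F12(2) by (rule is_field_set_adj[OF F1 s2])
  have s3: "q * q \<in> F2" unfolding q by (rule fs_numeral[OF F2])
  have F0: "F0 = adj F2 q" by (simp add: F0_def F12)
  show F0f: "is_field_set F0" unfolding F0 by (rule is_field_set_adj[OF F2 s3])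
  have g: "r \<in> F1" "i \<in> F2" unfolding F12 by (rule adj_gen[OF F], rule adj_gen[OF F1[unfolded F12]])
  show "q \<in> F0" "i \<in> F0" "r \<in> F0" unfolding F0
    using adj_gen[OF F2] adj_incl[OF F2] adj_incl[OF F1] g F12(2) by auto
  show "4 * t ^ 3 \<noteq> - 1" if t: "t \<in> F0"
  proof
    assume "4 * t ^ 3 = - 1"
    then have t3: "t ^ 3 = - 1 / 4" by (simp add: field_simps)
    then have Q: "t ^ 3 \<in> \<rat>" by simp
    obtain t2 where t2: "t2 \<in> F2" "t2 ^ 3 = t ^ 3"
      using cube_root_adj[OF F2 s3 t[unfolded F0]] fs_Rats[OF F2] Q by blast
    obtain t1 where t1: "t1 \<in> F1" "t1 ^ 3 = t ^ 3"
      using cube_root_adj[OF F1 s2 t2(1)[unfolded F12(2)]] fs_Rats[OF F1] Q t2(2) by auto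
    obtain t0 where t0: "t0 \<in> \<rat>" "t0 ^ 3 = t ^ 3"
      using cube_root_adj[OF F s1 t1(1)[unfolded F12(1)]] Q t1(2) by auto
    obtain V where "val_ring2 (V :: 'a set)" using exists_val_ring2 by blast
    then show False using val_ring2.no_rat_cube_root[OF _ t0(1)] t0(2) t3 by simp
  qed
  show "val_ring2.small_residue V F0" if V: "val_ring2 V"
  proof -
    interpret val_ring2 V by (rule V)
    define w where "w = (r - 1) / 2"
    have "w * w + w + 1 = (r * r + 3) / 4" by (simp add: w_def field_simps)
    then have w: "w * w + w + 1 = 0" by (simp add: r)
    have "r = 1 + 2 * w" unfolding w_def by (simp add: field_simps)
    from adj_subset[OF F this] have u1: "uniformized F1 2"
      unfolding F12(1) by (intro uniformized_mono[OF uniformized_omega[OF w]]) simp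
    have "i ^ Suc 1 \<in> V" using minus[OF one] by (simp add: i)
    then have iV: "i \<in> V" by (rule V_powerD)
    have "(i - 1) ^ Suc 1 = 2 * (- i)" using i by (simp add: algebra_simps)
    then have i1: "i - 1 \<in> M" using M_powerD[of "i - 1" 1] M_mult[OF two_M minus[OF iV]] by simp
    have iU: "i \<in> U" by (rule one_mod_M_U[OF iV i1])
    \<comment> \<open>Hence 1 + i is a uniformizer of the second step, and i has residue 1.\<close>
    have "(1 + i) * (1 + i) = 2 * i" using i by (simp add: algebra_simps)
    from uniformized_ramified[OF u1 this iU] have "uniformized (adj F1 (1 + i)) (1 + i)" .
    moreover have "i = - 1 + 1 * (1 + i)" by simp
    from adj_subset[OF F1 this fs_minus[OF F1 fs_one[OF F1]] fs_one[OF F1]]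
    have "F2 \<subseteq> adj F1 (1 + i)" unfolding F12(2) .
    ultimately have u2: "uniformized F2 (1 + i)" using uniformized_mono by blast
    \<comment> \<open>A square root of i. The square of 1 - z is 1 + i times a unit, and q = (1 - i)
      z shows that z and q generate the same extension.\<close>
    define z where "z = (1 + i) * q / 2"
    have "4 * (z * z) = (1 + i) * (1 + i) * (q * q)" by (simp add: z_def)
    also have "\<dots> = 4 * i" unfolding q using i by (simp add: algebra_simps)
    finally have zz: "z * z = i" by simp
    then have "z ^ Suc 1 \<in> V" using iV by simp
    then have zV: "z \<in> V" by (rule V_powerD)
    have "1 - i \<in> M" using M_minus[OF i1] by simp
    then have "- ((1 - i) * z) \<in> M" using M_minus M_mult zV by blast
    from U_add_M[OF U_one this] have eU: "1 - (1 - i) * z \<in> U" by simp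
    have "(1 - z) * (1 - z) = (1 + i) * (1 - (1 - i) * z)"
    proof -
      have "i * (i * z) = - z" using i by (simp flip: mult.assoc)
      then show ?thesis using zz i by (simp add: algebra_simps)
    qed
    from uniformized_ramified[OF u2 this eU] have "uniformized (adj F2 (1 - z)) (1 - z)" .
    moreover have "q = (1 - i) + (i - 1) * (1 - z)"
    proof -
      have "i * (i * q) = - q" using i by (simp flip: mult.assoc)
      then have "(1 - i) * z = q" unfolding z_def by (simp add: algebra_simps)
      then show ?thesis by (simp add: algebra_simps)
    qed
    from adj_subset[OF F2 this fs_diff[OF F2 fs_one[OF F2] g(2)] fs_diff[OF F2 g(2) fs_one[OF F2]]]
    have "F0 \<subseteq> adj F2 (1 - z)" unfolding F0 .
    ultimately show ?thesis using uniformized_mono uniformized_small_residue by blast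
  qed
qed

text \<open>Integers congruent to 1 modulo 8 are 2-adic squares, so adjoining these roots does not
  enlarge the residue field.\<close>

definition unramified_gens :: "'a::field_char_0 set" where
  "unramified_gens = {s. \<exists>k. s * s = 1 + 8 * of_int k}"

lemma square_unramified_gens:
  assumes F: "is_field_set F" and "s \<in> unramified_gens" shows "s * s \<in> F"
proof -
  obtain k where k: "s * s = 1 + 8 * of_int k" using assms(2) by (auto simp: unramified_gens_def)
  show ?thesis unfolding k
    by (rule fs_add[OF F fs_one[OF F] fs_mult[OF F fs_numeral[OF F] fs_of_int[OF F]]])
qed

text \<open>Writing s^2 = a/b, the square class of a b is a unit class times 1 or 2 times some 1 +
  8k; the roots of the first two factors lie in the base field.\<close>

lemma sqrt_in_tower:
  fixes r i q :: "'a::field_char_0"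
  assumes r: "r * r = - 3" and i: "i * i = - 1" and q: "q * q = 2"
  defines "T \<equiv> tower (adj (adj (adj \<rat> r) i) q) unramified_gens"
  assumes s: "s * s \<in> \<rat>"
  shows "s \<in> T"
proof -
  define F0 where "F0 = adj (adj (adj \<rat> r) i) q"
  note F0 = base_tower_field[OF r i q, folded F0_def]
  note sq = square_unramified_gens[OF F0]
  note T = is_field_set_tower[where S = unramified_gens, OF F0 sq, folded T_def[folded F0_def]]
  have gens: "r \<in> T" "i \<in> T" "q \<in> T" using base_tower_gens[OF r i q, folded F0_def] T(2) by auto
  show ?thesis
  proof (cases "s = 0")
    case True
    then show ?thesis using fs_zero[OF T(1)] by simp
  next
    case False
    obtain a b where ab: "s * s = of_int a / of_int b" "b \<noteq> 0" using s by (auto elim!: Rats_cases')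
    then have "a * b \<noteq> 0" using False by auto
    then obtain c \<delta> e k where c: "c \<in> {1, -1, -3, 3}" "\<delta> \<in> {1, 2}" "a * b * c = 4 ^ e * \<delta> * (1 + 8 * k)"
      by (rule int_square_class)
    have "\<exists>x\<in>T. x * x = of_int c"
    proof -
      have "(r * i) * (r * i) = (r * r) * (i * i)" by (simp only: ac_simps)
      then have "(r * i) * (r * i) = 3" unfolding r i by simp
      then show ?thesis using c(1) r i gens(1,2) fs_one[OF T(1)] fs_mult[OF T(1) gens(1,2)] by force
    qed
    then obtain x where x: "x \<in> T" "x * x = of_int c" by blast
    have "\<exists>y\<in>T. y * y = of_int \<delta>" using c(2) q gens fs_one[OF T(1)] by (auto intro: bexI[of _ 1] bexI[of _ q])
    then obtain y where y: "y \<in> T" "y * y = of_int \<delta>" by blast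
    have nz: "x \<noteq> 0" "y \<noteq> 0" using x(2) y(2) c(1,2) by auto
    \<comment> \<open>Chosen so that z^2 = 1 + 8k: x and y are the roots of c and delta, and 2^e is
      the root of 4^e.\<close>
    define z where "z = s * of_int b * x / (2 ^ e * y)"
    have "(4 :: 'a) ^ e = 2 ^ e * 2 ^ e" by (simp flip: power_mult_distrib)
    then have "z * z = (s * s) * (of_int b * of_int b) * (x * x) / (4 ^ e * (y * y))"
      by (simp add: z_def ac_simps)
    also have "\<dots> = of_int (a * b * c) / (4 ^ e * of_int \<delta>)"
      unfolding ab(1) x(2) y(2) using ab(2) by simp
    also have "\<dots> = 1 + 8 * of_int k" unfolding c(3) using c(2) by auto
    finally have "z \<in> unramified_gens" by (auto simp: unramified_gens_def)
    then have zT: "z \<in> T" using T(3) by blast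
    have "s = z * (2 ^ e * y) / (of_int b * x)" using nz ab(2) by (simp add: z_def)
    then show ?thesis
      using fs_divide[OF T(1) fs_mult[OF T(1) zT fs_mult[OF T(1) fs_power[OF T(1) fs_numeral[OF T(1)]] y(1)]]
          fs_mult[OF T(1) fs_of_int[OF T(1)] x(1)]] by simp
  qed
qed

subsection \<open>Torsion over fields with small residue fields\<close>

lemma padd_defined_over:
  assumes F: "is_field_set F" and "defined_over F P" "defined_over F Q"
  shows "defined_over F (P \<oplus>\<^sub>E Q)"
proof (cases P; cases Q)
  fix x1 y1 x2 y2 assume PQ: "P = Affine x1 y1" "Q = Affine x2 y2"
  then have m: "x1 \<in> F" "y1 \<in> F" "x2 \<in> F" "y2 \<in> F" using assms by auto
  have line: "defined_over F (line_sum E l x1 y1 x2)" if l: "l \<in> F" for l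
  proof -
    have x3: "l ^ 2 - x1 - x2 \<in> F" by (intro fs_diff[OF F] fs_power[OF F] m l)
    have "y1 + l * (l ^ 2 - x1 - x2 - x1) \<in> F"
      by (intro fs_add[OF F] fs_mult[OF F] fs_diff[OF F x3] m l)
    then have "- (y1 + l * (l ^ 2 - x1 - x2 - x1)) - 1 \<in> F"
      by (intro fs_diff[OF F] fs_minus[OF F] fs_one[OF F])
    with x3 show ?thesis by (simp add: line_sum_def Let_def)
  qed
  have l1: "(y2 - y1) / (x2 - x1) \<in> F" by (intro fs_divide[OF F] fs_diff[OF F] m)
  have l2: "3 * x1 ^ 2 / (2 * y1 + 1) \<in> F"
    by (intro fs_divide[OF F] fs_add[OF F] fs_mult[OF F] fs_power[OF F] fs_numeral[OF F] fs_one[OF F] m)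
  show ?thesis using line[OF l1] line[OF l2] by (cases "x1 = x2") (auto simp: PQ)
qed (use assms in auto)

lemma pmul_defined_over:
  assumes "is_field_set F" "defined_over F P" shows "defined_over F (pmul n P)"
  by (induction n) (use assms padd_defined_over in auto)

lemma pmul_padd:
  assumes "on_curve E P" "on_curve E Q"
  shows "pmul n (P \<oplus>\<^sub>E Q) = pmul n P \<oplus>\<^sub>E pmul n Q"
proof (induction n)
  case (Suc n)
  let ?A = "pmul n P" and ?B = "pmul n Q"
  have on: "on_curve E ?A" "on_curve E ?B" using assms on_curve_pmul by auto
  have "?A \<oplus>\<^sub>E ?B \<oplus>\<^sub>E (P \<oplus>\<^sub>E Q) = ?A \<oplus>\<^sub>E (?B \<oplus>\<^sub>E (P \<oplus>\<^sub>E Q))"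
    by (rule padd_assoc[OF on on_curve_padd[OF assms]])
  also have "?B \<oplus>\<^sub>E (P \<oplus>\<^sub>E Q) = P \<oplus>\<^sub>E (?B \<oplus>\<^sub>E Q)"
    using padd_assoc[OF on(2) assms] padd_commute[OF on(2) assms(1)] padd_assoc[OF assms(1) on(2) assms(2)] by simp
  also have "?A \<oplus>\<^sub>E (P \<oplus>\<^sub>E (?B \<oplus>\<^sub>E Q)) = ?A \<oplus>\<^sub>E P \<oplus>\<^sub>E (?B \<oplus>\<^sub>E Q)"
    by (rule padd_assoc[OF on(1) assms(1) on_curve_padd[OF on(2) assms(2)], symmetric])
  finally show ?case using Suc by simp
qed simp

text \<open>Factors 2 are stripped from n: if n = 2k, then k P is killed by 2, and an affine such
  point would satisfy 4 x^3 = -1. Odd n is handled by reduction.\<close>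

lemma torsion_killed_by_3:
  fixes F :: "'a::field_char_0 set"
  assumes F: "is_field_set F" and V: "val_ring2 V" and res: "val_ring2.small_residue V F"
    and cube: "\<And>t. t \<in> F \<Longrightarrow> 4 * t ^ 3 \<noteq> - 1"
    and P: "on_curve E P" "defined_over F P" and n: "n > 0" "pmul n P = At_Infinity"
  shows "pmul 3 P = At_Infinity"
  using n
proof (induction n rule: less_induct)
  case (less n)
  interpret val_ring2 V by (rule V)
  show ?case
  proof (cases "odd n")
    case True
    show ?thesis
    proof (rule odd_torsion[OF P(1) _ True less(3)])
      fix x y assume "P = Affine x y" "x \<in> V" "x \<notin> M"
      then show "x ^ 3 - 1 \<in> M" using res P(2) by (simp add: small_residue_def)
    qed
  next
    case False
    then obtain k where k: "n = 2 * k" by (auto elim: evenE)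
    have R: "on_curve E (pmul k P)" "defined_over F (pmul k P)"
      using on_curve_pmul P pmul_defined_over F by blast+
    have d: "pmul k P \<oplus>\<^sub>E pmul k P = At_Infinity"
      using less(3) pmul_mult[OF P(1), of 2 k] by (simp add: k numeral_2_eq_2)
    have "pmul k P = At_Infinity"
    proof (cases "pmul k P")
      case (Affine x y)
      have on: "y ^ 2 + y = x ^ 3" using R Affine by simp
      have "y = - y - 1"
        using d unfolding Affine by (cases rule: padd_cases[OF on on]) auto
      then have "2 * y + 1 = 0" by Groebner_Basis.algebra
      then have "4 * x ^ 3 = - 1" using on by Groebner_Basis.algebra
      then show ?thesis using cube[of x] R(2) Affine by simp
    qed
    then show ?thesis using less(1)[of k] less(2) k by auto
  qed
qed

text \<open>The tower needs roots that exist only in the algebraic closure, while the points have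
  coordinates in the original type; this carries the valuation ring back along the
  embedding.\<close>

lemma val_ring2_vimage:
  fixes V :: "'a::field_char_0 alg_closure set"
  assumes V: "val_ring2 V"
  shows "val_ring2 (to_ac -` V)" "x \<in> val_ring2.M (to_ac -` V) \<longleftrightarrow> to_ac x \<in> val_ring2.M V"
proof -
  interpret V: val_ring2 V by (rule V)
  show W: "val_ring2 (to_ac -` V)"
  proof
    show "inverse 2 \<notin> to_ac -` V" using V.two by simp
  qed (use V.one V.diff V.mult V.total in auto)
  interpret W: val_ring2 "to_ac -` V" by (rule W)
  have V_iff: "z \<in> V.M \<longleftrightarrow> z \<in> V \<and> (z = 0 \<or> inverse z \<notin> V)" for z
    using V.unit[of z] V.unit_iff[of z] V.M_zero V.M_V by auto
  have W_iff: "z \<in> W.M \<longleftrightarrow> z \<in> to_ac -` V \<and> (z = 0 \<or> inverse z \<notin> to_ac -` V)" for z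
    using W.unit[of z] W.unit_iff[of z] W.M_zero W.M_V by auto
  show "x \<in> W.M \<longleftrightarrow> to_ac x \<in> V.M" unfolding V_iff W_iff by auto
qed

section \<open>Multi-quadratic fields inside the ambient field\<close>

lemma ambient_simps:
  fixes x y :: "'a::field_char_0"
  shows "\<one>\<^bsub>ambient\<^esub> = (1::'a)" "\<zero>\<^bsub>ambient\<^esub> = (0::'a)" "carrier ambient = (UNIV :: 'a set)"
    "x \<oplus>\<^bsub>ambient\<^esub> y = x + y" "x \<otimes>\<^bsub>ambient\<^esub> y = x * y" "\<ominus>\<^bsub>ambient\<^esub> x = - x"
    "x \<noteq> 0 \<Longrightarrow> inv\<^bsub>ambient\<^esub> x = inverse x"
proof -
  interpret A: field "ambient :: 'a ring" by (rule field_from_type_algebra)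
  show "\<one>\<^bsub>ambient\<^esub> = (1::'a)" "\<zero>\<^bsub>ambient\<^esub> = (0::'a)" "carrier ambient = (UNIV :: 'a set)"
    "x \<oplus>\<^bsub>ambient\<^esub> y = x + y" "x \<otimes>\<^bsub>ambient\<^esub> y = x * y"
    by (simp_all add: ring_of_type_algebra_def)
  show "\<ominus>\<^bsub>ambient\<^esub> x = - x"
    by (rule A.minus_equality) (simp_all add: ring_of_type_algebra_def)
  show "inv\<^bsub>ambient\<^esub> x = inverse x" if "x \<noteq> 0"
    using that by (intro A.comm_inv_char) (simp_all add: ring_of_type_algebra_def)
qed

lemma is_field_set_subfield:
  assumes "subfield K (ambient :: 'a::field_char_0 ring)" shows "is_field_set K"
proof -
  interpret A: field "ambient :: 'a ring" by (rule field_from_type_algebra)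
  note sr = subringE[OF subfieldE(1)[OF assms], unfolded ambient_simps]
  have "x - y \<in> K" if "x \<in> K" "y \<in> K" for x y
    using sr(7)[OF that(1) sr(5)[OF that(2)]] by simp
  moreover have "inverse x \<in> K" if "x \<in> K" for x
  proof (cases "x = 0")
    case False
    then show ?thesis
      using A.subfield_m_inv(1)[OF assms, of x] that by (simp add: ambient_simps)
  qed (use sr(2) in simp)
  ultimately show ?thesis using sr(3,6) by (auto simp: is_field_set_def)
qed

lemma generate_field_subset:
  assumes F: "is_field_set F" and "S \<subseteq> F"
  shows "generate_field (ambient :: 'a::field_char_0 ring) S \<subseteq> F"
proof
  fix x assume "x \<in> generate_field (ambient :: 'a ring) S"
  then show "x \<in> F"
  proof (induction rule: generate_field.induct)
    case (m_inv h)
    then show ?case using fs_inverse[OF F m_inv.IH] by (simp add: ambient_simps)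
  qed (use assms fs_one fs_add fs_mult fs_minus in \<open>auto simp: ambient_simps\<close>)
qed

text \<open>In dimension two 1, f and f^2 are linearly dependent; if f is not rational this is a
  quadratic equation, and a rational shift completes the square.\<close>

lemma quadratic_field_generators:
  assumes F: "quadratic_number_field (F :: 'a::field_char_0 set)" and f: "f \<in> F"
  shows "\<exists>p\<in>\<rat>. (f + p) * (f + p) \<in> \<rat>"
proof -
  interpret A: field "ambient :: 'a ring" by (rule field_from_type_algebra)
  have sf: "subfield F (ambient :: 'a ring)" and "A.dimension 2 \<rat> F"
    using F by (auto simp: quadratic_number_field_def)
  then have "A.dimension (Suc (Suc 0)) \<rat> F" by (simp add: numeral_2_eq_2)
  then obtain v F1 where "A.dimension (Suc 0) \<rat> F1" and F: "F = A.line_extension \<rat> v F1"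
    by cases
  from this(1) obtain v' F2 where "A.dimension 0 \<rat> F2" "F1 = A.line_extension \<rat> v' F2"
    by cases
  from this(1) have "F2 = {0}" by cases (simp_all add: ambient_simps)
  with \<open>F1 = A.line_extension \<rat> v' F2\<close> have F1: "F1 = A.line_extension \<rat> v' {0}" by simp
  have comb: "\<exists>a\<in>\<rat>. \<exists>b\<in>\<rat>. x = a * v + b * v'" if "x \<in> F" for x
    using that unfolding F F1 A.line_extension_def
    by (auto simp: set_add_def set_mult_def r_coset_def ring_of_type_algebra_def)
  have fs: "is_field_set F" by (rule is_field_set_subfield[OF sf])
  obtain a0 b0 where 0: "a0 \<in> \<rat>" "b0 \<in> \<rat>" "1 = a0 * v + b0 * v'" using comb fs_one[OF fs] by blast
  obtain a1 b1 where 1: "a1 \<in> \<rat>" "b1 \<in> \<rat>" "f = a1 * v + b1 * v'" using comb f by blast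
  obtain a2 b2 where 2: "a2 \<in> \<rat>" "b2 \<in> \<rat>" "f * f = a2 * v + b2 * v'" using comb fs_mult[OF fs f f] by blast
  \<comment> \<open>The cross product of the two coordinate rows, hence a linear relation between 1,
    f and f^2. If c2 = 0, then f is already rational.\<close>
  define c0 c1 c2 where c: "c0 = a1 * b2 - a2 * b1" "c1 = a2 * b0 - a0 * b2" "c2 = a0 * b1 - a1 * b0"
  have cQ: "c0 \<in> \<rat>" "c1 \<in> \<rat>" "c2 \<in> \<rat>" using 0 1 2 by (auto simp: c)
  show ?thesis
  proof (cases "c2 = 0")
    case True
    have "a0 * f - a1 * 1 = c2 * v'" "b0 * f - b1 * 1 = - c2 * v"
      unfolding c 1(3) 0(3) by (simp_all add: algebra_simps)
    then have "a0 * f = a1" "b0 * f = b1" using True by auto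
    moreover have "a0 \<noteq> 0 \<or> b0 \<noteq> 0" using 0(3) by auto
    ultimately have "f = a1 / a0 \<or> f = b1 / b0" by (auto simp: field_simps)
    then have "f \<in> \<rat>" using 0 1 by auto
    then show ?thesis by (intro bexI[of _ 0]) auto
  next
    case False
    have "c0 * 1 + c1 * f + c2 * (f * f) = 0" unfolding 0(3) 1(3)[symmetric] 2(3)
      unfolding c 1(3) by (simp add: algebra_simps)
    then have "c2 * (f * f) = - c0 - c1 * f" by (simp add: algebra_simps eq_neg_iff_add_eq_0)
    then have ff: "f * f = (- c0 - c1 * f) / c2" using False by (simp add: field_simps)
    define p where "p = c1 / (2 * c2)"
    have "(f + p) * (f + p) = f * f + 2 * p * f + p * p" by (simp add: algebra_simps)
    also have "\<dots> = - c0 / c2 + p * p" unfolding ff p_def using False by (simp add: field_simps)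
    finally show ?thesis using cQ by (intro bexI[of _ p]) (simp_all add: p_def)
  qed
qed

text \<open>Up to rational shifts K is generated by square roots of rationals, which the tower in
  the algebraic closure contains; residues and the missing cube root of -1/4 are inherited from
  it.\<close>

lemma multiquadratic_torsion:
  fixes K :: "'a::field_char_0 set"
  assumes K: "multiquadratic_number_field K" and P: "on_curve E P" "defined_over K P"
    and n: "n > 0" "pmul n P = At_Infinity"
  shows "pmul 3 P = At_Infinity"
proof -
  have "\<exists>y :: 'a alg_closure. y * y = z" for z
    using nth_root_exists[of 2 z] by (auto simp: power2_eq_square)
  then obtain r i q :: "'a alg_closure" where gens: "r * r = - 3" "i * i = - 1" "q * q = 2" by metis
  define F0 where "F0 = adj (adj (adj \<rat> r) i) q"
  define T where "T = tower F0 unramified_gens"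
  have F0: "is_field_set F0" unfolding F0_def by (rule base_tower_field[OF gens])
  note sq = square_unramified_gens[OF F0]
  have T: "is_field_set T" unfolding T_def by (rule is_field_set_tower[OF F0 sq])
  obtain \<F> where \<F>: "\<forall>F\<in>\<F>. quadratic_number_field F" "K = generate_field ambient (\<Union>\<F>)"
    and sfK: "subfield K ambient"
    using K by (auto simp: multiquadratic_number_field_def number_field_def)
  have ac_rat: "to_ac a \<in> \<rat>" if a: "a \<in> \<rat>" for a :: 'a
    using a by (auto elim!: Rats_cases')
  have pre: "is_field_set (to_ac -` T)"
    using T by (auto simp: is_field_set_def)
  have "f \<in> to_ac -` T" if f: "f \<in> \<Union>\<F>" for f
  proof -
    obtain p where p: "p \<in> \<rat>" "(f + p) * (f + p) \<in> \<rat>"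
      using f \<F>(1) quadratic_field_generators by blast
    have "to_ac (f + p) * to_ac (f + p) \<in> \<rat>" using ac_rat[OF p(2)] by simp
    then have "to_ac (f + p) \<in> T" unfolding T_def F0_def by (rule sqrt_in_tower[OF gens])
    moreover have "to_ac p \<in> T" using fs_Rats[OF T] ac_rat[OF p(1)] by blast
    ultimately have "to_ac (f + p) - to_ac p \<in> T" by (rule fs_diff[OF T])
    then show ?thesis by simp
  qed
  then have KT: "K \<subseteq> to_ac -` T" unfolding \<F>(2) by (intro generate_field_subset[OF pre]) blast
  obtain V :: "'a alg_closure set" where V: "val_ring2 V" using exists_val_ring2 by blast
  interpret V: val_ring2 V by (rule V)
  have resT: "V.small_residue T"
  proof -
    have "V.small_residue (adjs F0 l)" if l: "set l \<subseteq> unramified_gens" for l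
      using l by (intro V.small_residue_adjs[OF F0 base_tower_residue[OF gens V, folded F0_def]])
        (auto simp: unramified_gens_def)
    then show ?thesis by (auto simp: V.small_residue_def T_def tower_def)
  qed
  interpret W: val_ring2 "to_ac -` V" by (rule val_ring2_vimage(1)[OF V])
  have res: "W.small_residue K"
    using resT KT by (auto simp: W.small_residue_def V.small_residue_def val_ring2_vimage(2)[OF V])
  have cube: "4 * t ^ 3 \<noteq> - 1" if t: "t \<in> K" for t
  proof
    assume a: "4 * t ^ 3 = - 1"
    have "to_ac (4 * t ^ 3) = to_ac (- 1)" by (simp only: a)
    then have 4: "4 * to_ac t ^ 3 = - 1" by simp
    then have e: "to_ac t ^ 3 = - 1 / 4" by (simp add: field_simps)
    obtain l where l: "set l \<subseteq> unramified_gens" "to_ac t \<in> adjs F0 l" using t KT by (auto simp: T_def tower_def)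
    have "to_ac t ^ 3 \<in> F0" unfolding e
      by (intro fs_divide[OF F0] fs_minus[OF F0] fs_one[OF F0] fs_numeral[OF F0])
    then obtain t0 where "t0 \<in> F0" "t0 ^ 3 = to_ac t ^ 3"
      using cube_root_adjs[OF F0 _ l(2)] sq l(1) by blast
    then show False using base_tower_cube[OF gens, folded F0_def, of t0] 4 by simp
  qed
  show ?thesis
    by (rule torsion_killed_by_3[OF is_field_set_subfield[OF sfK] W.val_ring2_axioms res cube P n])
qed

subsection \<open>Eisenstein integers\<close>

text \<open>\<open>Eis a b\<close> stands for $a + b \omega$, where $\omega^2 + \omega + 1 = 0$.\<close>

datatype eis = Eis (ere: int) (eim: int)

instantiation eis :: comm_ring_1
begin

definition "0 = Eis 0 0"
definition "1 = Eis 1 0"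
definition "x + y = Eis (ere x + ere y) (eim x + eim y)"
definition "x - y = Eis (ere x - ere y) (eim x - eim y)"
definition "- x = Eis (- ere x) (- eim x)"
definition "x * y = Eis (ere x * ere y - eim x * eim y) (ere x * eim y + eim x * ere y - eim x * eim y)"

instance
  by standard
    (auto simp: zero_eis_def one_eis_def plus_eis_def minus_eis_def uminus_eis_def times_eis_def algebra_simps)

end

lemma eis_sel [simp]:
  "ere 0 = 0" "eim 0 = 0" "ere 1 = 1" "eim 1 = 0"
  "ere (x + y) = ere x + ere y" "eim (x + y) = eim x + eim y"
  "ere (x - y) = ere x - ere y" "eim (x - y) = eim x - eim y"
  "ere (- x) = - ere x" "eim (- x) = - eim x"
  "ere (x * y) = ere x * ere y - eim x * eim y"
  "eim (x * y) = ere x * eim y + eim x * ere y - eim x * eim y"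
  by (simp_all add: zero_eis_def one_eis_def plus_eis_def minus_eis_def uminus_eis_def times_eis_def)

lemma eis_eq_iff: "x = y \<longleftrightarrow> ere x = ere y \<and> eim x = eim y"
  by (cases x; cases y) auto

definition enorm :: "eis \<Rightarrow> int" where
  "enorm x = ere x ^ 2 - ere x * eim x + eim x ^ 2"

lemma enorm_mult: "enorm (x * y) = enorm x * enorm y"
  unfolding enorm_def eis_sel by (simp add: algebra_simps power2_eq_square)

lemma four_enorm: "4 * enorm x = (2 * ere x - eim x) ^ 2 + 3 * eim x ^ 2"
  "4 * enorm x = (2 * eim x - ere x) ^ 2 + 3 * ere x ^ 2"
  unfolding enorm_def by (simp_all add: algebra_simps power2_eq_square)

lemma enorm_nonneg: "enorm x \<ge> 0"
  using four_enorm(1)[of x] zero_le_power2[of "2 * ere x - eim x"] zero_le_power2[of "eim x"] by linarith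

lemma enorm_0 [simp]: "enorm 0 = 0" by (simp add: enorm_def)

lemma enorm_eq_0_iff [simp]: "enorm x = 0 \<longleftrightarrow> x = 0"
proof
  assume "enorm x = 0"
  then have "eim x ^ 2 = 0" "ere x ^ 2 = 0"
    using four_enorm[of x] zero_le_power2[of "2 * ere x - eim x"] zero_le_power2[of "eim x"]
      zero_le_power2[of "2 * eim x - ere x"] zero_le_power2[of "ere x"] by linarith+
  then show "x = 0" by (simp add: eis_eq_iff)
qed simp

instance eis :: idom
proof
  fix a b :: eis assume "a \<noteq> 0" "b \<noteq> 0"
  then have "enorm (a * b) \<noteq> 0" by (simp add: enorm_mult)
  then show "a * b \<noteq> 0" by auto
qed

lemma enorm_pos: "x \<noteq> 0 \<Longrightarrow> enorm x > 0"
  using enorm_nonneg[of x] enorm_eq_0_iff[of x] by linarith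

lemma enorm_power: "enorm (x ^ n) = enorm x ^ n"
  by (induction n) (simp_all add: enorm_mult, simp add: enorm_def)

definition om :: eis where "om = Eis 0 1"
text \<open>The prime 1 - omega above 3, of norm 3.\<close>

definition lam :: eis where "lam = Eis 1 (-1)"

lemma om_sel [simp]: "ere om = 0" "eim om = 1" "ere lam = 1" "eim lam = -1"
  by (simp_all add: om_def lam_def)

lemma om_rel: "om * om = - 1 - om" and lam_om: "lam = 1 - om"
  by (simp_all add: eis_eq_iff)

lemma of_int_eis_sel [simp]: "ere (of_int n) = n" "eim (of_int n) = 0"
proof -
  have "ere (of_nat k) = int k \<and> eim (of_nat k) = 0" for k by (induction k) auto
  then show "ere (of_int n) = n" "eim (of_int n) = 0" by (cases n; simp del: of_nat_Suc)+
qed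

lemma numeral_eis_sel [simp]: "ere (numeral n) = numeral n" "eim (numeral n) = 0"
  using of_int_eis_sel[of "numeral n"] by simp_all

text \<open>Rounding the coordinates of a/b leaves errors of at most 1/2, and the norm form is then
  at most 3/4.\<close>

lemma eis_euclid:
  assumes "b \<noteq> 0" shows "\<exists>q. enorm (a - q * b) < enorm b"
proof -
  define n where "n = enorm b"
  have n: "n > 0" using enorm_pos[OF assms] by (simp add: n_def)
  \<comment> \<open>The complex conjugate of b, so that a/b = a cb / n.\<close>
  define cb where "cb = Eis (ere b - eim b) (- eim b)"
  have cb: "b * cb = of_int n" by (simp add: eis_eq_iff cb_def n_def enorm_def algebra_simps power2_eq_square)
  have ncb: "enorm cb = n" by (simp add: enorm_def cb_def n_def algebra_simps power2_eq_square)
  \<comment> \<open>The integer nearest to p/n.\<close>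
  define r where "r = (\<lambda>p. (2 * p + n) div (2 * n))"
  have r: "\<bar>2 * (p - r p * n)\<bar> \<le> n" for p
  proof -
    have "(2 * p + n) = r p * (2 * n) + (2 * p + n) mod (2 * n)"
      unfolding r_def by (rule div_mult_mod_eq[symmetric])
    moreover have "0 \<le> (2 * p + n) mod (2 * n)" "(2 * p + n) mod (2 * n) < 2 * n" using n by auto
    ultimately show ?thesis by (simp add: algebra_simps abs_le_iff)
  qed
  define q where "q = Eis (r (ere (a * cb))) (r (eim (a * cb)))"
  define d where "d = (a - q * b) * cb"
  have "d = a * cb - q * of_int n" unfolding d_def cb[symmetric] by (simp add: algebra_simps)
  then have d: "\<bar>2 * ere d\<bar> \<le> n" "\<bar>2 * eim d\<bar> \<le> n"
    using r[of "ere (a * cb)"] r[of "eim (a * cb)"] by (simp_all add: q_def)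
  have "4 * enorm d = (2 * ere d) ^ 2 - (2 * ere d) * (2 * eim d) + (2 * eim d) ^ 2"
    by (simp add: enorm_def power2_eq_square)
  moreover have "(2 * ere d) ^ 2 \<le> n ^ 2" "(2 * eim d) ^ 2 \<le> n ^ 2"
    using d n by (metis abs_le_square_iff abs_of_pos)+
  moreover have "\<bar>(2 * ere d) * (2 * eim d)\<bar> \<le> n * n"
    unfolding abs_mult[of "2 * ere d"] using d n by (intro mult_mono) auto
  ultimately have "4 * enorm d \<le> 3 * n * n" by (simp add: power2_eq_square abs_le_iff)
  moreover have "n * n > 0" using n by simp
  ultimately have "enorm d < n * n" by linarith
  then have "enorm (a - q * b) * n < n * n" by (simp add: d_def enorm_mult ncb)
  then show ?thesis using n by (auto simp: n_def)
qed

lemma eis_bezout: "\<exists>d r s. d = r * a + s * b \<and> d dvd a \<and> d dvd (b :: eis)"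
proof (induction "nat (enorm b)" arbitrary: a b rule: less_induct)
  case less
  show ?case
  proof (cases "b = 0")
    case True
    then show ?thesis by (intro exI[of _ a] exI[of _ 1] exI[of _ 0]) simp
  next
    case False
    then obtain q where "enorm (a - q * b) < enorm b" using eis_euclid by blast
    then have "nat (enorm (a - q * b)) < nat (enorm b)" using enorm_nonneg[of "a - q * b"] by simp
    from less[OF this, of b] obtain d r s where
      d: "d = r * b + s * (a - q * b)" "d dvd b" "d dvd a - q * b" by blast
    have "d = s * a + (r - s * q) * b" using d(1) by (simp add: algebra_simps)
    moreover have "d dvd a" using dvd_add[OF d(3) dvd_mult[OF d(2), of q]] by simp
    ultimately show ?thesis using d(2) by blast
  qed
qed

section \<open>Coprimality and divisibility in the Eisenstein integers\<close>

definition comax :: "'r::comm_ring_1 \<Rightarrow> 'r \<Rightarrow> bool" where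
  "comax a b \<longleftrightarrow> (\<exists>r s. r * a + s * b = 1)"

lemma comaxI: "r * a + s * b = 1 \<Longrightarrow> comax a b" by (auto simp: comax_def)

lemma comax_sym: "comax a b \<Longrightarrow> comax b a"
  unfolding comax_def by (metis add.commute)

lemma comax_mult:
  assumes "comax a b" "comax a c" shows "comax a (b * c)"
proof -
  obtain r s r' s' where "r * a + s * b = 1" "r' * a + s' * c = 1" using assms by (auto simp: comax_def)
  then have "(r * a + s * b) * (r' * a + s' * c) = 1" by simp
  then have "(r * r' * a + r * s' * c + s * b * r') * a + s * s' * (b * c) = 1" by (simp add: algebra_simps)
  then show ?thesis by (rule comaxI)
qed

lemma comax_power: "comax a b \<Longrightarrow> comax a (b ^ n)"
  by (induction n) (auto simp: comax_mult intro: comaxI[of 0 _ 1])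

lemma comax_power2: "comax a b \<Longrightarrow> comax (a ^ m) (b ^ n)"
  using comax_power comax_sym by blast

lemma comax_dvd: "comax a b \<Longrightarrow> c dvd a \<Longrightarrow> comax c b"
  unfolding comax_def by (metis dvd_def mult.assoc mult.commute)

lemma comax_self_unit: "comax a b \<Longrightarrow> a dvd b \<Longrightarrow> a dvd 1"
  unfolding comax_def by (metis dvd_add dvd_triv_right dvd_mult)

lemma eis_coprime_part:
  fixes a b :: eis
  assumes "a \<noteq> 0 \<or> b \<noteq> 0"
  obtains d a' b' where "d \<noteq> 0" "a = d * a'" "b = d * b'" "comax a' b'"
proof -
  obtain d r s where d: "d = r * a + s * b" "d dvd a" "d dvd b" using eis_bezout by blast
  from d(2,3) obtain a' b' where ab: "a = d * a'" "b = d * b'" by (auto elim!: dvdE)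
  have "d \<noteq> 0" using assms ab by auto
  moreover have "d * (r * a' + s * b') = r * a + s * b" unfolding ab by (simp add: algebra_simps)
  then have "d * (r * a' + s * b') = d * 1" using d(1) by simp
  ultimately have "r * a' + s * b' = 1" by simp
  then show ?thesis using that ab \<open>d \<noteq> 0\<close> comaxI by blast
qed

text \<open>Unique factorization is avoided: for d = gcd(a, c) the elements a and d^3 divide each
  other. Coprimality writes a as a combination of a b = c^3 and a^3, and in the expansion of (r a +
  s c)^3 each term is a multiple of a.\<close>

lemma eis_coprime_cube:
  fixes a b c :: eis
  assumes "comax a b" "a * b = c ^ 3"
  obtains u d where "u dvd 1" "a = u * d ^ 3"
proof (cases "a = 0")
  case True
  then show ?thesis using that[of 1 0] by simp
next
  case False
  obtain d r s where d: "d = r * a + s * c" "d dvd a" "d dvd c" using eis_bezout by blast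
  have "comax b (a ^ 2)" using assms(1) comax_sym comax_power by blast
  then obtain v w where "w * b + v * a ^ 2 = 1" by (auto simp: comax_def)
  then have "a = a * (w * b + v * a ^ 2)" by simp
  also have "\<dots> = w * c ^ 3 + v * a ^ 3"
    unfolding assms(2)[symmetric] by (simp add: algebra_simps power2_eq_square power3_eq_cube)
  also have "d ^ 3 dvd \<dots>" using d(2,3) by (simp add: dvd_power_same)
  finally obtain k where k: "a = d ^ 3 * k" by (auto elim: dvdE)
  have "d ^ 3 = a * (r ^ 3 * a ^ 2 + 3 * r ^ 2 * a * s * c + 3 * r * s ^ 2 * c ^ 2) + s ^ 3 * c ^ 3"
    unfolding d(1) by (simp add: algebra_simps power2_eq_square power3_eq_cube)
  also have "\<dots> = a * (r ^ 3 * a ^ 2 + 3 * r ^ 2 * a * s * c + 3 * r * s ^ 2 * c ^ 2 + s ^ 3 * b)"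
    unfolding assms(2)[symmetric] by (simp add: algebra_simps)
  finally obtain m where m: "d ^ 3 = a * m" by blast
  have "a * 1 = a * (m * k)" using k m by (simp add: mult.assoc)
  then have "m * k = 1" using False by simp
  then have "k dvd 1" by (metis dvd_triv_right)
  then show ?thesis using that[of k d] k by (simp add: mult.commute)
qed

lemma unit_mult: "a dvd 1 \<Longrightarrow> b dvd 1 \<Longrightarrow> a * b dvd (1 :: 'r::comm_semiring_1)"
  using mult_dvd_mono[of a 1 b 1] by simp

lemma eis_cube_dvd:
  fixes c d :: eis
  assumes "d ^ 3 dvd c ^ 3" shows "d dvd c"
proof (cases "d = 0 \<and> c = 0")
  case False
  then obtain g d' c' where g: "g \<noteq> 0" "d = g * d'" "c = g * c'" "comax d' c'"
    using eis_coprime_part by metis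
  have "d' ^ 3 dvd c' ^ 3" using assms g(1) by (simp add: g(2,3) power_mult_distrib)
  then have "d' ^ 3 dvd 1" using comax_power2[OF g(4)] comax_self_unit by blast
  then have "d' dvd 1" by (metis dvd_trans dvd_triv_left power3_eq_cube mult.assoc)
  then have "d' dvd c'" using dvd_trans one_dvd by blast
  then show ?thesis using g by simp
qed simp

lemma eis_unit_cases:
  assumes "u dvd 1"
  shows "u = 1 \<or> u = - 1 \<or> u = om \<or> u = - om \<or> u = om * om \<or> u = - (om * om)"
proof -
  obtain v where "1 = u * v" using assms by (auto elim: dvdE)
  then have "enorm u * enorm v = 1" by (simp flip: enorm_mult) (simp add: enorm_def)
  then have "enorm u = 1" using enorm_nonneg[of u] pos_zmult_eq_1_iff_lemma[of "enorm u" "enorm v"] by auto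
  then have "3 * eim u ^ 2 \<le> 4" "3 * ere u ^ 2 \<le> 4"
    using four_enorm[of u] zero_le_power2[of "2 * ere u - eim u"] zero_le_power2[of "2 * eim u - ere u"]
    by linarith+
  then have "eim u ^ 2 \<le> 1 ^ 2" "ere u ^ 2 \<le> 1 ^ 2" by simp_all
  then have "\<bar>eim u\<bar> \<le> 1" "\<bar>ere u\<bar> \<le> 1" by (simp_all only: abs_le_square_iff[symmetric] abs_1)
  then have "eim u \<in> {-1, 0, 1}" "ere u \<in> {-1, 0, 1}" by auto
  with \<open>enorm u = 1\<close> show ?thesis by (auto simp: eis_eq_iff enorm_def)
qed

lemma om_cube: "om ^ 3 = 1"
  by (simp add: eis_eq_iff power3_eq_cube)

lemma om_unit: "om dvd 1" "om \<noteq> 0"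
  by (rule dvdI[of 1 _ "om * om"]) (simp_all add: eis_eq_iff)

text \<open>The residue field is F_3 and omega = 1 - lam reduces to 1.\<close>

lemma lam_dvd_iff: "lam dvd x \<longleftrightarrow> 3 dvd ere x + eim x"
proof
  assume "lam dvd x"
  then obtain y where "x = lam * y" by (auto elim: dvdE)
  then have "ere x + eim x = 3 * eim y" by simp
  then show "3 dvd ere x + eim x" by simp
next
  assume "3 dvd ere x + eim x"
  then obtain k where "ere x + eim x = 3 * k" by (auto elim: dvdE)
  then have "x = lam * Eis (ere x - k) k" by (simp add: eis_eq_iff)
  then show "lam dvd x" by (metis dvd_triv_left)
qed

lemma lam_prime: "lam dvd x * y \<Longrightarrow> lam dvd x \<or> lam dvd y"
proof -
  assume "lam dvd x * y"
  then have "3 dvd ere (x * y) + eim (x * y)" by (simp only: lam_dvd_iff)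
  also have "ere (x * y) + eim (x * y) = (ere x + eim x) * (ere y + eim y) - 3 * (eim x * eim y)"
    by (simp add: algebra_simps)
  finally have "3 dvd (ere x + eim x) * (ere y + eim y)" by (simp add: dvd_diff_left_iff)
  then show ?thesis using prime_dvd_mult_iff[of "3 :: int"] by (simp add: lam_dvd_iff)
qed

lemma lam_dvd_power: "lam dvd x ^ n \<Longrightarrow> lam dvd x"
proof (induction n)
  case (Suc n)
  then show ?case using lam_prime[of x "x ^ n"] by auto
qed (simp add: lam_dvd_iff)

lemma lam_nonzero: "lam \<noteq> 0" by (simp add: eis_eq_iff)

lemma lam_not_unit: "\<not> lam dvd 1" by (simp add: lam_dvd_iff)

lemma lam_not_dvd_unit: "u dvd 1 \<Longrightarrow> \<not> lam dvd u"
  using lam_not_unit dvd_trans by blast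

text \<open>With x = 1 + lam t, x^3 - 1 = lam^3 t (t + 1)(t + 1 + om), and the last three factors
  run through all residues modulo lam, because om reduces to 1.\<close>

lemma cube_mod_lam4_aux:
  assumes "lam dvd x - 1" shows "lam ^ 4 dvd x ^ 3 - 1"
proof -
  obtain t where t: "x - 1 = lam * t" using assms by (auto elim: dvdE)
  then have x: "x = 1 + lam * t" by (simp add: algebra_simps)
  have "lam dvd t * (t + 1) * (t + 1 + om)"
  proof -
    have "3 dvd ere t + eim t \<or> 3 dvd ere t + eim t + 1 \<or> 3 dvd ere t + eim t + 2" by presburger
    then have "lam dvd t \<or> lam dvd t + 1 \<or> lam dvd t + 1 + om" by (simp add: lam_dvd_iff algebra_simps)
    then show ?thesis by auto
  qed
  moreover have "x ^ 3 - 1 = lam ^ 3 * (t * (t + 1) * (t + 1 + om))"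
    unfolding x lam_om using om_rel by Groebner_Basis.algebra
  moreover have "lam ^ 4 = lam ^ 3 * lam" by (simp add: eval_nat_numeral)
  ultimately show ?thesis by simp
qed

lemma cube_mod_lam4:
  assumes "\<not> lam dvd x" shows "\<exists>s\<in>{1, -1}. lam ^ 4 dvd x ^ 3 - s"
proof -
  have "3 dvd ere x + eim x - 1 \<or> 3 dvd - (ere x + eim x) - 1"
    using assms unfolding lam_dvd_iff by presburger
  then have "lam dvd x - 1 \<or> lam dvd (- x) - 1" by (simp add: lam_dvd_iff algebra_simps)
  then show ?thesis
  proof
    assume "lam dvd - x - 1"
    from cube_mod_lam4_aux[OF this] have "lam ^ 4 dvd - (x ^ 3 - (-1))" by simp
    then have "lam ^ 4 dvd x ^ 3 - (-1)" by (simp only: dvd_minus_iff)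
    then show ?thesis by blast
  qed (use cube_mod_lam4_aux in blast)
qed

lemma lam_pow_dvd_imp: "lam ^ 4 dvd x \<Longrightarrow> lam dvd x" "lam ^ 4 dvd x \<Longrightarrow> 9 dvd x"
proof -
  show "lam ^ 4 dvd x \<Longrightarrow> lam dvd x" by (meson dvd_power dvd_trans zero_less_numeral)
  have "lam ^ 4 = 9 * (om * om)" by (simp add: eis_eq_iff eval_nat_numeral)
  then show "lam ^ 4 dvd x \<Longrightarrow> 9 dvd x" by (metis dvd_mult_left)
qed

lemma numeral_dvd_eisD: "numeral n dvd x \<Longrightarrow> numeral n dvd ere x \<and> numeral n dvd eim x"
  by (auto elim!: dvdE)

subsection \<open>Fermat's equation of exponent 3 over the Eisenstein integers\<close>

lemma comax_lam_not_dvd: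
  assumes "comax a b" "u dvd 1" "lam dvd c" "a ^ 3 + b ^ 3 = u * c ^ 3"
  shows "\<not> lam dvd a" "\<not> lam dvd b"
proof -
  have *: "\<not> lam dvd a" if "comax a b" "a ^ 3 + b ^ 3 = u * c ^ 3" for a b
  proof
    assume a: "lam dvd a"
    have "b ^ 3 = u * c ^ 3 - a ^ 3" using that(2) by (simp add: algebra_simps)
    moreover have "lam dvd u * c ^ 3" "lam dvd a ^ 3" using a assms(3)
      by (simp_all add: dvd_power_same power3_eq_cube)
    ultimately have "lam dvd b" using lam_dvd_power[of b 3] by simp
    then show False using comax_dvd[OF that(1) a] comax_self_unit lam_not_unit by blast
  qed
  show "\<not> lam dvd a" "\<not> lam dvd b" using *[of a b] *[of b a] assms comax_sym by (auto simp: add.commute)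
qed

text \<open>Modulo lam^4 both cubes are 1 or -1, and lam does not divide 2, so they cancel. Then
  lam^4 divides c^3, which a single factor lam in c cannot provide.\<close>

lemma lam_square_dvd:
  assumes "comax a b" "u dvd 1" "lam dvd c" "a ^ 3 + b ^ 3 = u * c ^ 3"
  shows "lam * lam dvd c"
proof -
  obtain s t where st: "s \<in> {1, -1}" "t \<in> {1, -1}" "lam ^ 4 dvd a ^ 3 - s" "lam ^ 4 dvd b ^ 3 - t"
    using comax_lam_not_dvd[OF assms] cube_mod_lam4 by metis
  have sum: "lam ^ 4 dvd u * c ^ 3 - (s + t)"
    using dvd_add[OF st(3,4)] by (simp add: algebra_simps flip: assms(4))
  have "lam dvd u * c ^ 3" using assms(3) by (simp add: power3_eq_cube)
  then have "lam dvd u * c ^ 3 - (u * c ^ 3 - (s + t))" using lam_pow_dvd_imp(1)[OF sum] dvd_diff by blast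
  then have "lam dvd s + t" by simp
  then have "s + t = 0" using st(1,2) by (auto simp: lam_dvd_iff)
  then have "lam ^ 4 dvd u * c ^ 3" using sum by simp
  moreover obtain v where "v * u = 1" using assms(2) by (auto elim!: dvdE simp: mult.commute)
  then have "c ^ 3 = v * (u * c ^ 3)" by (simp flip: mult.assoc)
  ultimately have 4: "lam ^ 4 dvd c ^ 3" by (metis dvd_mult)
  obtain c1 where c1: "c = lam * c1" using assms(3) by (auto elim: dvdE)
  have "lam ^ 3 * lam dvd lam ^ 3 * c1 ^ 3" using 4 by (simp add: c1 power_mult_distrib eval_nat_numeral mult.assoc)
  then have "lam dvd c1 ^ 3" using lam_nonzero by (simp only: dvd_mult_cancel_left) simp
  then show ?thesis using lam_dvd_power c1 by auto
qed

text \<open>The three linear factors of a^3 + b^3 are congruent modulo lam, so lam divides each of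
  them. As lam^2 divides c, one factor contains lam twice; multiplying b by a power of om makes it a
  + b.\<close>

lemma om_shift:
  assumes "comax a b" "u dvd 1" "lam dvd c" "a ^ 3 + b ^ 3 = u * c ^ 3"
  shows "\<exists>b'. b' ^ 3 = b ^ 3 \<and> comax a b' \<and> lam * lam dvd a + b'"
proof -
  obtain c2 where c2: "c = lam * lam * c2" using lam_square_dvd[OF assms] by (auto elim: dvdE)
  have prod: "(a + b) * (a + om * b) * (a + om * om * b) = u * c ^ 3"
    unfolding assms(4)[symmetric] using om_rel by Groebner_Basis.algebra
  have "lam dvd u * c ^ 3" using assms(3) by (simp add: power3_eq_cube)
  then have d: "lam dvd a + b \<or> lam dvd a + om * b \<or> lam dvd a + om * om * b"
    unfolding prod[symmetric] using lam_prime by blast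
  have e: "a + om * b = (a + b) - lam * b" "a + om * om * b = (a + b) - lam * ((1 + om) * b)"
    by (simp_all add: lam_om algebra_simps)
  have "lam dvd a + b"
    using d unfolding e by (auto simp: dvd_diff_left_iff)
  then have "lam dvd a + om * b" "lam dvd a + om * om * b" unfolding e by (auto simp: dvd_diff_left_iff)
  with \<open>lam dvd a + b\<close> obtain y1 y2 y3 where
    y: "a + b = lam * y1" "a + om * b = lam * y2" "a + om * om * b = lam * y3" by (auto elim!: dvdE)
  have "lam ^ 3 * (y1 * y2 * y3) = lam ^ 3 * (u * (lam ^ 3 * c2 ^ 3))"
    using prod unfolding y c2 by (simp add: power3_eq_cube algebra_simps)
  then have "y1 * y2 * y3 = u * (lam ^ 3 * c2 ^ 3)" using lam_nonzero by (simp only: mult_cancel_left) simp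
  then have "lam dvd y1 * y2 * y3" by (simp add: power3_eq_cube)
  then have "lam dvd y1 \<or> lam dvd y2 \<or> lam dvd y3" using lam_prime by blast
  then have "lam * lam dvd a + b \<or> lam * lam dvd a + om * b \<or> lam * lam dvd a + om * om * b"
    unfolding y by auto
  moreover have "comax a (om * b)" "comax a (om * om * b)"
  proof -
    obtain r s where rs: "r * a + s * b = 1" using assms(1) by (auto simp: comax_def)
    have o3: "om * om * om = 1" using om_cube by (simp add: power3_eq_cube)
    have "r * a + s * (om * om) * (om * b) = r * a + s * ((om * om * om) * b)" by (simp add: algebra_simps)
    then show "comax a (om * b)" using rs o3 by (intro comaxI[of r _ "s * (om * om)"]) simp
    have "r * a + s * om * (om * om * b) = r * a + s * ((om * om * om) * b)" by (simp add: algebra_simps)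
    then show "comax a (om * om * b)" using rs o3 by (intro comaxI[of r _ "s * om"]) simp
  qed
  moreover have "(om * b) ^ 3 = b ^ 3" "(om * om * b) ^ 3 = b ^ 3"
    by (simp_all add: power_mult_distrib om_cube)
  ultimately show ?thesis using assms(1) by blast
qed

text \<open>Divided by lam, the linear factors become pairwise coprime with product a unit times a
  cube, hence each is a unit times a cube. Their linear relation is an equation of the same shape
  with a smaller right-hand side.\<close>

lemma descent_step:
  assumes ab: "comax a b" and u: "u dvd 1" and c: "lam dvd c" "c \<noteq> 0" and eq: "a ^ 3 + b ^ 3 = u * c ^ 3"
    and lam2: "lam * lam dvd a + b"
  shows "\<exists>a' b' u' c'. comax a' b' \<and> u' dvd 1 \<and> lam dvd c' \<and> c' \<noteq> 0 \<and>
     a' ^ 3 + b' ^ 3 = u' * c' ^ 3 \<and> enorm c' < enorm c"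
proof -
  obtain z where "a + b = lam * lam * z" using lam2 by (auto elim: dvdE)
  then have z: "a + b = lam * (lam * z)" by (simp only: mult.assoc)
  define y1 y2 y3 where y_def: "y1 = lam * z" "y2 = y1 - b" "y3 = y2 - om * b"
  have y: "a + b = lam * y1" "a + om * b = lam * y2" "a + om * om * b = lam * y3"
    using z om_rel unfolding y_def lam_om by Groebner_Basis.algebra+
  have prod: "(a + b) * (a + om * b) * (a + om * om * b) = u * c ^ 3"
    unfolding eq[symmetric] using om_rel by Groebner_Basis.algebra
  obtain c1 where c1: "c = lam * c1" using c(1) by (auto elim: dvdE)
  have "lam ^ 3 * (y1 * y2 * y3) = lam ^ 3 * (u * c1 ^ 3)"
    using prod unfolding y c1 by (simp add: power3_eq_cube algebra_simps)
  then have yyy: "y1 * y2 * y3 = u * c1 ^ 3" using lam_nonzero by (simp only: mult_cancel_left) simp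
  obtain r s where rs: "r * a + s * b = 1" using ab by (auto simp: comax_def)
  \<comment> \<open>Both a and b are combinations of y1 and y2, so the Bezout relation for a, b
    transfers to every pair among y1, y2, y3.\<close>
  have a: "a = y2 - om * y1"
    using z om_rel unfolding y_def lam_om by Groebner_Basis.algebra
  have b: "b = y1 - y2" by (simp add: y_def)
  have y12: "comax y1 y2" by (rule comaxI[of "s - r * om" _ "r - s"]) (use rs a b in \<open>Groebner_Basis.algebra\<close>)
  have y3: "y3 = - om * y1 - (om * om) * y2" unfolding y_def(3) b using om_rel by Groebner_Basis.algebra
  have y23: "comax y2 y3"
    by (rule comaxI[of "- om * (s - r * om) + (r - s)" _ "- (om * om) * (s - r * om)"])
      (use rs a b y3 om_rel in \<open>Groebner_Basis.algebra\<close>)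
  have y13: "comax y1 y3"
    by (rule comaxI[of "(s - r * om) - om * om * (r - s)" _ "- om * (r - s)"])
      (use rs a b y3 om_rel in \<open>Groebner_Basis.algebra\<close>)
  obtain u' where u': "u' * u = 1" using u by (auto elim!: dvdE simp: mult.commute)
  have cub: "\<exists>v d. v dvd 1 \<and> p = v * d ^ 3" if "comax p q" "comax p q'" "p * q * q' = u * c1 ^ 3" for p q q'
  proof -
    have "comax p u'" using u' by (intro comaxI[of 0 _ u]) (simp add: mult.commute)
    then have "comax p (q * q' * u')" using that comax_mult by blast
    moreover have "p * (q * q' * u') = u' * (u * c1 ^ 3)" using that(3) by (simp add: algebra_simps)
    then have "p * (q * q' * u') = c1 ^ 3" using u' by (simp flip: mult.assoc)
    ultimately show ?thesis using eis_coprime_cube by metis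
  qed
  obtain u1 d1 where 1: "u1 dvd 1" "y1 = u1 * d1 ^ 3" using cub[OF y12 y13 yyy] by blast
  obtain u2 d2 where 2: "u2 dvd 1" "y2 = u2 * d2 ^ 3"
    using cub[OF comax_sym[OF y12] y23] yyy by (auto simp: ac_simps)
  obtain u3 d3 where 3: "u3 dvd 1" "y3 = u3 * d3 ^ 3"
    using cub[OF comax_sym[OF y13] comax_sym[OF y23]] yyy by (auto simp: ac_simps)
  have nz: "c1 \<noteq> 0" "d1 \<noteq> 0" "d2 \<noteq> 0" "d3 \<noteq> 0"
  proof -
    show "c1 \<noteq> 0" using c c1 by auto
    then have "y1 * y2 * y3 \<noteq> 0" using u' unfolding yyy by auto
    then show "d1 \<noteq> 0" "d2 \<noteq> 0" "d3 \<noteq> 0" using 1 2 3 by auto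
  qed
  have d1: "lam dvd d1"
  proof -
    have "lam dvd u1 * d1 ^ 3" using 1(2) y_def(1) by (metis dvd_triv_left)
    then have "lam dvd d1 ^ 3" using lam_prime lam_not_dvd_unit 1(1) by blast
    then show ?thesis by (rule lam_dvd_power)
  qed
  have d23: "comax d2 d3"
  proof -
    have "d2 dvd y2" "d3 dvd y3" using 2 3 by (simp_all add: power3_eq_cube)
    then show ?thesis using y23 comax_dvd comax_sym by blast
  qed
  have "lam dvd y1" using y_def(1) by simp
  then have "\<not> lam dvd y2" "\<not> lam dvd y3"
    using y12 y13 comax_dvd comax_self_unit lam_not_unit by blast+
  then have nd: "\<not> lam dvd d2" "\<not> lam dvd d3" using 2 3 by (auto simp: power3_eq_cube)
  obtain v2 where v2: "v2 * u2 = 1" using 2(1) by (auto elim!: dvdE simp: mult.commute)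
  define v where "v = om * u3 * v2"
  define w where "w = - (om * om * u1 * v2)"
  have om3: "om * om * om = 1" using om_cube by (simp add: power3_eq_cube)
  have vu: "v dvd 1" "w dvd 1"
  proof -
    have "v2 dvd 1" using v2 by (metis dvd_triv_left)
    then show "v dvd 1" "w dvd 1" unfolding v_def w_def minus_dvd_iff
      using 1(1) 3(1) om_unit(1) unit_mult by blast+
  qed
  \<comment> \<open>The three linear factors weighted by 1, om, om^2 add up to 0.\<close>
  have "y1 + om * y2 + om * om * y3 = 0" unfolding y3 using om_rel by Groebner_Basis.algebra
  then have eq': "d2 ^ 3 + v * d3 ^ 3 = w * d1 ^ 3"
    unfolding v_def w_def 1 2 3 using v2 om3 by Groebner_Basis.algebra
  \<comment> \<open>Modulo 3 the right-hand side vanishes and the cubes on the left are 1 or -1;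
    among the six units only v = 1 and v = -1 allow this. Such a v is its own cube and can be
    absorbed into d3.\<close>
  have v1: "v = 1 \<or> v = -1"
  proof -
    obtain s t where st: "s \<in> {1, -1}" "t \<in> {1, -1}" "lam ^ 4 dvd d2 ^ 3 - s" "lam ^ 4 dvd d3 ^ 3 - t"
      using nd cube_mod_lam4 by metis
    have "9 dvd (d2 ^ 3 - s) + v * (d3 ^ 3 - t)" using st lam_pow_dvd_imp(2) by simp
    moreover have "(d2 ^ 3 - s) + v * (d3 ^ 3 - t) = w * d1 ^ 3 - (s + v * t)"
      unfolding eq'[symmetric] by (simp add: algebra_simps)
    moreover have "(3::eis) dvd 9" by (rule dvdI[of _ _ 3]) simp
    ultimately have "3 dvd w * d1 ^ 3 - (s + v * t)" by (metis dvd_trans)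
    moreover have "3 dvd w * d1 ^ 3"
    proof -
      obtain k where "d1 = lam * k" using d1 by (auto elim: dvdE)
      then have "w * d1 ^ 3 = lam * lam * (w * lam * k ^ 3)" by (simp add: power3_eq_cube ac_simps)
      also have "lam * lam = 3 * (- om)" by (simp add: eis_eq_iff)
      finally show ?thesis by (simp only: mult.assoc dvd_triv_left)
    qed
    ultimately have "3 dvd s + v * t" by (metis dvd_diff_right_iff)
    then have "3 dvd ere (s + v * t) \<and> 3 dvd eim (s + v * t)" by (rule numeral_dvd_eisD)
    then show ?thesis using eis_unit_cases[OF vu(1)] st(1,2) by auto
  qed
  have "v * v = 1" using v1 by auto
  have "comax d2 v" using \<open>v * v = 1\<close> by (intro comaxI[of 0 _ v]) simp
  then have "comax d2 (v * d3)" using d23 comax_mult by blast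
  moreover have "d2 ^ 3 + (v * d3) ^ 3 = w * d1 ^ 3"
    using eq' \<open>v * v = 1\<close> by Groebner_Basis.algebra
  \<comment> \<open>The descent gains the factor 3 = enorm lam removed from c.\<close>
  moreover have "enorm d1 < enorm c"
  proof -
    have u1: "enorm x = 1" if "x dvd 1" for x
      using eis_unit_cases[OF that] by (auto simp: enorm_def)
    have "enorm (y1 * y2 * y3) = (enorm d1 * enorm d2 * enorm d3) ^ 3"
      unfolding 1 2 3 using u1 1 2 3 by (simp add: enorm_mult enorm_power power_mult_distrib)
    then have "enorm c1 ^ 3 = (enorm d1 * enorm d2 * enorm d3) ^ 3"
      unfolding yyy using u1[OF u] by (simp add: enorm_mult enorm_power)
    then have "enorm c1 = enorm d1 * (enorm d2 * enorm d3)"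
      using enorm_nonneg power_eq_imp_eq_base[of "enorm c1" 3] by (simp add: mult.assoc)
    moreover have "1 \<le> enorm d2 * enorm d3" using enorm_pos nz by (simp add: int_one_le_iff_zero_less)
    ultimately have "enorm d1 \<le> enorm c1" using mult_left_mono[of 1 _ "enorm d1"] enorm_nonneg by force
    moreover have "enorm c = 3 * enorm c1" by (simp add: c1 enorm_mult) (simp add: enorm_def)
    ultimately show ?thesis using enorm_pos[OF nz(1)] by linarith
  qed
  ultimately show ?thesis using vu(2) d1 nz(2) by blast
qed

lemma lam_descent:
  assumes "comax a b" "u dvd 1" "lam dvd c" "a ^ 3 + b ^ 3 = u * c ^ 3"
  shows "c = 0"
  using assms
proof (induction "nat (enorm c)" arbitrary: a b u c rule: less_induct)
  case less
  show ?case
  proof (rule ccontr)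
    assume "c \<noteq> 0"
    obtain b' where "b' ^ 3 = b ^ 3" "comax a b'" "lam * lam dvd a + b'" using om_shift[OF less(2-5)] by blast
    then obtain a' b'' u' c' where *: "comax a' b''" "u' dvd 1" "lam dvd c'" "c' \<noteq> 0"
      "a' ^ 3 + b'' ^ 3 = u' * c' ^ 3" "enorm c' < enorm c"
      using descent_step[of a b' u c] less(3-5) \<open>c \<noteq> 0\<close> by auto
    then have "nat (enorm c') < nat (enorm c)" using enorm_nonneg[of c'] by simp
    from less(1)[OF this *(1,2,3,5)] show False using *(4) by simp
  qed
qed

text \<open>If lam divides none of the three, the cubes are 1 or -1 modulo 9 and cannot balance.
  Otherwise the term divisible by lam is moved to the right-hand side and the descent
  applies.\<close>

lemma eis_fermat3:
  fixes a b c :: eis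
  assumes "a ^ 3 + b ^ 3 = c ^ 3"
  shows "a = 0 \<or> b = 0 \<or> c = 0"
proof (rule ccontr)
  assume "\<not> ?thesis"
  then have nz: "a \<noteq> 0" "b \<noteq> 0" "c \<noteq> 0" by auto
  obtain d a' b' where d: "d \<noteq> 0" "a = d * a'" "b = d * b'" "comax a' b'"
    using eis_coprime_part nz by metis
  have "d ^ 3 dvd c ^ 3" unfolding assms[symmetric] by (simp add: d power_mult_distrib)
  then have "d dvd c" by (rule eis_cube_dvd)
  then obtain c' where c': "c = d * c'" by (auto elim: dvdE)
  have "d ^ 3 * (a' ^ 3 + b' ^ 3) = d ^ 3 * c' ^ 3" using assms by (simp add: d c' power_mult_distrib algebra_simps)
  then have eq: "a' ^ 3 + b' ^ 3 = c' ^ 3" using d(1) by simp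
  have nz': "a' \<noteq> 0" "b' \<noteq> 0" "c' \<noteq> 0" using nz d c' by auto
  have ac: "comax c' p" if pq: "comax p q" "c' ^ 3 = p ^ 3 + q ^ 3" for p q
  proof -
    obtain r s where "r * p ^ 3 + s * q ^ 3 = 1" using comax_power2[OF pq(1), of 3 3] by (auto simp: comax_def)
    then have "s * c' ^ 3 + (r - s) * p ^ 3 = 1" unfolding pq(2) by (simp add: algebra_simps)
    then have "comax (c' ^ 3) (p ^ 3)" by (rule comaxI)
    moreover have "c' dvd c' ^ 3" "p dvd p ^ 3" by (simp_all add: power3_eq_cube)
    ultimately show ?thesis using comax_dvd comax_sym by blast
  qed
  have ca: "comax c' a'" and cb: "comax c' b'" using ac[of a' b'] ac[of b' a'] d(4) comax_sym eq
    by (auto simp: add.commute)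
  have neg: "comax x (- y)" if "comax x y" for x y :: eis
    using that comaxI[of _ x "- _" "- y"] unfolding comax_def by (metis minus_mult_minus)
  consider "lam dvd a'" | "lam dvd b'" | "lam dvd c'" | "\<not> lam dvd a'" "\<not> lam dvd b'" "\<not> lam dvd c'" by blast
  then show False
  proof cases
    case 1
    have "c' ^ 3 + (- b') ^ 3 = 1 * a' ^ 3" using eq by (simp add: algebra_simps)
    from lam_descent[OF neg[OF cb] _ 1 this] show False using nz' by simp
  next
    case 2
    have "c' ^ 3 + (- a') ^ 3 = 1 * b' ^ 3" using eq by (simp add: algebra_simps)
    from lam_descent[OF neg[OF ca] _ 2 this] show False using nz' by simp
  next
    case 3
    have "a' ^ 3 + b' ^ 3 = 1 * c' ^ 3" using eq by simp
    from lam_descent[OF d(4) _ 3 this] show False using nz' by simp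
  next
    case 4
    obtain r s t where st: "r \<in> {1, -1}" "s \<in> {1, -1}" "t \<in> {1, -1}"
      "lam ^ 4 dvd a' ^ 3 - r" "lam ^ 4 dvd b' ^ 3 - s" "lam ^ 4 dvd c' ^ 3 - t"
      using 4 cube_mod_lam4 by metis
    have "lam ^ 4 dvd (a' ^ 3 - r) + (b' ^ 3 - s) - (c' ^ 3 - t)" by (rule dvd_diff[OF dvd_add[OF st(4,5)] st(6)])
    also have "\<dots> = t - r - s" unfolding eq[symmetric] by simp
    finally have "9 dvd ere (t - r - s)" using lam_pow_dvd_imp(2) numeral_dvd_eisD by blast
    then show False using st(1-3) by auto
  qed
qed

subsection \<open>The 3-torsion\<close>

text \<open>The polynomial is the 3-division polynomial 3 (x^4 + x) up to the factor 3. It arises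
  from comparing the abscissae of 2P and P.\<close>

lemma pmul_3_iff:
  fixes x y :: "'a::field_char_0"
  assumes on: "y ^ 2 + y = x ^ 3"
  shows "pmul 3 (Affine x y) = At_Infinity \<longleftrightarrow> x * (x ^ 3 + 1) = 0"
proof -
  have p3: "pmul 3 (Affine x y) = Affine x y \<oplus>\<^sub>E Affine x y \<oplus>\<^sub>E Affine x y"
    by (simp add: eval_nat_numeral del: point_add.simps(3))
  have sq: "(2 * y + 1) ^ 2 = 4 * x ^ 3 + 1" using on by Groebner_Basis.algebra
  show ?thesis
  proof (cases rule: padd_cases[OF on on])
    case 1
    have "2 * y + 1 = 0" using 1(2) by Groebner_Basis.algebra
    then have x: "4 * x ^ 3 + 1 = 0" using sq by simp
    have "x * (x ^ 3 + 1) \<noteq> 0"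
    proof
      assume "x * (x ^ 3 + 1) = 0"
      then have "(3 :: 'a) = 0 \<or> (1 :: 'a) = 0" using x by Groebner_Basis.algebra
      then show False by simp
    qed
    then show ?thesis using 1(3) p3 by simp
  next
    case (2 l x3 y3)
    have n: "2 * y + 1 \<noteq> 0" using 2(2) by auto
    have l: "l * (2 * y + 1) = 3 * x ^ 2" using 2(1) n by (simp add: slope_def)
    have e: "(x3 - x) * (2 * y + 1) ^ 2 = - 3 * (x * (x ^ 3 + 1))"
      using l sq 2(3) by Groebner_Basis.algebra
    have on3: "(- y3 - 1) ^ 2 + (- y3 - 1) = x3 ^ 3"
      using on_curve_padd[of "Affine x y" "Affine x y"] on by (simp add: 2(5) del: point_add.simps)
    have "pmul 3 (Affine x y) = At_Infinity \<longleftrightarrow> x3 = x"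
    proof
      assume "pmul 3 (Affine x y) = At_Infinity"
      then have "Affine x3 (- y3 - 1) \<oplus>\<^sub>E Affine x y = At_Infinity" unfolding p3 2(5) .
      then show "x3 = x" by (cases rule: padd_cases[OF on3 on]) auto
    next
      \<comment> \<open>Then y3 = y, so 2P is the negative of P.\<close>
      assume "x3 = x"
      then show "pmul 3 (Affine x y) = At_Infinity" unfolding p3 2(5) using 2(4) by simp
    qed
    also have "\<dots> \<longleftrightarrow> (x3 - x) * (2 * y + 1) ^ 2 = 0" using n by simp
    also have "\<dots> \<longleftrightarrow> x * (x ^ 3 + 1) = 0" unfolding e by simp
    finally show ?thesis .
  qed
qed

subsection \<open>Points over the third cyclotomic field\<close>

definition eis_eval :: "'a::field_char_0 \<Rightarrow> eis \<Rightarrow> 'a" where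
  "eis_eval w x = of_int (ere x) + of_int (eim x) * w"

text \<open>Q(omega) as fractions of Eisenstein integers, which gives access to numerators and
  denominators in lowest terms.\<close>

definition cyclotomic3 :: "'a::field_char_0 \<Rightarrow> 'a set" where
  "cyclotomic3 w = {eis_eval w p / eis_eval w q |p q. q \<noteq> 0}"

locale omega =
  fixes w :: "'a::field_char_0"
  assumes w: "w * w + w + 1 = 0"
begin

abbreviation ev :: "eis \<Rightarrow> 'a" where "ev \<equiv> eis_eval w"

lemma ww: "w * w = - 1 - w"
  using w by Groebner_Basis.algebra

lemma w3: "w ^ 3 = 1" using w by Groebner_Basis.algebra

lemma ev_simps [simp]: "ev 0 = 0" "ev 1 = 1" "ev (x + y) = ev x + ev y" "ev (x - y) = ev x - ev y"
  "ev (- x) = - ev x"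
  by (simp_all add: eis_eval_def algebra_simps)

lemma ev_mult [simp]: "ev (x * y) = ev x * ev y"
proof -
  have "ev x * ev y = of_int (ere x * ere y) + of_int (ere x * eim y + eim x * ere y) * w
      + of_int (eim x * eim y) * (w * w)"
    by (simp add: eis_eval_def algebra_simps)
  then show ?thesis unfolding ww by (simp add: eis_eval_def algebra_simps)
qed

lemma ev_power [simp]: "ev (x ^ n) = ev x ^ n" by (induction n) auto

lemma ev_eq_0_iff [simp]: "ev x = 0 \<longleftrightarrow> x = 0"
proof
  assume "ev x = 0"
  moreover have "x * Eis (ere x - eim x) (- eim x) = of_int (enorm x)"
    by (simp add: eis_eq_iff enorm_def algebra_simps power2_eq_square)
  ultimately have "ev (of_int (enorm x)) = 0" by (metis ev_mult mult_zero_left)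
  then show "x = 0" by (simp add: eis_eval_def)
qed simp

lemma ev_eq_iff [simp]: "ev x = ev y \<longleftrightarrow> x = y"
  using ev_eq_0_iff[of "x - y"] by simp

lemma cyclotomic3I: "q \<noteq> 0 \<Longrightarrow> ev p / ev q \<in> cyclotomic3 w"
  by (auto simp: cyclotomic3_def)

lemma ev_in: "ev p \<in> cyclotomic3 w"
  using cyclotomic3I[of 1 p] by simp

lemma w_in: "w \<in> cyclotomic3 w"
  using ev_in[of om] by (simp add: eis_eval_def)

lemma is_field_set_cyclotomic3: "is_field_set (cyclotomic3 w)"
  unfolding is_field_set_def
proof (intro conjI ballI)
  show "1 \<in> cyclotomic3 w" using ev_in[of 1] by simp
next
  fix x y assume "x \<in> cyclotomic3 w" "y \<in> cyclotomic3 w"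
  then obtain p q p' q' where xy: "x = ev p / ev q" "y = ev p' / ev q'" and nz: "q \<noteq> 0" "q' \<noteq> 0"
    by (auto simp: cyclotomic3_def)
  have e: "x - y = ev (p * q' - p' * q) / ev (q * q')" "x * y = ev (p * p') / ev (q * q')"
    using nz by (simp_all add: xy diff_frac_eq)
  have "q * q' \<noteq> 0" using nz by simp
  then show "x - y \<in> cyclotomic3 w" "x * y \<in> cyclotomic3 w" unfolding e by (rule cyclotomic3I)+
next
  fix x assume "x \<in> cyclotomic3 w"
  then obtain p q where x: "x = ev p / ev q" "q \<noteq> 0" by (auto simp: cyclotomic3_def)
  then have "inverse x = ev q / ev p" by simp
  then show "inverse x \<in> cyclotomic3 w"
    using cyclotomic3I[of p q] ev_in[of 0] by (cases "p = 0") auto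
qed

text \<open>Clearing denominators turns this into Fermat's equation of exponent 3.\<close>

lemma cube_successor:
  assumes "g \<in> cyclotomic3 w" "h \<in> cyclotomic3 w" "h ^ 3 = g ^ 3 + 1"
  shows "g = 0 \<or> h = 0"
proof -
  obtain a c where g: "g = ev a / ev c" "c \<noteq> 0" using assms(1) by (auto simp: cyclotomic3_def)
  obtain b d where h: "h = ev b / ev d" "d \<noteq> 0" using assms(2) by (auto simp: cyclotomic3_def)
  have nz: "ev c ^ 3 \<noteq> 0" "ev d ^ 3 \<noteq> 0" using g h by simp_all
  have "ev b ^ 3 / ev d ^ 3 = ev a ^ 3 / ev c ^ 3 + 1" using assms(3) by (simp add: g h power_divide)
  then have "ev b ^ 3 * ev c ^ 3 = ev a ^ 3 * ev d ^ 3 + ev c ^ 3 * ev d ^ 3"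
    using nz by (simp add: field_simps)
  then have "ev ((a * d) ^ 3 + (c * d) ^ 3) = ev ((b * c) ^ 3)"
    by (simp add: power_mult_distrib)
  then have "(a * d) ^ 3 + (c * d) ^ 3 = (b * c) ^ 3" by (simp only: ev_eq_iff)
  from eis_fermat3[OF this] show ?thesis using g h by auto
qed

text \<open>For y = p/q in lowest terms, y^2 + y = x^3 makes p (p + q) q a cube with pairwise
  coprime factors, so p and q are units times cubes. As -1 is a cube, the unit can be taken among 1,
  w, w^2.\<close>

lemma cyclotomic_cube_class:
  assumes xy: "x \<in> cyclotomic3 w" "y \<in> cyclotomic3 w" and on: "y ^ 2 + y = x ^ 3"
  obtains u g where "u \<in> {1, w, w * w}" "g \<in> cyclotomic3 w" "y = u * g ^ 3"
proof (cases "y = 0")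
  case True
  then show ?thesis using that[of 1 0] fs_zero[OF is_field_set_cyclotomic3] by simp
next
  case False
  obtain p0 q0 where y0: "y = ev p0 / ev q0" "q0 \<noteq> 0" using xy(2) by (auto simp: cyclotomic3_def)
  then obtain d p q where pq: "d \<noteq> 0" "p0 = d * p" "q0 = d * q" "comax p q" using eis_coprime_part[of p0 q0] by metis
  have y: "y = ev p / ev q" "q \<noteq> 0" using y0 pq by auto
  obtain m n where x: "x = ev m / ev n" "n \<noteq> 0" using xy(1) by (auto simp: cyclotomic3_def)
  have nz: "ev q \<noteq> 0" "ev n ^ 3 \<noteq> 0" using x y by auto
  have "(ev p * ev p + ev p * ev q) / (ev q * ev q) = ev m ^ 3 / ev n ^ 3"
    using on nz by (simp add: x y power2_eq_square power_divide add_divide_distrib)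
  then have "(ev p * ev p + ev p * ev q) * ev n ^ 3 = ev m ^ 3 * (ev q * ev q)"
    using nz by (simp add: frac_eq_eq)
  then have "ev (p * (p + q) * n ^ 3) = ev (m ^ 3 * (q * q))" by (simp add: algebra_simps)
  then have "p * (p + q) * n ^ 3 = m ^ 3 * (q * q)" by (simp only: ev_eq_iff)
  then have e: "p * (p + q) * q * n ^ 3 = (m * q) ^ 3" by Groebner_Basis.algebra
  then have "n ^ 3 dvd (m * q) ^ 3" by (metis dvd_triv_right)
  then have "n dvd m * q" by (rule eis_cube_dvd)
  then obtain k where k: "m * q = n * k" by (auto elim: dvdE)
  have "n ^ 3 * (p * (p + q) * q) = n ^ 3 * k ^ 3" using e unfolding k by (simp add: power_mult_distrib ac_simps)
  then have ppq: "p * (p + q) * q = k ^ 3" using x(2) by simp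
  obtain r s where rs: "r * p + s * q = 1" using pq(4) by (auto simp: comax_def)
  have "comax p (p + q)" by (rule comaxI[of "r - s" _ s]) (use rs in \<open>simp add: algebra_simps\<close>)
  moreover have "comax q (p + q)" by (rule comaxI[of "s - r" _ r]) (use rs in \<open>simp add: algebra_simps\<close>)
  ultimately have "comax p ((p + q) * q)" "comax q (p * (p + q))" using pq(4) comax_sym comax_mult by blast+
  moreover have "p * ((p + q) * q) = k ^ 3" "q * (p * (p + q)) = k ^ 3" using ppq by (simp_all add: ac_simps)
  ultimately obtain u1 u2 a c where u: "u1 dvd 1" "p = u1 * a ^ 3" "u2 dvd 1" "q = u2 * c ^ 3"
    using eis_coprime_cube by metis
  obtain v where v: "v * u2 = 1" using u(3) by (auto elim!: dvdE simp: mult.commute)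
  then have "v dvd 1" by (metis dvd_triv_left)
  have "ev v * ev u2 = 1" using arg_cong[OF v, of ev] by simp
  have c0: "c \<noteq> 0" using u(4) y(2) by auto
  have "y = ev u1 * ev a ^ 3 / (ev u2 * ev c ^ 3)" using y u by simp
  also have "\<dots> = ev (u1 * v) * (ev a / ev c) ^ 3"
  proof -
    have "ev u2 \<noteq> 0" using \<open>ev v * ev u2 = 1\<close> by auto
    then have "ev v = 1 / ev u2" using \<open>ev v * ev u2 = 1\<close> by (simp only: eq_divide_eq simp_thms if_True if_False)
    then show ?thesis by (simp add: power_divide)
  qed
  finally have y': "y = ev (u1 * v) * (ev a / ev c) ^ 3" .
  have g: "ev a / ev c \<in> cyclotomic3 w" "- (ev a / ev c) \<in> cyclotomic3 w"
    using cyclotomic3I[OF c0] fs_minus[OF is_field_set_cyclotomic3] by auto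
  have om: "ev om = w" by (simp add: eis_eval_def)
  have pos: thesis if "ev (u1 * v) = t" "t \<in> {1, w, w * w}" for t
    using that(1) \<open>\<And>u g. u \<in> {1, w, w * w} \<Longrightarrow> g \<in> cyclotomic3 w \<Longrightarrow> y = u * g ^ 3 \<Longrightarrow> thesis\<close>[OF that(2) g(1)] y'
    by metis
  have neg: thesis if "ev (u1 * v) = - t" "t \<in> {1, w, w * w}" for t
  proof -
    have "y = t * (- (ev a / ev c)) ^ 3" unfolding y' that(1) by simp
    then show thesis using \<open>\<And>u g. u \<in> {1, w, w * w} \<Longrightarrow> g \<in> cyclotomic3 w \<Longrightarrow> y = u * g ^ 3 \<Longrightarrow> thesis\<close>[OF that(2) g(2)]
      by blast
  qed
  have "ev (u1 * v) \<in> {1, - 1, w, - w, w * w, - (w * w)}"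
    using eis_unit_cases[OF unit_mult[OF u(1) \<open>v dvd 1\<close>]] by (elim disjE) (simp_all only: ev_simps ev_mult om insert_iff simp_thms)
  then show ?thesis using pos[of 1] pos[of w] pos[of "w * w"] neg[of 1] neg[of w] neg[of "w * w"] by auto
qed

text \<open>For nonzero g, division by g^3 gives (x/g)^3 = g^3 + 1.\<close>

lemma cyclotomic_cube_ordinate:
  assumes "x \<in> cyclotomic3 w" "g \<in> cyclotomic3 w" "(g ^ 3) ^ 2 + g ^ 3 = x ^ 3"
  shows "x = 0"
proof (cases "g = 0")
  case False
  have "x / g \<in> cyclotomic3 w" using fs_divide[OF is_field_set_cyclotomic3 assms(1,2)] .
  moreover have "(x / g) ^ 3 = g ^ 3 + 1"
    unfolding power_divide assms(3)[symmetric] using False by (simp add: field_simps power2_eq_square)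
  ultimately have "x / g = 0" using cube_successor[OF assms(2)] False by blast
  then show ?thesis using False by simp
qed (use assms in auto)

text \<open>Adding a 3-torsion point whose ordinate is the inverse of u changes the cube class of y
  to the trivial one, where Fermat applies; tripling does not see the translation.\<close>

lemma cyclotomic_points:
  assumes on: "on_curve E P" and F: "defined_over (cyclotomic3 w) P"
  shows "pmul 3 P = At_Infinity"
proof (cases P)
  case (Affine x y)
  note C = is_field_set_cyclotomic3
  have xy: "x \<in> cyclotomic3 w" "y \<in> cyclotomic3 w" "y ^ 2 + y = x ^ 3" using on F Affine by auto
  obtain u g where ug: "u \<in> {1, w, w * w}" "g \<in> cyclotomic3 w" "y = u * g ^ 3"
    using cyclotomic_cube_class[OF xy] by blast
  show ?thesis
  proof (cases "u = 1")
    case True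
    then have "x = 0" using cyclotomic_cube_ordinate[OF xy(1) ug(2)] xy(3) ug(3) by simp
    then show ?thesis using pmul_3_iff[OF xy(3)] Affine by simp
  next
    case False
    \<comment> \<open>The inverse of the primitive cube root of unity u, which is also u^2; (-1, t)
      is on the curve since t^2 + t = -1.\<close>
    define t where "t = - 1 - u"
    have t: "u * t = 1" "t ^ 2 + t = (- 1) ^ 3" "t \<in> cyclotomic3 w"
    proof -
      have "(w * w) * (w * w) + w * w + 1 = 0" using w by Groebner_Basis.algebra
      then have "u * u + u + 1 = 0" using ug(1) False w by auto
      then show "u * t = 1" "t ^ 2 + t = (- 1) ^ 3" unfolding t_def by Groebner_Basis.algebra+
      have "u \<in> cyclotomic3 w" using ug(1) fs_one[OF C] fs_mult[OF C] w_in by auto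
      then show "t \<in> cyclotomic3 w" unfolding t_def by (intro fs_diff[OF C] fs_minus[OF C] fs_one[OF C])
    qed
    let ?T = "Affine (- 1) t"
    have T3: "pmul 3 ?T = At_Infinity" using pmul_3_iff[OF t(2)] by simp
    show ?thesis
    proof (cases rule: padd_cases[OF xy(3) t(2)])
      case 1
      then show ?thesis using pmul_3_iff[OF xy(3)] Affine by auto
    next
      case (2 l x3 y3)
      define b where "b = y - l * x"
      note v = line_vieta[OF xy(3) t(2) 2(1,2,3) b_def]
      have y: "y = l * x + b" and y3: "y3 = l * x3 + b" using b_def 2(4) by Groebner_Basis.algebra+
      \<comment> \<open>The ordinates on a line multiply to b^3. As t cancels u, the ordinate y3 is
        the cube of b/g.\<close>
      have "y * t * y3 = b ^ 3" unfolding v(1) y3 using v(2,3) 2(3) y by Groebner_Basis.algebra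
      then have "g ^ 3 * y3 = b ^ 3" using ug(3) t(1) by Groebner_Basis.algebra
      have "defined_over (cyclotomic3 w) (Affine x y \<oplus>\<^sub>E ?T)"
        by (rule padd_defined_over[OF C]) (use xy t fs_minus[OF C fs_one[OF C]] in auto)
      then have m3: "x3 \<in> cyclotomic3 w" unfolding 2(5) by simp
      have onT: "on_curve E (Affine x y)" "on_curve E ?T" using xy t by simp_all
      have "on_curve E (Affine x y \<oplus>\<^sub>E ?T)" by (rule on_curve_padd[OF onT])
      then have on3: "(- y3 - 1) ^ 2 + (- y3 - 1) = x3 ^ 3" unfolding 2(5) by simp
      then have on3': "y3 ^ 2 + y3 = x3 ^ 3" by Groebner_Basis.algebra
      have sum3: "pmul 3 (Affine x y \<oplus>\<^sub>E ?T) = pmul 3 P"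
        unfolding pmul_padd[OF onT] T3 Affine by simp
      show ?thesis
      proof (cases "g = 0")
        case True
        then have "x = 0" using ug(3) xy(3) by simp
        then show ?thesis using pmul_3_iff[OF xy(3)] Affine by simp
      next
        case g: False
        have "b \<in> cyclotomic3 w"
        proof -
          have "l \<in> cyclotomic3 w"
          proof (cases "x = - 1")
            case True
            then have "y = t" using 2(2) by auto
            then show ?thesis unfolding 2(1) slope_def True
              by (simp, intro fs_divide[OF C] fs_numeral[OF C] fs_add[OF C] fs_mult[OF C] fs_one[OF C] t)
          next
            case x: False
            then show ?thesis unfolding 2(1) slope_def
              by (simp, intro fs_divide[OF C] fs_diff[OF C] fs_minus[OF C] fs_one[OF C] t xy)
          qed
          then show ?thesis unfolding b_def using fs_diff[OF C xy(2) fs_mult[OF C _ xy(1)]] by blast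
        qed
        then have "b / g \<in> cyclotomic3 w" using fs_divide[OF C _ ug(2)] by blast
        moreover have "y3 = (b / g) ^ 3" using \<open>g ^ 3 * y3 = b ^ 3\<close> g by (simp add: power_divide field_simps)
        ultimately have "x3 = 0" using cyclotomic_cube_ordinate[OF m3] on3' by simp
        then have "pmul 3 (Affine x y \<oplus>\<^sub>E ?T) = At_Infinity" unfolding 2(5) using pmul_3_iff[OF on3] by simp
        then show ?thesis unfolding sum3 .
      qed
    qed
  qed
qed simp

section \<open>The nine 3-torsion points and their group\<close>

lemma three_torsion_points:
  assumes on: "on_curve E P" and 3: "pmul 3 P = At_Infinity"
  shows "P \<in> {At_Infinity, Affine 0 0, Affine 0 (- 1)} \<union>
    {Affine x y |x y. x \<in> {- 1, - w, - (w * w)} \<and> y \<in> {w, w * w}}"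
proof (cases P)
  case (Affine x y)
  have xy: "y ^ 2 + y = x ^ 3" using on Affine by simp
  have "x * (x ^ 3 + 1) = 0" using pmul_3_iff[OF xy] 3 Affine by simp
  then consider "x = 0" | "x ^ 3 + 1 = 0" by auto
  then show ?thesis
  proof cases
    case 1
    then have "y * (y + 1) = 0" using xy by (simp add: algebra_simps power2_eq_square)
    then have "y = 0 \<or> y = - 1" by (simp add: eq_neg_iff_add_eq_0)
    then show ?thesis using Affine 1 by auto
  next
    case 2
    have "(x - (- 1)) * ((x - (- w)) * (x - (- (w * w)))) = 0" using 2 w by Groebner_Basis.algebra
    then have "x \<in> {- 1, - w, - (w * w)}" unfolding mult_eq_0_iff right_minus_eq by blast
    moreover have "(y - w) * (y - w * w) = 0" using 2 xy w by Groebner_Basis.algebra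
    then have "y \<in> {w, w * w}" unfolding mult_eq_0_iff right_minus_eq by blast
    ultimately show ?thesis using Affine by blast
  qed
qed simp

lemma three_torsion_defined_over:
  assumes "on_curve E P" "pmul 3 P = At_Infinity"
  shows "defined_over (cyclotomic3 w) P"
proof -
  note C = is_field_set_cyclotomic3
  note m = w_in fs_mult[OF C w_in w_in] fs_zero[OF C] fs_one[OF C]
  note m' = m fs_minus[OF C m(1)] fs_minus[OF C m(2)] fs_minus[OF C m(4)]
  from three_torsion_points[OF assms] show ?thesis
  proof (elim UnE CollectE exE conjE)
    fix x y assume "P = Affine x y" "x \<in> {- 1, - w, - (w * w)}" "y \<in> {w, w * w}"
    moreover from this have "x \<in> cyclotomic3 w" "y \<in> cyclotomic3 w"
      using m' by (elim insertE emptyE; simp only:)+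
    ultimately show ?thesis by simp
  qed (use m' in auto)
qed

text \<open>The points A = (0, 0) and B = (-1, w) generate: the map has trivial kernel, and its nine
  values exhaust the at most nine 3-torsion points.\<close>

lemma three_torsion_group_iso:
  fixes G :: "'a point monoid"
  assumes C: "carrier G = {P. on_curve E P \<and> pmul 3 P = At_Infinity}" "monoid.mult G = point_add curve_27a3"
  shows "G \<cong> integer_mod_group 3 \<times>\<times> integer_mod_group 3"
proof -
  define A :: "'a point" where "A = Affine 0 0"
  define B where "B = Affine (- 1) w"
  have w2: "w ^ 2 + w = - 1" using w by Groebner_Basis.algebra
  have AB: "on_curve E A" "on_curve E B" "pmul 3 A = At_Infinity" "pmul 3 B = At_Infinity"
    using pmul_3_iff[of 0 0] pmul_3_iff[of w "- 1"] w2 by (simp_all add: A_def B_def)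
  define f where "f = (\<lambda>(i :: int, j :: int). pmul (nat i) A \<oplus>\<^sub>E pmul (nat j) B)"
  let ?H = "integer_mod_group 3 \<times>\<times> integer_mod_group 3"
  have cH: "carrier ?H = {0..<3} \<times> {0..<3}" by (simp add: DirProd_def carrier_integer_mod_group)
  have red: "pmul (nat ((i + j) mod 3)) P = pmul (nat i) P \<oplus>\<^sub>E pmul (nat j) P"
    if P: "on_curve E P" "pmul 3 P = At_Infinity" and ij: "0 \<le> i" "0 \<le> j" for i j P
  proof -
    have "pmul (nat (i + j)) P = pmul (nat i) P \<oplus>\<^sub>E pmul (nat j) P"
      using pmul_add[OF P(1)] ij by (simp add: nat_add_distrib)
    moreover have "nat (i + j) = nat ((i + j) div 3) * 3 + nat ((i + j) mod 3)"
      using ij by (simp add: nat_div_distrib nat_mod_distrib)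
    moreover have "pmul (nat ((i + j) div 3) * 3) P = At_Infinity" using pmul_mult[OF P(1)] P(2) by simp
    ultimately show ?thesis using pmul_add[OF P(1)] by simp
  qed
  have on: "on_curve E (pmul m A)" "on_curve E (pmul n B)" for m n using AB on_curve_pmul by auto
  have exch: "(S \<oplus>\<^sub>E S') \<oplus>\<^sub>E (R \<oplus>\<^sub>E R') = (S \<oplus>\<^sub>E R) \<oplus>\<^sub>E (S' \<oplus>\<^sub>E R')"
    if c: "on_curve E S" "on_curve E S'" "on_curve E R" "on_curve E R'" for S S' R R'
  proof -
    have "S \<oplus>\<^sub>E S' \<oplus>\<^sub>E (R \<oplus>\<^sub>E R') = S \<oplus>\<^sub>E (S' \<oplus>\<^sub>E (R \<oplus>\<^sub>E R'))"
      by (rule padd_assoc[OF c(1,2) on_curve_padd[OF c(3,4)]])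
    also have "S' \<oplus>\<^sub>E (R \<oplus>\<^sub>E R') = S' \<oplus>\<^sub>E R \<oplus>\<^sub>E R'" by (rule padd_assoc[OF c(2,3,4), symmetric])
    also have "S' \<oplus>\<^sub>E R = R \<oplus>\<^sub>E S'" by (rule padd_commute[OF c(2,3)])
    also have "R \<oplus>\<^sub>E S' \<oplus>\<^sub>E R' = R \<oplus>\<^sub>E (S' \<oplus>\<^sub>E R')" by (rule padd_assoc[OF c(3,2,4)])
    also have "S \<oplus>\<^sub>E (R \<oplus>\<^sub>E (S' \<oplus>\<^sub>E R')) = S \<oplus>\<^sub>E R \<oplus>\<^sub>E (S' \<oplus>\<^sub>E R')"
      by (rule padd_assoc[OF c(1,3) on_curve_padd[OF c(2,4)], symmetric])
    finally show ?thesis .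
  qed
  have fin: "f x \<in> carrier G" for x
  proof -
    obtain i j where x: "x = (i, j)" by (cases x)
    have kill: "pmul 3 (pmul m P) = At_Infinity" if "on_curve E P" "pmul 3 P = At_Infinity" for m P
      using pmul_mult[OF that(1), of 3 m] pmul_mult[OF that(1), of m 3] that(2) by (simp add: mult.commute)
    show ?thesis unfolding C(1) mem_Collect_eq x f_def prod.case pmul_padd[OF on] kill[OF AB(1,3)] kill[OF AB(2,4)]
      using on_curve_padd[OF on] by simp
  qed
  have "f \<in> hom ?H G"
  proof (rule homI)
    fix x y assume xy: "x \<in> carrier ?H" "y \<in> carrier ?H"
    obtain i j i' j' where e: "x = (i, j)" "y = (i', j')" by (cases x; cases y)
    have r: "0 \<le> i" "0 \<le> j" "0 \<le> i'" "0 \<le> j'" using xy unfolding cH e by auto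
    have "x \<otimes>\<^bsub>?H\<^esub> y = ((i + i') mod 3, (j + j') mod 3)"
      by (simp add: e DirProd_def integer_mod_group_def)
    then show "f (x \<otimes>\<^bsub>?H\<^esub> y) = f x \<otimes>\<^bsub>G\<^esub> f y"
      by (simp only: f_def e prod.case C(2) red[OF AB(1,3) r(1,3)] red[OF AB(2,4) r(2,4)] exch[OF on(1) on(1) on(2) on(2)])
  qed (use fin in blast)
  moreover have "bij_betw f (carrier ?H) (carrier G)"
  proof -
    have w0: "w \<noteq> 0" using w by auto
    have w1: "w \<noteq> 1"
    proof
      assume "w = 1"
      then show False using w by simp
    qed
    have ww1: "w * w \<noteq> 1"
    proof
      assume "w * w = 1"
      then have "w + 2 = 0" using w by Groebner_Basis.algebra
      then have "(3 :: 'a) = 0" using w by Groebner_Basis.algebra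
      then show False by simp
    qed
    have www: "w * w \<noteq> w" using w0 w1 by auto
    have two: "pmul 2 P = pneg P" if P: "on_curve E P" "pmul 3 P = At_Infinity" for P
    proof -
      have "pmul 2 P \<oplus>\<^sub>E P = pneg P \<oplus>\<^sub>E P" using P(2) padd_pneg[of P] by (simp add: eval_nat_numeral)
      then have "pmul 2 P \<oplus>\<^sub>E (P \<oplus>\<^sub>E pneg P) = pneg P \<oplus>\<^sub>E (P \<oplus>\<^sub>E pneg P)"
        using padd_assoc[OF on_curve_pmul[OF P(1)] P(1) pneg_on_curve[OF P(1)]]
          padd_assoc[OF pneg_on_curve[OF P(1)] P(1) pneg_on_curve[OF P(1)]] by metis
      moreover have "P \<oplus>\<^sub>E pneg P = At_Infinity"
        using padd_pneg padd_commute[OF P(1) pneg_on_curve[OF P(1)]] by metis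
      ultimately show ?thesis by simp
    qed
    have inj: "f x = At_Infinity \<Longrightarrow> x = (0, 0)" if "x \<in> {0..<3} \<times> {0..<3}" for x
    proof -
      have A2: "pmul 2 A = Affine 0 (- 1)" using two[OF AB(1,3)] by (simp add: A_def)
      have B2: "pmul 2 B = Affine (- 1) (- w - 1)" using two[OF AB(2,4)] by (simp add: B_def)
      have "i \<in> {0, 1, 2}" "j \<in> {0, 1, 2}" if "i \<in> {0..<3}" "j \<in> {0..<3}" for i j :: int using that by auto
      then have "fst x \<in> {0, 1, 2}" "snd x \<in> {0, 1, 2}" using that by (cases x; force)+
      moreover assume "f x = At_Infinity"
      ultimately show "x = (0, 0)"
        by (cases x) (auto simp: f_def A2 B2 line_sum_def Let_def, auto simp: A_def B_def line_sum_def Let_def)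
    qed
    have "inj_on f (carrier ?H)" unfolding cH
    proof (rule inj_onI)
      fix x y :: "int \<times> int" assume xy: "x \<in> {0..<3} \<times> {0..<3}" "y \<in> {0..<3} \<times> {0..<3}" "f x = f y"
      obtain i j i' j' where e: "x = (i, j)" "y = (i', j')" by (cases x; cases y)
      \<comment> \<open>The difference of x and y in the product group; adding 3 - i' instead of
        subtracting i' keeps the argument of \<open>nat\<close> nonnegative.\<close>
      define z where "z = ((i + (3 - i')) mod 3, (j + (3 - j')) mod 3)"
      have r: "0 \<le> i" "i < 3" "0 \<le> j" "j < 3" "0 \<le> i'" "i' < 3" "0 \<le> j'" "j' < 3" using xy(1,2) by (auto simp: e)
      have s: "0 \<le> 3 - i'" "0 \<le> 3 - j'" using r by auto
      define n where "n = pmul (nat (3 - i')) A \<oplus>\<^sub>E pmul (nat (3 - j')) B"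
      have "f z = f x \<oplus>\<^sub>E n"
        by (simp only: z_def f_def e prod.case n_def red[OF AB(1,3) r(1) s(1)] red[OF AB(2,4) r(3) s(2)]
            exch[OF on(1) on(1) on(2) on(2)])
      also have "\<dots> = f ((i' + (3 - i')) mod 3, (j' + (3 - j')) mod 3)" unfolding xy(3)
        by (simp only: f_def e prod.case n_def red[OF AB(1,3) r(5) s(1)] red[OF AB(2,4) r(7) s(2)]
            exch[OF on(1) on(1) on(2) on(2)])
      also have "\<dots> = At_Infinity" by (simp add: f_def)
      finally have "z = (0, 0)" by (rule inj[rotated]) (simp add: z_def)
      then have "(i + (3 - i')) mod 3 = 0" "(j + (3 - j')) mod 3 = 0" by (auto simp: z_def)
      then have "i = i'" "j = j'" using r by presburger+
      then show "x = y" by (simp add: e)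
    qed
    moreover have "f ` carrier ?H = carrier G"
    proof (rule card_seteq)
      let ?N = "{At_Infinity, Affine 0 0, Affine 0 (- 1)} \<union>
        (\<lambda>(x, y). Affine x y) ` ({- 1, - w, - (w * w)} \<times> {w, w * w})"
      have sub: "carrier G \<subseteq> ?N" using three_torsion_points unfolding C(1) by fastforce
      then show "finite (carrier G)" by (rule finite_subset) simp
      show "f ` carrier ?H \<subseteq> carrier G" using fin by blast
      have "card (f ` carrier ?H) = card (carrier ?H)" by (rule card_image) fact
      also have "\<dots> = 9" unfolding cH card_cartesian_product by simp
      finally have "card (f ` carrier ?H) = 9" .
      moreover have "card (carrier G) \<le> card ?N" by (rule card_mono[OF _ sub]) simp
      moreover have "card ?N \<le> 3 + 6"
      proof (rule order_trans[OF card_Un_le add_mono])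
        show "card {At_Infinity, Affine 0 0, Affine 0 (- 1 :: 'a)} \<le> 3" by simp
        have "card ((\<lambda>(x, y). Affine x y) ` ({- 1, - w, - (w * w)} \<times> {w, w * w}))
            \<le> card ({- 1, - w, - (w * w)} \<times> {w, w * w})" by (rule card_image_le) simp
        also have "\<dots> = card {- 1, - w, - (w * w)} * card {w, w * w}" by (rule card_cartesian_product)
        also have "\<dots> \<le> 3 * 2" by (intro mult_mono card_insert_le_m1) (auto simp: card_insert_if)
        finally show "card ((\<lambda>(x, y). Affine x y) ` ({- 1, - w, - (w * w)} \<times> {w, w * w})) \<le> 6" by simp
      qed
      ultimately show "card (carrier G) \<le> card (f ` carrier ?H)" by linarith
    qed
    ultimately show ?thesis by (simp add: bij_betw_def)
  qed
  ultimately have "f \<in> iso ?H G" by (simp add: iso_def)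
  then have "?H \<cong> G" by (auto simp: is_iso_def)
  moreover have "group ?H" by (intro DirProd_group) simp_all
  ultimately show ?thesis using group.iso_sym by blast
qed

end

section \<open>Identification of the base field and conclusion\<close>

lemma rat_adjoin_eq_cyclotomic3:
  fixes r :: "'a::field_char_0"
  assumes r: "r ^ 2 = - 3"
  shows "rat_adjoin r = cyclotomic3 ((r - 1) / 2)" "omega ((r - 1) / 2)"
proof -
  define w where "w = (r - 1) / 2"
  have "4 * (w * w + w + 1) = r ^ 2 + 3" by (simp add: w_def field_simps power2_eq_square)
  then have "4 * (w * w + w + 1) = 0" unfolding r by simp
  then have "w * w + w + 1 = 0" unfolding mult_eq_0_iff by simp
  then show om: "omega ((r - 1) / 2)" unfolding w_def[symmetric] omega_def by simp
  interpret omega w using om unfolding w_def .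
  interpret A: field "ambient :: 'a ring" by (rule field_from_type_algebra)
  note C = is_field_set_cyclotomic3
  have "subfield (rat_adjoin r) ambient" unfolding rat_adjoin_def
    by (rule A.generate_field_is_subfield) (simp add: ambient_simps)
  then have R: "is_field_set (rat_adjoin r)" by (rule is_field_set_subfield)
  have "r \<in> rat_adjoin r" unfolding rat_adjoin_def by (rule generate_field.incl) simp
  then have w_R: "w \<in> rat_adjoin r" unfolding w_def
    by (intro fs_divide[OF R] fs_diff[OF R] fs_one[OF R] fs_numeral[OF R])
  have "rat_adjoin r \<subseteq> cyclotomic3 w" unfolding rat_adjoin_def
  proof (rule generate_field_subset[OF C])
    have "1 + 2 * w \<in> cyclotomic3 w" by (intro fs_add[OF C] fs_mult[OF C] fs_one[OF C] fs_numeral[OF C] w_in)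
    moreover have "1 + 2 * w = r" unfolding w_def by (simp add: field_simps)
    ultimately show "{r} \<subseteq> cyclotomic3 w" by simp
  qed
  moreover have "ev p \<in> rat_adjoin r" for p
    unfolding eis_eval_def by (intro fs_add[OF R] fs_mult[OF R] fs_of_int[OF R] w_R)
  then have "cyclotomic3 w \<subseteq> rat_adjoin r" using fs_divide[OF R] by (auto simp: cyclotomic3_def)
  ultimately show "rat_adjoin r = cyclotomic3 ((r - 1) / 2)" unfolding w_def by blast
qed

lemma J1_3_9_simps:
  "carrier (J1_3_9 K) = {P. on_curve curve_27a3 P \<and> defined_over K P}"
  "monoid.mult (J1_3_9 K) = point_add curve_27a3"
  "one (J1_3_9 K) = At_Infinity"
  by (simp_all add: J1_3_9_def rational_points_def)

lemma J1_3_9_pow: "P [^]\<^bsub>J1_3_9 K\<^esub> (n :: nat) = pmul n P"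
  unfolding nat_pow_def J1_3_9_simps by (induction n) simp_all

theorem theorem4p10:
  fixes K :: "'a::field_char_0 set" and sqrt_m3 :: 'a
  assumes "multiquadratic_number_field K"
    and "sqrt_m3 ^ 2 = -3"
    and "rat_adjoin sqrt_m3 \<subseteq> K"
  shows "torsion_subgroup (J1_3_9 K) = J1_3_9 (rat_adjoin sqrt_m3) \<and>
         J1_3_9 (rat_adjoin sqrt_m3) \<cong> integer_mod_group 3 \<times>\<times> integer_mod_group 3"
proof -
  let ?w = "(sqrt_m3 - 1) / 2"
  note F = rat_adjoin_eq_cyclotomic3[OF assms(2)]
  interpret omega ?w by (rule F(2))
  \<comment> \<open>Over the base field every point is killed by 3 and every point killed by 3 is
    rational, so the group is exactly E[3].\<close>
  have carrier: "carrier (J1_3_9 (rat_adjoin sqrt_m3)) = {P. on_curve curve_27a3 P \<and> pmul 3 P = At_Infinity}"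
    using cyclotomic_points three_torsion_defined_over unfolding J1_3_9_simps F(1) by blast
  have over_K: "defined_over K P" if "defined_over (rat_adjoin sqrt_m3) P" for P :: "'a point"
    using that assms(3) by (cases P) auto
  have "{P \<in> carrier (J1_3_9 K). \<exists>n::nat. n > 0 \<and> P [^]\<^bsub>J1_3_9 K\<^esub> n = \<one>\<^bsub>J1_3_9 K\<^esub>}
      = carrier (J1_3_9 (rat_adjoin sqrt_m3))"
    (is "?tors = _")
  proof
    show "?tors \<subseteq> carrier (J1_3_9 (rat_adjoin sqrt_m3))"
      unfolding carrier using multiquadratic_torsion[OF assms(1)] by (auto simp: J1_3_9_simps J1_3_9_pow)
    show "carrier (J1_3_9 (rat_adjoin sqrt_m3)) \<subseteq> ?tors"
    proof
      fix P assume P: "P \<in> carrier (J1_3_9 (rat_adjoin sqrt_m3))"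
      then have "P \<in> carrier (J1_3_9 K)" using over_K by (auto simp: J1_3_9_simps)
      moreover have "pmul 3 P = At_Infinity" using P unfolding carrier by simp
      ultimately show "P \<in> ?tors" by (auto simp: J1_3_9_pow J1_3_9_simps(3) intro: exI[of _ "3 :: nat"])
    qed
  qed
  then have "torsion_subgroup (J1_3_9 K) = J1_3_9 (rat_adjoin sqrt_m3)"
    unfolding torsion_subgroup_def by (simp add: J1_3_9_def rational_points_def)
  moreover have "J1_3_9 (rat_adjoin sqrt_m3) \<cong> integer_mod_group 3 \<times>\<times> integer_mod_group 3"
    by (rule three_torsion_group_iso[OF carrier J1_3_9_simps(2)])
  ultimately show ?thesis by blast
qed

end
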